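(* Let $d\ge 1$, $r>0$, $\theta>0$, $\mu\in\mathbb{R}^d$, let $s\in[r,d+r)$ and let $q$ be defined by $1-q=\frac{d+r}{d+r-s}$ (so $q=-\frac{s}{d+r-s}<0$). Let $X$ be an $\mathbb{R}^d$-valued random variable with distribution $P=f\cdot\lambda_d$ such that $\mathbb{E}|X|^{r+\delta}<+\infty$ for some $\delta>0$ with $r+\delta>\frac{sd}{d+r-s}$, and let $(a_n)_{n\ge1}$ be an $L^r$-optimal greedy quantization sequence of $X$. Let $\eta\in\big(0,\,r+\delta-\frac{sd}{d+r-s}\big)$ and let $p'=\frac{r+\delta-\eta}{d|q|}$ and $q'=\frac{r+\delta-\eta}{r+\delta-\eta-d|q|}$, which are conjugate exponents larger than $1$. Assume $$\int_{\{f>0\}}\Big(\frac{f_{\theta,\mu}}{f}\Big)^{(1-q)q'}f\,d\lambda_d<+\infty .$$ Then, for every $n\ge 3$, $$e_s\big(a^{(n)}_{\theta,\mu},P\big)\le \theta^{1+\frac ds}\,\kappa\,\left(\int_{\{f>0\}}\Big(\frac{f_{\theta,\mu}}{f}\Big)^{(1-q)q'}f\,d\lambda_d\right)^{\frac{1}{q'|q|(d+r)}}\sigma_{r+\delta}(P)\,(n-2)^{-\frac1d},$$ where $\sigma_{r+\delta}(P)=e_{r+\delta}(a^{(1)},P)=\big(\mathbb{E}|X-a_1|^{r+\delta}\big)^{\frac1{r+\delta}}<+\infty$ and $$\kappa=2^{\frac1d+\frac{r+\delta}{r+d}\left(1+\frac{1}{|q|p'}\right)}\,V_d^{-\frac1d}\Big(\frac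 rd\Big)^{\frac{r}{d(d+r)}}\min_{\varepsilon\in(0,\frac13)}\Big[(1+\varepsilon)\varphi_r(\varepsilon)^{-\frac1d}\Big]\left(\int_{\mathbb{R}^d}(1\vee|x|)^{-d\frac{r+\delta}{r+\delta-\eta}}dx\right)^{\frac1d}.$$
   Context: $|\cdot|$ is a fixed norm on $\mathbb{R}^d$, $\lambda_d$ is Lebesgue measure on $\mathbb{R}^d$, $V_d$ is the $\lambda_d$-volume of the unit ball of $|\cdot|$, and $u\vee v=\max(u,v)$. For a finite set $\Gamma\subset\mathbb{R}^d$ and a probability distribution $P$ on $\mathbb{R}^d$ (the law of $X$), the $L^s$-quantization error is $e_s(\Gamma,P)=e_s(\Gamma,X)=\big(\int \min_{x\in\Gamma}|\xi-x|^s\,dP(\xi)\big)^{1/s}$, $s>0$. An $L^r$-optimal greedy quantization sequence of $X$ (with $\mathbb{E}|X|^r<\infty$) is a sequence $(a_n)_{n\ge1}$ in $\mathbb{R}^d$ such that, with $a^{(0)}=\varnothing$ and $a^{(n)}=\{a_1,\dots,a_n\}$, one has $a_{n+1}\in\operatorname{argmin}_{\xi\in\mathbb{R}^d}e_r(a^{(n)}\cup\{\xi\},X)$ for every $n\ge0$; in particular $a_1$ is an $L^r$-median of $P$. For $\theta>0$, $\mu\in\mathbb{R}^d$: $a^{(n)}_{\theta,\mu}=\{\mu+\theta(a_i-\mu):1\le i\le n\}$ and $f_{\theta,\mu}(x)=f(\mu+\theta(x-\mu))$. Finally $\varphi_r(u)=\big(\frac1{3^r}-u^r\big)u^d$ for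 $u\in(0,\frac13)$.
   Formalization: The formal theorem additionally assumes that f_{θ,μ}=0 almost everywhere on {f=0}; without this the claim fails, e.g. for P uniform on [0,1], θ=1/2, μ=10, where the integral over {f>0} is 0 but the error is positive. *)

theory Defs
  imports "HOL-Probability.Probability"
begin

definition is_norm :: "(real ^ 'd \<Rightarrow> real) \<Rightarrow> bool" where
  "is_norm N \<longleftrightarrow>
     (\<forall>x. 0 \<le> N x) \<and> (\<forall>x. N x = 0 \<longleftrightarrow> x = 0) \<and>
     (\<forall>c x. N (c *\<^sub>R x) = \<bar>c\<bar> * N x) \<and>
     (\<forall>x y. N (x + y) \<le> N x + N y)"

definition unit_ball_volume :: "(real ^ 'd \<Rightarrow> real) \<Rightarrow> real" where
  "unit_ball_volume N = measure lborel {x. N x \<le> 1}"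

(* Power with exponent p > 0 on [0, \<infinity>].  The library has no powr on ennreal, and with real-valued
   errors an infinite error would be read as 0. *)
definition epowr :: "ennreal \<Rightarrow> real \<Rightarrow> ennreal" where
  "epowr x p = (if x = \<infinity> then \<infinity> else ennreal (enn2real x powr p))"

(* Only meaningful for finite non-empty \<Gamma>. *)
definition quant_error ::
    "(real ^ 'd \<Rightarrow> real) \<Rightarrow> real \<Rightarrow> (real ^ 'd) set \<Rightarrow> (real ^ 'd) measure \<Rightarrow> ennreal" where
  "quant_error N s \<Gamma> P =
     epowr (\<integral>\<^sup>+ \<xi>. ennreal (MIN x\<in>\<Gamma>. N (\<xi> - x) powr s) \<partial>P) (1 / s)"

(* Sequences are indexed from 1; the value at index 0 is never used. *)
definition first_points :: "(nat \<Rightarrow> 'a) \<Rightarrow> nat \<Rightarrow> 'a set" where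
  "first_points a n = a ` {1..n}"

definition greedy_sequence ::
    "(real ^ 'd \<Rightarrow> real) \<Rightarrow> real \<Rightarrow> (real ^ 'd) measure \<Rightarrow> (nat \<Rightarrow> real ^ 'd) \<Rightarrow> bool" where
  "greedy_sequence N r P a \<longleftrightarrow>
     integrable P (\<lambda>x. N x powr r) \<and>
     (\<forall>n. is_arg_min (\<lambda>\<xi>. quant_error N r (first_points a n \<union> {\<xi>}) P) (\<lambda>_. True) (a (Suc n)))"

definition dilate_set :: "real \<Rightarrow> real ^ 'd \<Rightarrow> (real ^ 'd) set \<Rightarrow> (real ^ 'd) set" where
  "dilate_set \<theta> \<mu> \<Gamma> = (\<lambda>x. \<mu> + \<theta> *\<^sub>R (x - \<mu>)) ` \<Gamma>"

definition dilate_fun :: "real \<Rightarrow> real ^ 'd \<Rightarrow> (real ^ 'd \<Rightarrow> real) \<Rightarrow> real ^ 'd \<Rightarrow> real" where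
  "dilate_fun \<theta> \<mu> f x = f (\<mu> + \<theta> *\<^sub>R (x - \<mu>))"

definition phi :: "real \<Rightarrow> real \<Rightarrow> real \<Rightarrow> real" where
  "phi d r u = (1 / 3 powr r - u powr r) * u powr d"

(* The minimum over the open interval is written as an infimum; phi_min_attained below shows that
   it is attained. *)
definition kappa ::
    "(real ^ 'd \<Rightarrow> real) \<Rightarrow> real \<Rightarrow> real \<Rightarrow> real \<Rightarrow> real \<Rightarrow> real \<Rightarrow> real" where
  "kappa N r \<delta> \<eta> q p' =
     (let d = real CARD('d) in
        2 powr (1 / d + (r + \<delta>) / (r + d) * (1 + 1 / (\<bar>q\<bar> * p')))
        * unit_ball_volume N powr (- 1 / d)
        * (r / d) powr (r / (d * (d + r)))
        * (INF \<epsilon>\<in>{0<..<1/3}. (1 + \<epsilon>) * phi d r \<epsilon> powr (- 1 / d))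
        * (\<integral>x. max 1 (N x) powr (- d * ((r + \<delta>) / (r + \<delta> - \<eta>))) \<partial>lborel) powr (1 / d))"

lemma phi_min_attained:
  fixes d r :: real
  assumes "0 < d" "0 < r"
  shows "\<exists>\<epsilon>\<in>{0<..<1/3}.
    (INF \<epsilon>\<in>{0<..<1/3}. (1 + \<epsilon>) * phi d r \<epsilon> powr (- 1 / d)) =
      (1 + \<epsilon>) * phi d r \<epsilon> powr (- 1 / d) \<and>
    (\<forall>u\<in>{0<..<1/3}. (1 + \<epsilon>) * phi d r \<epsilon> powr (- 1 / d) \<le> (1 + u) * phi d r u powr (- 1 / d))"
proof -
  define G where "G = (\<lambda>u. (1 + u) * phi d r u powr (- 1 / d))"
  define H where "H = (\<lambda>u. phi d r u * (1 + u) powr (- d))"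
  have phi_pos: "0 < phi d r u" if "u \<in> {0<..<1/3}" for u
  proof -
    have "u powr r < (1 / 3) powr r"
      using that assms by (intro powr_less_mono2) auto
    then show ?thesis
      using that by (auto simp: phi_def powr_divide)
  qed
  have G_H: "G u = H u powr (- 1 / d)" if "u \<in> {0<..<1/3}" for u
    using phi_pos[OF that] that assms
    by (simp add: G_def H_def powr_mult powr_powr)
  have H_pos: "0 < H u" if "u \<in> {0<..<1/3}" for u
    using phi_pos[OF that] that by (simp add: H_def)
  have "continuous_on {0..1/3} H"
    unfolding H_def phi_def using assms
    by (intro continuous_intros continuous_on_powr') auto
  then obtain e where e: "e \<in> {0..1/3}" "\<And>u. u \<in> {0..1/3} \<Longrightarrow> H u \<le> H e"
    using continuous_attains_sup[of "{0..1/3::real}" H] by auto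
  have "0 < H e"
    using H_pos[of "1/6"] e(2)[of "1/6"] by simp
  moreover have "H 0 = 0" "H (1/3) = 0"
    using assms by (simp_all add: H_def phi_def powr_divide)
  ultimately have "e \<noteq> 0" "e \<noteq> 1/3"
    by (metis less_irrefl)+
  with e(1) have e_in: "e \<in> {0<..<1/3}"
    by auto
  have e_min: "G e \<le> G u" if "u \<in> {0<..<1/3}" for u
    unfolding G_H[OF that] G_H[OF e_in]
    using H_pos[OF that] e(2)[of u] that assms
    by (intro powr_mono2') auto
  have "(INF u\<in>{0<..<1/3}. G u) = G e"
    using e_in e_min by (intro cInf_eq_minimum) auto
  then show ?thesis
    using e_in e_min unfolding G_def by blast
qed

end

theory Submission
  imports Defs
begin

text \<open>
  Write \<open>p = r + \<delta>\<close>, \<open>\<rho> = p - \<eta>\<close>, \<open>\<alpha> = \<rho> / p\<close>, \<open>M = d / \<rho>\<close>, \<open>D n\<close> for the distance to the first \<open>n\<close>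
  points, \<open>\<sigma>\<close> for the \<open>p\<close>-th moment norm of \<open>N (X - a 1)\<close> and \<open>Y = (N (X - a 1) / \<sigma>) powr p\<close>, so that
  \<open>Y\<close> has mean 1.

  The change of variables \<open>\<xi> = \<mu> + \<theta> (x - \<mu>)\<close> and Hoelder's inequality with exponent \<open>(1 - q) q'\<close> turn the
  error of the dilated points into the \<open>L\<^sup>t\<close> error of the original ones, \<open>t = \<rho> (d + r) / (d + \<rho>)\<close>.

  A greedy point does at least as well as a point drawn at random. Drawing it with density proportional
  to \<open>G ((N (y - a 1) / (2 \<sigma>)) powr p)\<close>, \<open>G\<close> nonincreasing, shows that the \<open>r\<close>-th power of the
  \<open>L\<^sup>r\<close> error drops at step \<open>n\<close> by at least a multiple of the mean of \<open>G Y * D n powr (d + r)\<close>.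
  Hoelder then gives a recursion for the \<open>L\<^sup>r\<close> error, which decays like \<open>n powr (- 1 / d)\<close>. For the \<open>L\<^sup>t\<close>
  error, run the first half of the steps to make the \<open>L\<^sup>r\<close> error small, and sum the gains over the second
  half: if \<open>D n\<close> were large in \<open>L\<^sup>t\<close>, these gains would exceed the \<open>L\<^sup>r\<close> error that is left, by a
  pointwise Young inequality linking \<open>G Y\<close> and \<open>D n powr t\<close>.

  The constant \<open>\<kappa>\<close> is reached by a suitable \<open>G\<close>: a single cut-off power if \<open>p \<ge> 1\<close>, and two powers with
  exponents on either side of the critical one if \<open>p < 1\<close>.
\<close>

section \<open>Inequalities for powers\<close>

text \<open>The right side is the perspective \<open>Z * (w / Z) powr (M + 1)\<close> of a convex
  power, the left side its supporting plane along \<open>w = Z\<close>. With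
  \<open>v = w / Z\<close> this is Bernoulli's inequality, read off from Young's inequality with
  weights \<open>1 / (M + 1)\<close> and \<open>M / (M + 1)\<close>. Being affine in
  \<open>w\<close> and \<open>Z\<close>, the lower bound can be integrated directly.\<close>

lemma perspective_tangent:
  fixes M w Z :: real
  assumes "0 < M" "0 \<le> w" "0 < Z"
  shows "(M + 1) * w - M * Z \<le> Z powr (- M) * w powr (M + 1)"
proof (cases "w = 0")
  case True
  then show ?thesis using assms by auto
next
  case False
  define v where "v = w / Z"
  have v: "0 < v" and w: "w = Z * v" using False assms by (auto simp: v_def)
  have "1 + (M + 1) * (v - 1) \<le> v powr (M + 1)"
  proof -
    have "1 / (M + 1) + M / (M + 1) = 1"
      using assms by (simp add: field_simps)
    then have "v \<le> (v powr (M + 1) + M) / (M + 1)"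
      using Youngs_inequality_0[of "1 / (M + 1)" "M / (M + 1)" "v powr (M + 1)" 1] assms v
      by (simp add: powr_powr add_divide_distrib)
    then show ?thesis
      using assms by (simp add: pos_le_divide_eq algebra_simps)
  qed
  then have "Z * (1 + (M + 1) * (v - 1)) \<le> Z * v powr (M + 1)"
    using assms by (intro mult_left_mono) auto
  also have "\<dots> = Z powr (- M) * w powr (M + 1)"
    using assms v by (simp add: w powr_mult powr_add powr_minus field_simps)
  finally show ?thesis
    by (simp add: w algebra_simps)
qed

text \<open>The maximum of \<open>(1 - y) * y powr M\<close> over \<open>y > 0\<close>.\<close>

definition peak :: "real \<Rightarrow> real" where
  "peak M = (M / (M + 1)) powr M / (M + 1)"

lemma peak_pos: "0 < M \<Longrightarrow> 0 < peak M"
  by (simp add: peak_def)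

text \<open>Rescaling \<open>Z\<close> by \<open>(M + 1) / M\<close> in the tangent inequality makes
  the coefficients of \<open>w\<close> and \<open>Z\<close> equal; dividing by \<open>M + 1\<close>
  then leaves the constant \<open>peak M\<close>.\<close>

lemma peak_tangent:
  fixes M w Z :: real
  assumes "0 < M" "0 \<le> w" "0 < Z"
  shows "w - Z \<le> peak M * Z powr (- M) * w powr (M + 1)"
proof -
  define l where "l = (M + 1) / M"
  have l: "0 < l" using assms by (simp add: l_def)
  have "(M + 1) * w - M * (l * Z) \<le> (l * Z) powr (- M) * w powr (M + 1)"
    using assms l by (intro perspective_tangent) auto
  moreover have "(M + 1) * w - M * (l * Z) = (M + 1) * (w - Z)"
    using assms by (simp add: l_def field_simps)
  moreover have "(l * Z) powr (- M) = (M / (M + 1)) powr M * Z powr (- M)"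
    using assms by (simp add: l_def powr_mult powr_divide powr_minus_divide)
  ultimately have "(M + 1) * (w - Z) \<le> (M / (M + 1)) powr M * Z powr (- M) * w powr (M + 1)"
    by simp
  then show ?thesis
    using assms by (simp add: peak_def field_simps)
qed

text \<open>This amounts to \<open>((M + 1) / M) powr (M + 1) >= exp 1\<close>, because
  \<open>peak M * M\<close> is the reciprocal of that power.\<close>

lemma peak_le: "0 < M \<Longrightarrow> peak M \<le> 1 / (exp 1 * M)"
proof -
  assume M: "0 < M"
  have "1 - 1 / (1 + 1/M) \<le> ln (1 + 1/M)"
    using ln_le_minus_one[of "1 / (1 + 1/M)"] M by (simp add: ln_div field_simps add_pos_pos)
  then have "1 / (M + 1) \<le> ln (1 + 1/M)"
    using M by (simp add: field_simps)
  then have "1 \<le> (M + 1) * ln (1 + 1/M)"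
    using M by (simp add: field_simps)
  then have "exp 1 \<le> exp ((M + 1) * ln (1 + 1/M))" by simp
  also have "\<dots> = ((M + 1) / M) powr (M + 1)"
    using M by (simp add: powr_def field_simps)
  finally have 1: "exp 1 \<le> ((M + 1) / M) powr (M + 1)" .
  have "peak M * M = (M / (M + 1)) powr (M + 1)"
    using M by (simp add: peak_def powr_add)
  also have "\<dots> = 1 / ((M + 1) / M) powr (M + 1)"
    using M by (simp add: powr_divide)
  also have "\<dots> \<le> 1 / exp 1"
    using 1 M by (intro divide_left_mono mult_pos_pos) auto
  finally show ?thesis using M by (simp add: field_simps)
qed

text \<open>Discrete form of the differential inequality
  \<open>E' <= - A * E powr (1 + 1 / x)\<close>: each step raises \<open>E n powr (- 1 / x)\<close>
  by at least \<open>A / x\<close>. The start value enters only through the sign of its power, so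
  the \<open>m - 1\<close> steps from 1 to \<open>m\<close> give a bound free of
  \<open>E 1\<close>.\<close>

lemma decay_of_power_recursion:
  fixes E :: "nat \<Rightarrow> real" and A x :: real
  assumes x: "0 < x" and A: "0 < A"
    and E_nonneg: "\<And>n. 1 \<le> n \<Longrightarrow> 0 \<le> E n"
    and step: "\<And>n. 1 \<le> n \<Longrightarrow> A * E n powr (1 + 1 / x) \<le> E n - E (Suc n)"
    and m: "2 \<le> m"
  shows "E m powr (1 / x) \<le> x / (A * (real m - 1))"
proof (cases "E m = 0")
  case True
  then show ?thesis using x A m by simp
next
  case False
  have dec: "E (Suc n) \<le> E n" if "1 \<le> n" for n
    using step[OF that] A by (smt (verit) mult_nonneg_nonneg powr_ge_zero)
  have "E m \<le> E n" if "1 \<le> n" "n \<le> m" for n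
    using that(2,1) by (induction rule: inc_induct) (auto intro: order_trans[OF _ dec])
  with False E_nonneg[of m] m have pos: "0 < E n" if "1 \<le> n" "n \<le> m" for n
    using that by fastforce
  have incr: "E n powr (- 1 / x) + A / x \<le> E (Suc n) powr (- 1 / x)" if "1 \<le> n" "n < m" for n
  proof -
    have p: "0 < E n" "0 < E (Suc n)" using pos that by auto
    \<comment> \<open>For this ratio, \<open>- ln v\<close> lies between \<open>1 - v\<close> and
      \<open>x * (v powr (- 1 / x) - 1)\<close>, which links the decrease of \<open>E\<close> to the
      increase of its negative power.\<close>
    define v where "v = E (Suc n) / E n"
    have v: "0 < v" using p by (simp add: v_def)
    have "1 / x * (1 - v) \<le> 1 / x * - ln v"
      using ln_le_minus_one[OF v] x by (intro mult_left_mono) auto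
    also have "1 / x * - ln v \<le> exp (- (1 / x) * ln v) - 1"
      using exp_ge_add_one_self[of "- (1 / x) * ln v"] by simp
    also have "\<dots> = v powr (- 1 / x) - 1"
      using v by (simp add: powr_def)
    finally have 1: "1 / x * (1 - v) \<le> v powr (- 1 / x) - 1" .
    have "A * E n powr (1 / x) \<le> 1 - v"
      using step[of n] that p by (simp add: v_def powr_add field_simps)
    then have "1 / x * (A * E n powr (1 / x)) \<le> 1 / x * (1 - v)"
      using x by (intro mult_left_mono) auto
    with 1 have "E n powr (- 1 / x) * (1 / x * (A * E n powr (1 / x)))
        \<le> E n powr (- 1 / x) * (v powr (- 1 / x) - 1)"
      by (intro mult_left_mono) auto
    moreover have "E n powr (- 1 / x) * v powr (- 1 / x) = E (Suc n) powr (- 1 / x)"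
      using p v by (subst powr_mult[symmetric]) (auto simp: v_def)
    moreover have "E n powr (- 1 / x) * E n powr (1 / x) = 1"
      using p by (simp add: powr_add[symmetric])
    ultimately show ?thesis by (simp add: algebra_simps)
  qed
  have "A / x * (real n - 1) \<le> E n powr (- 1 / x)" if "1 \<le> n" "n \<le> m" for n
    using that
  proof (induction n rule: dec_induct)
    case base
    then show ?case by simp
  next
    case (step n)
    then show ?case using incr[of n] by (auto simp: algebra_simps)
  qed
  then have "A / x * (real m - 1) \<le> E m powr (- 1 / x)" using m by auto
  then have "A / x * (real m - 1) \<le> 1 / E m powr (1 / x)"
    by (simp add: powr_minus_divide)
  moreover have "0 < E m powr (1 / x)" using pos[of m] m by simp
  ultimately show ?thesis
    using x A m by (simp add: field_simps)
qed

section \<open>Radial integrals for a norm\<close>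

lemma nn_integral_powr_from_0:
  fixes e c :: real
  assumes "- 1 < e" "0 \<le> c"
  shows "(\<integral>\<^sup>+ t. ennreal (t powr e) * indicator {0..c} t \<partial>lborel) = ennreal (c powr (e + 1) / (e + 1))"
proof -
  have int: "((\<lambda>t. if t \<in> {0..c} then t powr e else 0) has_integral c powr (e + 1) / (e + 1)) UNIV"
    using has_integral_powr_from_0[OF assms] by (simp only: has_integral_restrict_UNIV)
  moreover have "(\<integral>\<^sup>+ t. ennreal (t powr e) * indicator {0..c} t \<partial>lborel)
      = (\<integral>\<^sup>+ t. ennreal (if t \<in> {0..c} then t powr e else 0) \<partial>lborel)"
    by (intro nn_integral_cong) (auto simp: indicator_def)
  moreover have "(\<integral>\<^sup>+ t. ennreal (if t \<in> {0..c} then t powr e else 0) \<partial>lborel)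
      = ennreal (c powr (e + 1) / (e + 1))"
    by (rule nn_integral_has_integral_lborel[OF _ _ int]) auto
  ultimately show ?thesis by simp
qed

lemma nn_integral_powr_to_inf:
  fixes e c :: real
  assumes "e < - 1" "0 < c"
  shows "(\<integral>\<^sup>+ t. ennreal (t powr e) * indicator {c..} t \<partial>lborel) = ennreal (c powr (e + 1) / (- e - 1))"
proof -
  have int: "((\<lambda>t. if t \<in> {c..} then t powr e else 0) has_integral - (c powr (e + 1)) / (e + 1)) UNIV"
    using has_integral_powr_to_inf[OF assms] by (simp only: has_integral_restrict_UNIV)
  moreover have "(\<integral>\<^sup>+ t. ennreal (t powr e) * indicator {c..} t \<partial>lborel)
      = (\<integral>\<^sup>+ t. ennreal (if t \<in> {c..} then t powr e else 0) \<partial>lborel)"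
    by (intro nn_integral_cong) (auto simp: indicator_def)
  moreover have "(\<integral>\<^sup>+ t. ennreal (if t \<in> {c..} then t powr e else 0) \<partial>lborel)
      = ennreal (- (c powr (e + 1)) / (e + 1))"
    by (rule nn_integral_has_integral_lborel[OF _ _ int]) auto
  moreover have "- (c powr (e + 1)) / (e + 1) = c powr (e + 1) / (- e - 1)"
    using assms by (simp add: field_simps)
  ultimately show ?thesis by simp
qed

text \<open>\<open>N\<close> is an arbitrary norm given as a function, so continuity, measurability
  and the volume of its balls are derived here by comparison with the Euclidean norm.\<close>

locale vec_norm =
  fixes N :: "real ^ 'd \<Rightarrow> real" and d :: real
  assumes is_norm: "is_norm N" and d_eq: "d = real CARD('d)"
begin

abbreviation (input) "V \<equiv> unit_ball_volume N"

lemma d_ge_1: "1 \<le> d"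
  using zero_less_card_finite[where 'a='d] unfolding d_eq by linarith

lemma N_nonneg [simp]: "0 \<le> N x"
  and N_eq_0_iff [simp]: "N x = 0 \<longleftrightarrow> x = 0"
  and N_scaleR: "N (c *\<^sub>R x) = \<bar>c\<bar> * N x"
  and N_triangle: "N (x + y) \<le> N x + N y"
  using is_norm by (auto simp: is_norm_def)

lemma N_zero [simp]: "N 0 = 0"
  by simp

lemma N_le_0_iff [simp]: "N x \<le> 0 \<longleftrightarrow> x = 0"
  using N_nonneg[of x] by (auto simp del: N_nonneg dest: antisym)

lemma N_pos_iff [simp]: "0 < N x \<longleftrightarrow> x \<noteq> 0"
  using N_le_0_iff[of x] by (simp only: not_le[symmetric])

lemma N_minus [simp]: "N (- x) = N x"
  using N_scaleR[of "- 1" x] by simp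

lemma N_minus_commute: "N (x - y) = N (y - x)"
  using N_minus[of "x - y"] by simp

lemma N_sum_le: "finite A \<Longrightarrow> N (\<Sum>i\<in>A. f i) \<le> (\<Sum>i\<in>A. N (f i))"
  by (induction A rule: finite_induct) (auto intro: order_trans[OF N_triangle])

lemma N_bounded_by_norm: obtains C where "0 < C" "\<And>x. N x \<le> C * norm x"
proof
  define C where "C = (\<Sum>i\<in>UNIV. N (axis i 1 :: real ^ 'd)) + 1"
  show "0 < C" by (simp add: C_def sum_nonneg add_nonneg_pos)
  fix x :: "real ^ 'd"
  have "N x = N (\<Sum>i\<in>UNIV. x $ i *\<^sub>R axis i 1)"
    using basis_expansion[of x] by (simp add: scalar_mult_eq_scaleR)
  also have "\<dots> \<le> (\<Sum>i\<in>UNIV. \<bar>x $ i\<bar> * N (axis i 1))"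
    by (rule order_trans[OF N_sum_le]) (auto simp: N_scaleR)
  also have "\<dots> \<le> (\<Sum>i\<in>UNIV. norm x * N (axis i 1))"
    by (intro sum_mono mult_right_mono component_le_norm_cart) auto
  also have "\<dots> \<le> C * norm x"
    by (simp add: C_def sum_distrib_left[symmetric] algebra_simps)
  finally show "N x \<le> C * norm x" .
qed

lemma continuous_on_N [continuous_intros]: "continuous_on A N"
proof -
  obtain C where C: "0 < C" "\<And>x. N x \<le> C * norm x" by (rule N_bounded_by_norm) blast
  have diff: "\<bar>N x - N y\<bar> \<le> C * norm (x - y)" for x y
    using N_triangle[of "x - y" y] N_triangle[of "y - x" x] C(2)[of "x - y"] N_minus_commute[of x y]
    by auto
  have "C-lipschitz_on A N"
    using C(1) diff by (intro lipschitz_onI) (auto simp: dist_norm)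
  then show ?thesis
    by (rule lipschitz_on_continuous_on)
qed

lemma N_measurable [measurable]: "N \<in> borel_measurable borel"
  by (intro borel_measurable_continuous_onI continuous_on_N)

lemma norm_bounded_by_N: obtains c where "0 < c" "\<And>x. c * norm x \<le> N x"
proof -
  obtain z where z: "z \<in> sphere 0 1" "\<And>x. x \<in> sphere 0 1 \<Longrightarrow> N z \<le> N x"
    using continuous_attains_inf[of "sphere (0 :: real ^ 'd) 1" N] continuous_on_N by auto
  have "0 < N z" using z(1) by auto
  moreover have "N z * norm x \<le> N x" for x
  proof (cases "x = 0")
    case False
    have "N z \<le> N ((1 / norm x) *\<^sub>R x)" using False by (intro z(2)) auto
    then show ?thesis using False by (simp add: N_scaleR field_simps)
  qed simp
  ultimately show thesis by (rule that)
qed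

text \<open>Euclidean balls inside and outside the unit ball of \<open>N\<close> make its volume
  positive and finite. Finiteness matters because \<open>measure\<close> would read an infinite
  volume as 0.\<close>

lemma emeasure_unit_ball: "emeasure lborel {x. N x \<le> 1} = ennreal V"
  and V_pos: "0 < V"
proof -
  obtain c where c: "0 < c" "\<And>x. c * norm x \<le> N x" by (rule norm_bounded_by_N) blast
  obtain C where C: "0 < C" "\<And>x. N x \<le> C * norm x" by (rule N_bounded_by_norm) blast
  have "{x. N x \<le> 1} \<subseteq> cball 0 (1 / c)"
  proof
    fix x assume "x \<in> {x. N x \<le> 1}"
    then have "c * norm x \<le> 1" using c(2)[of x] by simp
    then show "x \<in> cball 0 (1 / c)" using c(1) by (simp add: field_simps)
  qed
  then have "bounded {x. N x \<le> 1}" using bounded_cball bounded_subset by blast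
  then have fin: "emeasure lborel {x. N x \<le> 1} < \<infinity>" by (rule emeasure_bounded_finite)
  then show 1: "emeasure lborel {x. N x \<le> 1} = ennreal V"
    unfolding unit_ball_volume_def by (simp add: emeasure_eq_ennreal_measure top.not_eq_extremum)
  have "cball 0 (1 / C) \<subseteq> {x. N x \<le> 1}"
  proof
    fix x :: "real ^ 'd" assume "x \<in> cball 0 (1 / C)"
    then have "C * norm x \<le> 1" using C(1) by (simp add: field_simps)
    then show "x \<in> {x. N x \<le> 1}" using C(2)[of x] by simp
  qed
  then have "emeasure lborel (cball (0 :: real ^ 'd) (1 / C)) \<le> emeasure lborel {x. N x \<le> 1}"
    by (intro emeasure_mono) auto
  moreover have "0 < emeasure lborel (cball (0 :: real ^ 'd) (1 / C))"
    using C(1) by (simp add: emeasure_cball unit_ball_vol_pos)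
  ultimately have "0 < ennreal V" unfolding 1 by (rule less_le_trans[rotated])
  then show "0 < V" by simp
qed

lemma emeasure_N_ball:
  assumes "0 \<le> c"
  shows "emeasure lborel {x. N x \<le> c} = ennreal (V * c powr d)"
proof (cases "c = 0")
  case True
  then have "{x. N x \<le> c} = {0}" by auto
  then show ?thesis using True by simp
next
  case False
  with assms have c: "0 < c" by simp
  have "emeasure lborel {x. N x \<le> c}
      = emeasure (density (distr lborel borel (\<lambda>x. 0 + c *\<^sub>R x)) (\<lambda>_. \<bar>c\<bar> ^ DIM(real ^ 'd))) {x. N x \<le> c}"
    using lborel_affine[of c "0 :: real ^ 'd"] c by simp
  also have "\<dots> = ennreal (c ^ CARD('d)) * emeasure lborel {x. N x \<le> 1}"
    using c by (simp add: emeasure_density nn_integral_cmult emeasure_distr vimage_def N_scaleR field_simps)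
  also have "\<dots> = ennreal (V * c powr d)"
    using c by (simp add: emeasure_unit_ball powr_realpow d_eq ennreal_mult[symmetric] V_pos less_imp_le mult.commute)
  finally show ?thesis .
qed

text \<open>Polar coordinates for \<open>N\<close>: the volumes of the balls determine the image
  measure, since the half-lines \<open>{..a}\<close> are stable under intersection and generate the
  Borel sets.\<close>

lemma distr_N:
  "distr lborel borel N
    = density lborel (\<lambda>t. ennreal (d * V) * (ennreal (t powr (d - 1)) * indicator {0..} t))"
  (is "?L = density _ ?w")
proof (rule measure_eqI_generator_eq[where E="range (\<lambda>a::real. {..a})" and \<Omega>=UNIV and A="\<lambda>n. {..real n}"])
  show "Int_stable (range (\<lambda>a::real. {..a}))"
    by (auto simp: Int_stable_def)
  have eq: "emeasure ?L {..c} = (if c < 0 then 0 else ennreal (V * c powr d))" for c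
  proof -
    have "emeasure ?L {..c} = emeasure lborel {x. N x \<le> c}"
      by (subst emeasure_distr) (auto simp: vimage_def)
    moreover have "{x. N x \<le> c} = {}" if "c < 0"
      using that N_nonneg by (auto simp: not_le intro: less_le_trans)
    ultimately show ?thesis using emeasure_N_ball[of c] by auto
  qed
  fix X assume "X \<in> range (\<lambda>a::real. {..a})"
  then obtain c where X: "X = {..c}" by auto
  have "emeasure (density lborel ?w) {..c} = (\<integral>\<^sup>+ t. ennreal (d * V) * (ennreal (t powr (d - 1)) * indicator {0..c} t) \<partial>lborel)"
    by (subst emeasure_density) (auto intro!: nn_integral_cong simp: indicator_def)
  also have "\<dots> = ennreal (d * V) * (\<integral>\<^sup>+ t. ennreal (t powr (d - 1)) * indicator {0..c} t \<partial>lborel)"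
    by (intro nn_integral_cmult) auto
  also have "\<dots> = (if c < 0 then 0 else ennreal (V * c powr d))"
  proof (cases "c < 0")
    case False
    then show ?thesis
      using d_ge_1 V_pos by (subst nn_integral_powr_from_0) (auto simp: ennreal_mult[symmetric])
  qed auto
  finally show "emeasure ?L X = emeasure (density lborel ?w) X"
    by (simp add: X eq)
next
  show "emeasure ?L {..real n} \<noteq> \<infinity>" for n
    by (subst emeasure_distr) (auto simp: vimage_def emeasure_N_ball)
qed (auto simp: borel_eq_atMost UN_atMost_UNIV intro: real_arch_simple)

lemma nn_integral_radial:
  assumes [measurable]: "g \<in> borel_measurable borel"
  shows "(\<integral>\<^sup>+ z. g (N z) \<partial>lborel)
    = ennreal (d * V) * (\<integral>\<^sup>+ t. (ennreal (t powr (d - 1)) * indicator {0..} t) * g t \<partial>lborel)"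
proof -
  have "(\<integral>\<^sup>+ z. g (N z) \<partial>lborel) = (\<integral>\<^sup>+ t. g t \<partial>distr lborel borel N)"
    by (subst nn_integral_distr) auto
  also have "\<dots> = (\<integral>\<^sup>+ t. ennreal (d * V) * ((ennreal (t powr (d - 1)) * indicator {0..} t) * g t) \<partial>lborel)"
    unfolding distr_N by (subst nn_integral_density) (auto simp: mult_ac)
  finally show ?thesis by (simp add: nn_integral_cmult)
qed

text \<open>\<open>ennreal\<close> sends negative reals to 0, so the integrand is a positive part
  and lives on the ball of radius \<open>R\<close>. The value is what a unit density of candidate
  points saves at a location whose current distance is \<open>R\<close>.\<close>

lemma nn_integral_ball_deficit:
  assumes R: "0 \<le> R" and r: "0 < r"
  shows "(\<integral>\<^sup>+ z. ennreal (R powr r - N z powr r) \<partial>lborel) = ennreal (V * (r / (d + r)) * R powr (d + r))"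
proof (cases "R = 0")
  case True
  then show ?thesis using r by (simp add: ennreal_neg)
next
  case False
  with R have R: "0 < R" by simp
  have int: "((\<lambda>t. R powr r * t powr (d - 1) - t powr (d - 1 + r)) has_integral
     R powr r * (R powr (d - 1 + 1) / (d - 1 + 1)) - R powr (d - 1 + r + 1) / (d - 1 + r + 1)) {0..R}"
    using d_ge_1 r R by (intro has_integral_diff has_integral_mult_right has_integral_powr_from_0) auto
  have val: "R powr r * (R powr (d - 1 + 1) / (d - 1 + 1)) - R powr (d - 1 + r + 1) / (d - 1 + r + 1)
     = r / (d * (d + r)) * R powr (d + r)"
    using d_ge_1 r R by (simp add: powr_add field_simps)
  have "(\<integral>\<^sup>+ z. ennreal (R powr r - N z powr r) \<partial>lborel)
     = ennreal (d * V) * (\<integral>\<^sup>+ t. (ennreal (t powr (d - 1)) * indicator {0..} t) * ennreal (R powr r - t powr r) \<partial>lborel)"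
    by (rule nn_integral_radial) auto
  also have "(\<integral>\<^sup>+ t. (ennreal (t powr (d - 1)) * indicator {0..} t) * ennreal (R powr r - t powr r) \<partial>lborel)
    = (\<integral>\<^sup>+ t. ennreal (if t \<in> {0..R} then R powr r * t powr (d - 1) - t powr (d - 1 + r) else 0) \<partial>lborel)"
  proof (intro nn_integral_cong)
    fix t :: real
    have "R powr r - t powr r \<le> 0" if "R < t"
      using powr_mono2[of r R t] r R that by auto
    moreover have "t powr (d - 1) * (R powr r - t powr r) = R powr r * t powr (d - 1) - t powr (d - 1 + r)"
      by (simp only: powr_add right_diff_distrib mult_ac)
    ultimately show "ennreal (t powr (d - 1)) * indicator {0..} t * ennreal (R powr r - t powr r)
      = ennreal (if t \<in> {0..R} then R powr r * t powr (d - 1) - t powr (d - 1 + r) else 0)"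
      by (auto simp: indicator_def ennreal_neg ennreal_mult'[symmetric])
  qed
  also have "\<dots> = ennreal (r / (d * (d + r)) * R powr (d + r))"
  proof (rule nn_integral_has_integral_lborel)
    have "t powr (d - 1 + r) = t powr r * t powr (d - 1)" for t :: real
      by (simp only: powr_add mult_ac)
    then show "0 \<le> (if t \<in> {0..R} then R powr r * t powr (d - 1) - t powr (d - 1 + r) else 0)" for t
      using powr_mono2[of r t R] r by (auto intro!: mult_right_mono)
    show "((\<lambda>t. if t \<in> {0..R} then R powr r * t powr (d - 1) - t powr (d - 1 + r) else 0) has_integral
      r / (d * (d + r)) * R powr (d + r)) UNIV"
      using int unfolding val by (simp only: has_integral_restrict_UNIV)
  qed auto
  finally show ?thesis
    using d_ge_1 V_pos r by (simp add: ennreal_mult'[symmetric])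
qed

lemma nn_integral_two_powers:
  assumes "a < d" "d < b"
  shows "(\<integral>\<^sup>+ z. ennreal (if N z \<le> 1 then N z powr (- a) else N z powr (- b)) \<partial>lborel)
    = ennreal (V * d * (1 / (d - a) + 1 / (b - d)))"
proof -
  have "(\<integral>\<^sup>+ z. ennreal (if N z \<le> 1 then N z powr (- a) else N z powr (- b)) \<partial>lborel)
     = ennreal (d * V) * (\<integral>\<^sup>+ t. (ennreal (t powr (d - 1)) * indicator {0..} t) * ennreal (if t \<le> 1 then t powr (- a) else t powr (- b)) \<partial>lborel)"
    by (rule nn_integral_radial[of "\<lambda>t. ennreal (if t \<le> 1 then t powr (- a) else t powr (- b))"]) auto
  also have "(\<integral>\<^sup>+ t. (ennreal (t powr (d - 1)) * indicator {0..} t) * ennreal (if t \<le> 1 then t powr (- a) else t powr (- b)) \<partial>lborel)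
    = (\<integral>\<^sup>+ t. (ennreal (t powr (d - 1 - a)) * indicator {0..1} t) + ennreal (t powr (d - 1 - b)) * indicator {1..} t \<partial>lborel)"
  proof (intro nn_integral_cong_AE)
    \<comment> \<open>The two intervals overlap in the null set \<open>{1}\<close>.\<close>
    have "AE t in lborel. t \<noteq> (1 :: real)" by (rule AE_lborel_singleton)
    then show "AE t in lborel. (ennreal (t powr (d - 1)) * indicator {0..} t) * ennreal (if t \<le> 1 then t powr (- a) else t powr (- b))
      = (ennreal (t powr (d - 1 - a)) * indicator {0..1} t) + ennreal (t powr (d - 1 - b)) * indicator {1..} t"
    proof eventually_elim
      case (elim t)
      then show ?case
        by (auto simp: indicator_def ennreal_mult[symmetric] powr_add[symmetric])
    qed
  qed
  also have "\<dots> = (\<integral>\<^sup>+ t. ennreal (t powr (d - 1 - a)) * indicator {0..1} t \<partial>lborel)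
      + (\<integral>\<^sup>+ t. ennreal (t powr (d - 1 - b)) * indicator {1..} t \<partial>lborel)"
    by (intro nn_integral_add) auto
  also have "(\<integral>\<^sup>+ t. ennreal (t powr (d - 1 - a)) * indicator {0..1} t \<partial>lborel) = ennreal (1 / (d - a))"
    using assms(1) by (subst nn_integral_powr_from_0) auto
  also have "(\<integral>\<^sup>+ t. ennreal (t powr (d - 1 - b)) * indicator {1..} t \<partial>lborel) = ennreal (1 / (b - d))"
    using assms(2) by (subst nn_integral_powr_to_inf) auto
  also have "ennreal (1 / (d - a)) + ennreal (1 / (b - d)) = ennreal (1 / (d - a) + 1 / (b - d))"
    using assms by (subst ennreal_plus) auto
  also have "ennreal (d * V) * \<dots> = ennreal (d * V * (1 / (d - a) + 1 / (b - d)))"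
    using assms d_ge_1 V_pos by (subst ennreal_mult') auto
  finally show ?thesis
    by (simp only: mult.commute[of d V])
qed

lemma nn_integral_max_1_powr:
  assumes "d < k"
  shows "(\<integral>\<^sup>+ z. ennreal (max 1 (N z) powr (- k)) \<partial>lborel) = ennreal (V * k / (k - d))"
proof -
  have "(\<integral>\<^sup>+ z. ennreal (max 1 (N z) powr (- k)) \<partial>lborel)
      = (\<integral>\<^sup>+ z. ennreal (if N z \<le> 1 then N z powr (- 0) else N z powr (- k)) \<partial>lborel)"
  proof (intro nn_integral_cong_AE)
    \<comment> \<open>At the origin \<open>0 powr 0 = 0\<close> while \<open>max 1 0 = 1\<close>, so
      the identity only holds almost everywhere.\<close>
    have "AE z in lborel. z \<noteq> (0 :: real ^ 'd)" by (rule AE_lborel_singleton)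
    then show "AE z in lborel. ennreal (max 1 (N z) powr (- k))
        = ennreal (if N z \<le> 1 then N z powr (- 0) else N z powr (- k))"
      by eventually_elim (auto simp: max_def)
  qed
  also have "\<dots> = ennreal (V * d * (1 / (d - 0) + 1 / (k - d)))"
    using assms d_ge_1 by (intro nn_integral_two_powers) auto
  also have "V * d * (1 / (d - 0) + 1 / (k - d)) = V * k / (k - d)"
    using assms d_ge_1 by (simp add: field_simps)
  finally show ?thesis .
qed

end

section \<open>The gain of a greedy step\<close>

lemma epowr_le_iff:
  assumes "0 < p"
  shows "epowr x p \<le> epowr y p \<longleftrightarrow> x \<le> y"
proof -
  have "s powr p \<le> t powr p \<longleftrightarrow> s \<le> t" if "0 \<le> s" "0 \<le> t" for s t :: real
    using assms that powr_mono2[of p s t] powr_less_mono2[of p t s] by linarith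
  then show ?thesis
    by (cases x; cases y) (auto simp: epowr_def top_unique)
qed

section \<open>Distance to a finite set, and the deficit integral around a point\<close>

context vec_norm
begin

definition ndist :: "(real ^ 'd) set \<Rightarrow> real ^ 'd \<Rightarrow> real" where
  "ndist \<Gamma> x = (MIN y\<in>\<Gamma>. N (x - y))"

lemma ndist_nonneg: "finite \<Gamma> \<Longrightarrow> \<Gamma> \<noteq> {} \<Longrightarrow> 0 \<le> ndist \<Gamma> x"
  by (simp add: ndist_def)

lemma ndist_le: "finite \<Gamma> \<Longrightarrow> y \<in> \<Gamma> \<Longrightarrow> ndist \<Gamma> x \<le> N (x - y)"
  by (simp add: ndist_def)

lemma ndist_insert:
  "finite \<Gamma> \<Longrightarrow> \<Gamma> \<noteq> {} \<Longrightarrow> ndist (insert y \<Gamma>) x = min (N (x - y)) (ndist \<Gamma> x)"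
  by (simp add: ndist_def)

lemma ndist_attained:
  assumes "finite \<Gamma>" "\<Gamma> \<noteq> {}"
  obtains y where "y \<in> \<Gamma>" "ndist \<Gamma> x = N (x - y)"
proof -
  have "ndist \<Gamma> x \<in> (\<lambda>y. N (x - y)) ` \<Gamma>"
    unfolding ndist_def using assms by (intro Min_in) auto
  then show thesis using that by blast
qed

lemma ndist_antimono: "finite \<Delta> \<Longrightarrow> \<Gamma> \<noteq> {} \<Longrightarrow> \<Gamma> \<subseteq> \<Delta> \<Longrightarrow> ndist \<Delta> x \<le> ndist \<Gamma> x"
  unfolding ndist_def by (intro Min_antimono) auto

lemma ndist_measurable: "finite \<Gamma> \<Longrightarrow> ndist \<Gamma> \<in> borel_measurable borel"
  unfolding ndist_def by (intro borel_measurable_Min) measurable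

lemma Min_powr_eq_ndist:
  assumes "finite \<Gamma>" "\<Gamma> \<noteq> {}" "0 < s"
  shows "(MIN y\<in>\<Gamma>. N (x - y) powr s) = ndist \<Gamma> x powr s"
proof -
  obtain y where y: "y \<in> \<Gamma>" "ndist \<Gamma> x = N (x - y)"
    using ndist_attained[OF assms(1,2)] .
  show ?thesis
  proof (rule Min_eqI)
    fix z assume "z \<in> (\<lambda>y. N (x - y) powr s) ` \<Gamma>"
    then obtain w where "w \<in> \<Gamma>" "z = N (x - w) powr s" by auto
    then show "ndist \<Gamma> x powr s \<le> z"
      using assms ndist_le[of \<Gamma> w x] ndist_nonneg[of \<Gamma> x] by (auto intro!: powr_mono2)
  qed (use assms y in auto)
qed

lemma quant_error_eq:
  "finite \<Gamma> \<Longrightarrow> \<Gamma> \<noteq> {} \<Longrightarrow> 0 < s \<Longrightarrow>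
    quant_error N s \<Gamma> P = epowr (\<integral>\<^sup>+ x. ennreal (ndist \<Gamma> x powr s) \<partial>P) (1 / s)"
  by (simp add: quant_error_def Min_powr_eq_ndist)

text \<open>The truncated deficit vanishes outside the ball of radius \<open>R\<close> around
  \<open>x\<close>, so the lower bound on \<open>g\<close> is required only inside it. Translation
  invariance then reduces the claim to the centred ball.\<close>

lemma nn_integral_deficit_ge:
  assumes r: "0 < r" and R: "0 \<le> R"
    and g: "AE y in lborel. N (x - y) < R \<longrightarrow> ennreal c \<le> g y"
  shows "ennreal c * ennreal (V * (r / (d + r)) * R powr (d + r))
    \<le> (\<integral>\<^sup>+ y. g y * ennreal (R powr r - N (x - y) powr r) \<partial>lborel)"
proof -
  have "ennreal c * ennreal (V * (r / (d + r)) * R powr (d + r))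
     = ennreal c * (\<integral>\<^sup>+ y. ennreal (R powr r - N y powr r) \<partial>lborel)"
    using r R by (simp add: nn_integral_ball_deficit)
  also have "(\<integral>\<^sup>+ y. ennreal (R powr r - N y powr r) \<partial>lborel)
      = (\<integral>\<^sup>+ y. ennreal (R powr r - N (y - x) powr r) \<partial>distr lborel borel ((+) x))"
    by (subst nn_integral_distr) auto
  also have "ennreal c * \<dots> = (\<integral>\<^sup>+ y. ennreal c * ennreal (R powr r - N (x - y) powr r) \<partial>lborel)"
    unfolding lborel_distr_plus by (subst nn_integral_cmult) (auto simp: N_minus_commute[of x])
  also have "\<dots> \<le> (\<integral>\<^sup>+ y. g y * ennreal (R powr r - N (x - y) powr r) \<partial>lborel)"
  proof (rule nn_integral_mono_AE)
    show "AE y in lborel. ennreal c * ennreal (R powr r - N (x - y) powr r)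
        \<le> g y * ennreal (R powr r - N (x - y) powr r)"
      using g
    proof eventually_elim
      case (elim y)
      show ?case
      proof (cases "N (x - y) < R")
        case True
        then show ?thesis using elim by (intro mult_right_mono) auto
      next
        case False
        then have "R powr r \<le> N (x - y) powr r" using R r by (intro powr_mono2) auto
        then show ?thesis by (simp add: ennreal_neg)
      qed
    qed
  qed
  finally show ?thesis .
qed

lemma nn_integral_affine:
  fixes h :: "real ^ 'd \<Rightarrow> ennreal"
  assumes [measurable]: "h \<in> borel_measurable borel" and c: "0 < c"
  shows "(\<integral>\<^sup>+ z. h z \<partial>lborel) = ennreal (c powr d) * (\<integral>\<^sup>+ z. h (b + c *\<^sub>R z) \<partial>lborel)"
proof -
  have "(\<integral>\<^sup>+ z. h z \<partial>lborel)
      = (\<integral>\<^sup>+ z. h z \<partial>density (distr lborel borel (\<lambda>x. b + c *\<^sub>R x)) (\<lambda>_. \<bar>c\<bar> ^ DIM(real ^ 'd)))"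
    using lborel_affine[of c b] c by simp
  also have "\<dots> = ennreal (c ^ CARD('d)) * (\<integral>\<^sup>+ z. h (b + c *\<^sub>R z) \<partial>lborel)"
    using c by (simp add: nn_integral_density nn_integral_cmult nn_integral_distr)
  finally show ?thesis
    using c by (simp add: d_eq powr_realpow)
qed

end

lemma finite_first_points [simp]: "finite (first_points a n)"
  by (simp add: first_points_def)

lemma first_points_nonempty [simp]: "1 \<le> n \<Longrightarrow> first_points a n \<noteq> {}"
  by (simp add: first_points_def)

lemma first_points_Suc: "first_points a (Suc n) = insert (a (Suc n)) (first_points a n)"
  by (auto simp: first_points_def atLeastAtMostSuc_conv)

lemma first_points_mono: "m \<le> n \<Longrightarrow> first_points a m \<subseteq> first_points a n"
  by (auto simp: first_points_def)

text \<open>\<open>p\<close> is the order of the available moment and \<open>\<sigma>\<close> its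
  norm, a positive parameter by which distances are normalised. \<open>no_atom\<close> makes
  \<open>Y\<close> positive almost everywhere, so conditions on a profile are imposed at positive
  arguments only.\<close>

locale greedy_quantization = vec_norm N d + prob_space P
  for N :: "real ^ 'd \<Rightarrow> real" and d :: real and P :: "(real ^ 'd) measure" +
  fixes a :: "nat \<Rightarrow> real ^ 'd" and r p \<sigma> :: real
  assumes sets_P [measurable_cong]: "sets P = sets borel"
    and r_pos: "0 < r" and r_less_p: "r < p" and \<sigma>_pos: "0 < \<sigma>"
    and moment: "integrable P (\<lambda>x. N (x - a 1) powr p)"
      "(\<integral>x. N (x - a 1) powr p \<partial>P) = \<sigma> powr p"
    and no_atom: "AE x in P. x \<noteq> a 1"
    and greedy: "greedy_sequence N r P a"
begin

abbreviation "D n \<equiv> ndist (first_points a n)"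

text \<open>The root is left out so that the gains of successive steps telescope.\<close>

definition E :: "nat \<Rightarrow> real" where
  "E n = (\<integral>x. D n x powr r \<partial>P)"

definition Y :: "real ^ 'd \<Rightarrow> real" where
  "Y x = (N (x - a 1) / \<sigma>) powr p"

lemma D_measurable [measurable]: "D n \<in> borel_measurable borel"
  by (rule ndist_measurable) simp

lemma Y_measurable [measurable]: "Y \<in> borel_measurable borel"
  unfolding Y_def by measurable

lemma D_nonneg [simp]: "1 \<le> n \<Longrightarrow> 0 \<le> D n x"
  by (rule ndist_nonneg) auto

lemma D_le: "1 \<le> n \<Longrightarrow> D n x \<le> N (x - a 1)"
  by (rule ndist_le) (auto simp: first_points_def)

lemma D_antimono: "1 \<le> m \<Longrightarrow> m \<le> n \<Longrightarrow> D n x \<le> D m x"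
  by (rule ndist_antimono) (auto simp: first_points_mono)

lemma p_pos: "0 < p"
  using r_pos r_less_p by simp

lemma integrable_Y: "integrable P Y"
  and integral_Y: "(\<integral>x. Y x \<partial>P) = 1"
  using moment \<sigma>_pos by (auto simp: Y_def[abs_def] powr_divide)

lemma Y_pos: "AE x in P. 0 < Y x"
  using no_atom
proof eventually_elim
  case (elim x)
  then show ?case using \<sigma>_pos by (simp add: Y_def)
qed

lemma integrable_powr_D:
  assumes "1 \<le> n" "0 < s" "s \<le> p"
  shows "integrable P (\<lambda>x. D n x powr s)"
proof (rule Bochner_Integration.integrable_bound)
  show "integrable P (\<lambda>x. 1 + N (x - a 1) powr p)"
    using moment by simp
  have "D n x powr s \<le> 1 + N (x - a 1) powr p" for x
  proof -
    have "D n x powr s \<le> N (x - a 1) powr s"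
      using assms D_le by (intro powr_mono2) auto
    also have "\<dots> \<le> 1 + N (x - a 1) powr p"
    proof (cases "N (x - a 1) \<le> 1")
      case True
      then have "N (x - a 1) powr s \<le> 1" using assms by (intro powr_le1) auto
      then show ?thesis by (smt (verit) powr_ge_zero)
    next
      case False
      then have "N (x - a 1) powr s \<le> N (x - a 1) powr p" using assms by (intro powr_mono) auto
      then show ?thesis by simp
    qed
    finally show ?thesis .
  qed
  then show "AE x in P. norm (D n x powr s) \<le> norm (1 + N (x - a 1) powr p)"
    by (auto simp: abs_of_nonneg)
qed measurable

lemma nn_integral_powr_D:
  assumes "1 \<le> n" "0 < s" "s \<le> p"
  shows "(\<integral>\<^sup>+ x. ennreal (D n x powr s) \<partial>P) = ennreal (\<integral>x. D n x powr s \<partial>P)"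
  using integrable_powr_D[OF assms] by (intro nn_integral_eq_integral) auto

lemma E_nonneg [simp]: "0 \<le> E n"
  by (simp add: E_def)

text \<open>The greedy point is compared with an arbitrary competitor \<open>y\<close>. Adding
  \<open>y\<close> replaces \<open>D n x\<close> by a minimum, and the \<open>r\<close>-th power of
  that minimum plus the positive part in the integral is exactly \<open>D n x powr r\<close>. The
  additive form avoids subtraction in \<open>ennreal\<close>.\<close>

lemma greedy_step:
  assumes n: "1 \<le> n"
  shows "ennreal (E (Suc n)) + (\<integral>\<^sup>+ x. ennreal (D n x powr r - N (x - y) powr r) \<partial>P) \<le> ennreal (E n)"
proof -
  let ?\<Gamma> = "first_points a n"
  have "quant_error N r (insert (a (Suc n)) ?\<Gamma>) P \<le> quant_error N r (insert y ?\<Gamma>) P"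
    using greedy by (auto simp: greedy_sequence_def is_arg_min_def not_less)
  then have "(\<integral>\<^sup>+ x. ennreal (D (Suc n) x powr r) \<partial>P) \<le> (\<integral>\<^sup>+ x. ennreal (ndist (insert y ?\<Gamma>) x powr r) \<partial>P)"
    using r_pos by (simp add: quant_error_eq epowr_le_iff first_points_Suc)
  then have "ennreal (E (Suc n)) \<le> (\<integral>\<^sup>+ x. ennreal (ndist (insert y ?\<Gamma>) x powr r) \<partial>P)"
    using r_pos r_less_p by (simp add: nn_integral_powr_D E_def)
  then have "ennreal (E (Suc n)) + (\<integral>\<^sup>+ x. ennreal (D n x powr r - N (x - y) powr r) \<partial>P)
    \<le> (\<integral>\<^sup>+ x. ennreal (ndist (insert y ?\<Gamma>) x powr r) \<partial>P) + (\<integral>\<^sup>+ x. ennreal (D n x powr r - N (x - y) powr r) \<partial>P)"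
    by (intro add_right_mono)
  also have "\<dots> = (\<integral>\<^sup>+ x. ennreal (ndist (insert y ?\<Gamma>) x powr r) + ennreal (D n x powr r - N (x - y) powr r) \<partial>P)"
    using ndist_measurable[of "insert y ?\<Gamma>"] by (intro nn_integral_add[symmetric]) auto
  also have "\<dots> = (\<integral>\<^sup>+ x. ennreal (D n x powr r) \<partial>P)"
  proof (rule nn_integral_cong)
    fix x
    show "ennreal (ndist (insert y ?\<Gamma>) x powr r) + ennreal (D n x powr r - N (x - y) powr r) = ennreal (D n x powr r)"
    proof (cases "N (x - y) \<le> D n x")
      case True
      then have "N (x - y) powr r \<le> D n x powr r" using r_pos by (intro powr_mono2) auto
      then show ?thesis using True n by (simp add: ndist_insert min_def ennreal_plus[symmetric] del: ennreal_plus)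
    next
      case False
      then have "D n x powr r \<le> N (x - y) powr r" using r_pos n by (intro powr_mono2) auto
      then show ?thesis using False n by (simp add: ndist_insert min_def ennreal_neg)
    qed
  qed
  also have "\<dots> = ennreal (E n)"
    using r_pos r_less_p n by (simp add: nn_integral_powr_D E_def)
  finally show ?thesis .
qed

text \<open>The inequality of \<open>greedy_step\<close> is averaged over \<open>y\<close> with a
  weight and the integrals are interchanged. At \<open>x\<close> only competitors with
  \<open>N (x - y) < D n x\<close> help; since \<open>a 1\<close> is among the points, they satisfy
  \<open>N (y - a 1) <= 2 * N (x - a 1)\<close>, and monotonicity of \<open>G\<close> bounds their
  weight below by \<open>G (Y x)\<close>. The ball deficit then produces the power
  \<open>d + r\<close>.\<close>

lemma averaged_gain:
  fixes G :: "real \<Rightarrow> real"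
  assumes n: "1 \<le> n"
    and G_measurable [measurable]: "G \<in> borel_measurable borel"
    and G_nonneg: "\<And>y. 0 \<le> G y"
    and G_antimono: "\<And>y z. 0 < y \<Longrightarrow> y \<le> z \<Longrightarrow> G z \<le> G y"
    and J: "(\<integral>\<^sup>+ z. ennreal (G (N z powr p)) \<partial>lborel) = ennreal J" "0 < J"
  shows "integrable P (\<lambda>x. G (Y x) * D n x powr (d + r))"
    and "V * (r / (d + r)) / ((2 * \<sigma>) powr d * J) * (\<integral>x. G (Y x) * D n x powr (d + r) \<partial>P) \<le> E n - E (Suc n)"
proof -
  \<comment> \<open>The scale \<open>2 * \<sigma>\<close>, against \<open>\<sigma>\<close> in
    \<open>Y\<close>, absorbs the factor 2 from the triangle inequality; its price is the factor
    \<open>2 powr d\<close> in the total mass \<open>K\<close>.\<close>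
  define g where "g y = ennreal (G ((N (y - a 1) / (2 * \<sigma>)) powr p))" for y
  have g_measurable [measurable]: "g \<in> borel_measurable borel"
    unfolding g_def by measurable
  define K where "K = (2 * \<sigma>) powr d * J"
  have K: "0 < K" using J \<sigma>_pos by (simp add: K_def)
  have "(\<integral>\<^sup>+ y. g y \<partial>lborel) = ennreal ((2 * \<sigma>) powr d) * (\<integral>\<^sup>+ z. g (a 1 + (2 * \<sigma>) *\<^sub>R z) \<partial>lborel)"
    using \<sigma>_pos by (intro nn_integral_affine) auto
  also have "(\<integral>\<^sup>+ z. g (a 1 + (2 * \<sigma>) *\<^sub>R z) \<partial>lborel) = ennreal J"
    using \<sigma>_pos by (simp add: g_def N_scaleR J)
  finally have g_int: "(\<integral>\<^sup>+ y. g y \<partial>lborel) = ennreal K"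
    using J by (simp add: K_def ennreal_mult)
  define h where "h x y = ennreal (D n x powr r - N (x - y) powr r)" for x y
  have h_measurable [measurable]: "(\<lambda>z. h (fst z) (snd z)) \<in> borel_measurable (P \<Otimes>\<^sub>M lborel)"
    unfolding h_def by measurable
  have h1 [measurable]: "(\<lambda>x. h x y) \<in> borel_measurable P" for y
    unfolding h_def by measurable
  have h3 [measurable]: "(\<lambda>y. \<integral>\<^sup>+ x. h x y \<partial>P) \<in> borel_measurable lborel"
    unfolding h_def by measurable
  interpret L: pair_sigma_finite P "lborel :: (real ^ 'd) measure" ..
  define S where "S = (\<integral>\<^sup>+ x. (\<integral>\<^sup>+ y. g y * h x y \<partial>lborel) \<partial>P)"
  have S_eq: "S = (\<integral>\<^sup>+ y. g y * (\<integral>\<^sup>+ x. h x y \<partial>P) \<partial>lborel)"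
  proof -
    have "S = (\<integral>\<^sup>+ y. (\<integral>\<^sup>+ x. g y * h x y \<partial>P) \<partial>lborel)"
      unfolding S_def h_def by (rule L.Fubini'[symmetric]) measurable
    also have "\<dots> = (\<integral>\<^sup>+ y. g y * (\<integral>\<^sup>+ x. h x y \<partial>P) \<partial>lborel)"
      by (intro nn_integral_cong nn_integral_cmult) auto
    finally show ?thesis .
  qed
  have "ennreal K * ennreal (E (Suc n)) + S
    = (\<integral>\<^sup>+ y. g y * ennreal (E (Suc n)) \<partial>lborel) + (\<integral>\<^sup>+ y. g y * (\<integral>\<^sup>+ x. h x y \<partial>P) \<partial>lborel)"
    by (simp add: g_int[symmetric] S_eq nn_integral_multc)
  also have "\<dots> = (\<integral>\<^sup>+ y. g y * (ennreal (E (Suc n)) + (\<integral>\<^sup>+ x. h x y \<partial>P)) \<partial>lborel)"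
    by (subst nn_integral_add[symmetric]) (auto simp: distrib_left)
  also have "\<dots> \<le> (\<integral>\<^sup>+ y. g y * ennreal (E n) \<partial>lborel)"
    unfolding h_def using n by (intro nn_integral_mono mult_left_mono greedy_step) auto
  also have "\<dots> = ennreal K * ennreal (E n)"
    by (simp add: g_int[symmetric] nn_integral_multc)
  finally have upper: "ennreal K * ennreal (E (Suc n)) + S \<le> ennreal K * ennreal (E n)" .
  define c where "c = V * (r / (d + r))"
  have c: "0 < c" using V_pos r_pos d_ge_1 by (simp add: c_def)
  have "(\<integral>\<^sup>+ x. ennreal (c * (G (Y x) * D n x powr (d + r))) \<partial>P) \<le> S"
    unfolding S_def
  proof (rule nn_integral_mono_AE)
    show "AE x in P. ennreal (c * (G (Y x) * D n x powr (d + r))) \<le> (\<integral>\<^sup>+ y. g y * h x y \<partial>lborel)"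
      using no_atom
    proof eventually_elim
      case (elim x)
      \<comment> \<open>\<open>G\<close> is monotone on positive arguments only, so the point
        \<open>a 1\<close> is removed.\<close>
      have "AE y in lborel. y \<noteq> a 1" by (rule AE_lborel_singleton)
      then have "AE y in lborel. N (x - y) < D n x \<longrightarrow> ennreal (G (Y x)) \<le> g y"
      proof eventually_elim
        case (elim y)
        show ?case
        proof
          assume "N (x - y) < D n x"
          then have "N (x - y) \<le> N (x - a 1)" using D_le[OF n, of x] by simp
          moreover have "N (y - a 1) \<le> N (y - x) + N (x - a 1)" using N_triangle[of "y - x" "x - a 1"] by simp
          ultimately have "N (y - a 1) / (2 * \<sigma>) \<le> N (x - a 1) / \<sigma>"
            using \<sigma>_pos by (simp add: N_minus_commute[of x y] field_simps)
          then have "(N (y - a 1) / (2 * \<sigma>)) powr p \<le> Y x"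
            unfolding Y_def using \<sigma>_pos p_pos by (intro powr_mono2) auto
          moreover have "0 < N (y - a 1)"
            using elim by simp
          ultimately show "ennreal (G (Y x)) \<le> g y"
            unfolding g_def using \<sigma>_pos by (intro ennreal_leI G_antimono) auto
        qed
      qed
      then have "ennreal (G (Y x)) * ennreal (V * (r / (d + r)) * D n x powr (d + r)) \<le> (\<integral>\<^sup>+ y. g y * h x y \<partial>lborel)"
        unfolding h_def using r_pos n by (intro nn_integral_deficit_ge) auto
      also have "ennreal (G (Y x)) * ennreal (V * (r / (d + r)) * D n x powr (d + r))
          = ennreal (c * (G (Y x) * D n x powr (d + r)))"
        unfolding c_def[symmetric] using G_nonneg c by (subst ennreal_mult[symmetric]) (auto simp: mult_ac)
      finally show ?case .
    qed
  qed
  then have lower: "ennreal c * (\<integral>\<^sup>+ x. ennreal (G (Y x) * D n x powr (d + r)) \<partial>P) \<le> S"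
    using c G_nonneg by (simp add: ennreal_mult nn_integral_cmult)
  \<comment> \<open>Integrability is drawn from this finite upper bound for \<open>S\<close>, since
    \<open>d + r\<close> may exceed the order \<open>p\<close> of the available moment.\<close>
  have "S \<le> ennreal K * ennreal (E n)"
    using upper by (meson dual_order.trans le_add2 add_increasing zero_le order_refl)
  then have "S < \<infinity>"
    by (simp add: ennreal_mult[symmetric] K less_imp_le) (metis ennreal_less_top le_less_trans)
  with lower have "ennreal c * (\<integral>\<^sup>+ x. ennreal (G (Y x) * D n x powr (d + r)) \<partial>P) < \<infinity>"
    by (rule le_less_trans)
  then have fin: "(\<integral>\<^sup>+ x. ennreal (G (Y x) * D n x powr (d + r)) \<partial>P) < \<infinity>"
    using c by (auto simp: ennreal_mult_less_top)
  then show int: "integrable P (\<lambda>x. G (Y x) * D n x powr (d + r))"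
    using G_nonneg by (intro integrableI_nonneg) auto
  then have eq: "(\<integral>\<^sup>+ x. ennreal (G (Y x) * D n x powr (d + r)) \<partial>P) = ennreal (\<integral>x. G (Y x) * D n x powr (d + r) \<partial>P)"
    using G_nonneg by (intro nn_integral_eq_integral) auto
  let ?I = "\<integral>x. G (Y x) * D n x powr (d + r) \<partial>P"
  have I: "0 \<le> ?I" using G_nonneg by (intro Bochner_Integration.integral_nonneg) auto
  have "ennreal K * ennreal (E (Suc n)) + ennreal c * ennreal ?I \<le> ennreal K * ennreal (E n)"
    using upper lower unfolding eq by (meson add_left_mono order_trans)
  then have "ennreal (K * E (Suc n) + c * ?I) \<le> ennreal (K * E n)"
    using K c I by (simp add: ennreal_mult ennreal_plus)
  then have "K * E (Suc n) + c * ?I \<le> K * E n"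
    using K by (subst (asm) ennreal_le_iff) auto
  then show "V * (r / (d + r)) / ((2 * \<sigma>) powr d * J) * ?I \<le> E n - E (Suc n)"
    using K unfolding K_def[symmetric] c_def[symmetric] by (simp add: field_simps)
qed

end

section \<open>From the gain to the error\<close>

lemma powr_le_affine:
  fixes y e :: real
  assumes "0 < y" "0 \<le> e" "e \<le> 1"
  shows "y powr e \<le> 1 + e * (y - 1)"
  using Youngs_inequality_0[of e "1 - e" y 1] assms by (simp add: algebra_simps)

text \<open>
  The last two conditions are integrated with \<open>y = Y\<close> and \<open>w = D n powr t\<close> divided by its mean; both then
  have mean 1, so the terms in \<open>b\<close>, \<open>c1\<close> and \<open>c2\<close> disappear.
\<close>

definition profile :: "real \<Rightarrow> real \<Rightarrow> (real \<Rightarrow> real) \<Rightarrow> bool" where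
  "profile M L G \<longleftrightarrow>
     G \<in> borel_measurable borel \<and> (\<forall>y. 0 \<le> G y) \<and> (\<forall>y z. 0 < y \<longrightarrow> y \<le> z \<longrightarrow> G z \<le> G y) \<and>
     (\<exists>b\<in>{0..1}. \<forall>y>0. (1 + b * (y - 1)) powr (- M) \<le> G y) \<and>
     (\<exists>c1 c2. \<forall>y>0. \<forall>w\<ge>0. max 0 (1 - w) + c1 * (w - 1) - c2 * (y - 1) \<le> L * G y * w powr (M + 1))"

context greedy_quantization
begin

text \<open>Two regimes, with \<open>e\<close> the norm of \<open>D n\<close> of order
  \<open>t\<close>. If \<open>e powr r <= E m\<close>, the decay of \<open>E\<close> up to
  \<open>m\<close> yields the first entry of \<open>max\<close>. Otherwise
  \<open>E m < e powr r\<close>, and the gains of the steps from \<open>m\<close> to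
  \<open>n\<close> cannot exceed \<open>e powr r - E n\<close>; the last condition of
  \<open>profile\<close> turns this into the second entry.\<close>

lemma mismatch_error_bound:
  fixes G :: "real \<Rightarrow> real"
  assumes M: "0 < M" "M * r < d" and t: "r \<le> t" "t \<le> p" "t * (M + 1) = d + r"
    and L: "0 < L" and G: "profile M L G"
    and J: "(\<integral>\<^sup>+ z. ennreal (G (N z powr p)) \<partial>lborel) = ennreal J" "0 < J"
    and mn: "2 \<le> m" "m < n"
  shows "(\<integral>x. D n x powr t \<partial>P) powr (d / t)
    \<le> max (r / d / (real m - 1)) (L / (real n - real m)) * ((d + r) * (2 * \<sigma>) powr d * J / (V * r))"
proof -
  have G_meas [measurable]: "G \<in> borel_measurable borel" and G_nonneg: "\<And>y. 0 \<le> G y"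
    and G_antimono: "\<And>y z. 0 < y \<Longrightarrow> y \<le> z \<Longrightarrow> G z \<le> G y"
    using G by (auto simp: profile_def)
  obtain b where b: "0 \<le> b" "b \<le> 1" "\<And>y. 0 < y \<Longrightarrow> (1 + b * (y - 1)) powr (- M) \<le> G y"
    using G by (auto simp: profile_def)
  obtain c1 c2 where c: "\<And>y w. 0 < y \<Longrightarrow> 0 \<le> w \<Longrightarrow>
      max 0 (1 - w) + c1 * (w - 1) - c2 * (y - 1) \<le> L * G y * w powr (M + 1)"
    using G unfolding profile_def by blast
  have Z_pos: "0 < 1 + b * (y - 1)" if "0 < y" for y
  proof (cases "b = 1")
    case False
    then have "0 < (1 - b) + b * y" using b that by (intro add_pos_nonneg) auto
    then show ?thesis by (simp add: algebra_simps)
  qed (use that in simp)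
  have G_pos: "0 < G y" if "0 < y" for y
    using b(3)[OF that] Z_pos[OF that] by (smt (verit) powr_gt_zero)
  define x where "x = r / d"
  have d_pos: "0 < d" using d_ge_1 by simp
  have x: "0 < x" "M * x < 1" using r_pos d_pos M by (simp_all add: x_def field_simps)
  have t_pos: "0 < t" using t r_pos by simp
  define A where "A = V * (r / (d + r)) / ((2 * \<sigma>) powr d * J)"
  have A: "0 < A" using V_pos r_pos d_pos J \<sigma>_pos by (simp add: A_def)
  define I where "I k = (\<integral>x. G (Y x) * D k x powr (d + r) \<partial>P)" for k
  have I_int: "integrable P (\<lambda>x. G (Y x) * D k x powr (d + r))" and gain: "A * I k \<le> E k - E (Suc k)"
    if "1 \<le> k" for k
    unfolding A_def I_def by (rule averaged_gain[OF that G_meas G_nonneg G_antimono J]; simp)+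
  have I_nonneg: "0 \<le> I k" for k
    unfolding I_def using G_nonneg by (intro Bochner_Integration.integral_nonneg) auto

  \<comment> \<open>Hoelder's inequality in the form of an integrated minorant \<open>h\<close>. The
    tangent inequality is used with exponent \<open>1 / x\<close>, with
    \<open>w = D k z powr r\<close>, and with \<open>Z\<close> equal to \<open>E k\<close> times the
    power \<open>M * x\<close> of \<open>1 + b * (Y z - 1)\<close>. As \<open>M * x < 1\<close>,
    that power lies below an affine function of \<open>Y\<close>, whose mean is 1.\<close>
  have "E k powr (1 + 1 / x) \<le> I k" if k: "1 \<le> k" for k
  proof (cases "E k = 0")
    case True
    then show ?thesis using I_nonneg by simp
  next
    case False
    then have Ek: "0 < E k" using E_nonneg[of k] by linarith
    define h where "h z = E k powr (1 / x) * ((1 / x + 1) * D k z powr r - 1 / x * (E k * (1 + M * x * (b * (Y z - 1)))))" for z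
    have D_int: "integrable P (\<lambda>z. D k z powr r)"
      using k r_pos r_less_p by (intro integrable_powr_D) auto
    have "(\<integral>z. h z \<partial>P) \<le> I k"
      unfolding I_def
    proof (rule integral_mono_AE)
      show "integrable P h" unfolding h_def using D_int integrable_Y by simp
      show "integrable P (\<lambda>x. G (Y x) * D k x powr (d + r))" by (rule I_int[OF k])
      show "AE z in P. h z \<le> G (Y z) * D k z powr (d + r)"
        using Y_pos
      proof eventually_elim
        case (elim z)
        let ?Z = "1 + b * (Y z - 1)"
        have Z: "0 < ?Z" by (rule Z_pos[OF elim])
        have "?Z powr (M * x) \<le> 1 + M * x * (b * (Y z - 1))"
          using powr_le_affine[OF Z, of "M * x"] x M by simp
        then have "h z \<le> E k powr (1 / x) * ((1 / x + 1) * D k z powr r - 1 / x * (E k * ?Z powr (M * x)))"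
          unfolding h_def using Ek x by (intro mult_left_mono diff_left_mono) auto
        also have "\<dots> \<le> E k powr (1 / x) * ((E k * ?Z powr (M * x)) powr (- (1 / x)) * (D k z powr r) powr (1 / x + 1))"
          using Ek x Z by (intro mult_left_mono perspective_tangent) auto
        also have "\<dots> = ?Z powr (- M) * D k z powr (d + r)"
        proof -
          have cancel: "(d * r + r * r) / r = d + r" using r_pos by (simp add: field_simps)
          show ?thesis
            using Ek x Z r_pos d_pos
            by (simp add: powr_mult powr_powr powr_minus_divide) (simp add: x_def field_simps cancel)
        qed
        also have "\<dots> \<le> G (Y z) * D k z powr (d + r)"
          using b(3)[OF elim] by (intro mult_right_mono) auto
        finally show ?case .
      qed
    qed
    moreover have "(\<integral>z. h z \<partial>P) = E k powr (1 / x) * ((1 / x + 1) * E k - 1 / x * E k)"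
      unfolding h_def using D_int integrable_Y integral_Y
      by (simp add: E_def[symmetric] prob_space)
    moreover have "\<dots> = E k powr (1 + 1 / x)"
      using Ek by (simp add: powr_add algebra_simps)
    ultimately show ?thesis by simp
  qed
  then have "A * E k powr (1 + 1 / x) \<le> E k - E (Suc k)" if "1 \<le> k" for k
    using gain[OF that] that A by (meson mult_left_mono less_imp_le order_trans)
  then have E_decay: "E m powr (1 / x) \<le> x / (A * (real m - 1))"
    using x A mn by (intro decay_of_power_recursion) auto

  define T where "T = (\<integral>x. D n x powr t \<partial>P)"
  have D_int: "integrable P (\<lambda>z. D n z powr t)" "integrable P (\<lambda>z. D n z powr r)"
    using mn t r_pos t_pos r_less_p by (auto intro!: integrable_powr_D)
  have T_nonneg: "0 \<le> T" unfolding T_def by (intro Bochner_Integration.integral_nonneg) auto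
  define e where "e = T powr (1 / t)"
  have e: "0 \<le> e" "T = e powr t" "T powr (d / t) = e powr d"
    using T_nonneg t_pos by (auto simp: e_def powr_powr)
  have "e powr d \<le> max (x / (real m - 1)) (L / (real n - real m)) / A"
  proof (cases "e powr r \<le> E m")
    case True
    then have "(e powr r) powr (1 / x) \<le> E m powr (1 / x)"
      using x by (intro powr_mono2) auto
    then have "e powr d \<le> E m powr (1 / x)"
      using r_pos by (simp add: powr_powr x_def)
    also have "\<dots> \<le> (x / (real m - 1)) / A" using E_decay by (simp add: mult.commute)
    also have "\<dots> \<le> max (x / (real m - 1)) (L / (real n - real m)) / A"
      using A by (intro divide_right_mono) auto
    finally show ?thesis .
  next
    case False
    then have e_pos: "0 < e" using e(1) E_nonneg[of m] by (cases "e = 0") auto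
    define W where "W z = D n z powr t / T" for z
    have T_pos: "0 < T" using e e_pos by simp
    have W_int: "integrable P W" "(\<integral>z. W z \<partial>P) = 1"
      unfolding W_def using D_int T_pos by (auto simp: T_def[symmetric])
    have W_nonneg: "0 \<le> W z" for z using T_nonneg by (simp add: W_def)
    have W_D: "e powr r * W z powr (r / t) = D n z powr r" "e powr (d + r) * W z powr (M + 1) = D n z powr (d + r)" for z
      using t_pos e e_pos t(3) by (simp_all add: W_def powr_divide powr_powr)
    define K where "K = (\<integral>z. G (Y z) * W z powr (M + 1) \<partial>P)"
    have I_K: "I n = e powr (d + r) * K"
      unfolding I_def K_def by (subst integral_mult_right_zero[symmetric]) (simp add: W_D(2)[symmetric] mult_ac)
    have K_int: "integrable P (\<lambda>z. G (Y z) * W z powr (M + 1))"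
    proof -
      have "integrable P (\<lambda>z. e powr (d + r) * (G (Y z) * W z powr (M + 1)))"
        using I_int[of n] mn by (simp add: W_D(2)[symmetric] mult_ac)
      then show ?thesis using e_pos by simp
    qed
    \<comment> \<open>\<open>K\<close> is cancelled at the end. It cannot vanish, because
      \<open>G\<close> is positive at positive arguments and \<open>W\<close> has mean 1.\<close>
    have "K \<noteq> 0"
    proof -
      { assume "K = 0"
        then have "AE z in P. G (Y z) * W z powr (M + 1) = 0"
          using K_int G_nonneg unfolding K_def by (subst (asm) integral_nonneg_eq_0_iff_AE) auto
        with Y_pos have "AE z in P. W z = 0"
          by eventually_elim (use G_pos in force)
        then have "(\<integral>z. W z \<partial>P) = 0" by (intro integral_eq_zero_AE) auto
        with W_int have False by simp }
      then show ?thesis by blast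
    qed
    moreover have "0 \<le> K" unfolding K_def using G_nonneg by (intro Bochner_Integration.integral_nonneg) auto
    ultimately have K_pos: "0 < K" by simp

    \<comment> \<open>Distances decrease as points are added, so \<open>A * I n\<close> bounds each
      of the \<open>n - m\<close> gains from below, and the gains telescope.\<close>
    have "I n \<le> I k" if "m \<le> k" "k \<le> n" for k
      unfolding I_def using that mn I_int d_pos r_pos G_nonneg D_antimono
      by (intro integral_mono mult_left_mono powr_mono2) auto
    then have step: "A * I n \<le> E k - E (Suc k)" if "m \<le> k" "k < n" for k
      using gain[of k] that mn A by (smt (verit) mult_left_mono less_imp_le le_trans one_le_numeral)
    have "(real k - real m) * (A * I n) \<le> E m - E k" if "m \<le> k" "k \<le> n" for k
      using that
    proof (induction k rule: dec_induct)
      case (step k)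
      then show ?case using \<open>m \<le> k \<Longrightarrow> k < n \<Longrightarrow> A * I n \<le> E k - E (Suc k)\<close>
        by (auto simp: algebra_simps)
    qed simp
    then have "(real n - real m) * (A * I n) \<le> E m - E n" using mn by simp
    also have "\<dots> \<le> e powr r * (1 - (\<integral>z. W z powr (r / t) \<partial>P))"
    proof -
      have "E n = e powr r * (\<integral>z. W z powr (r / t) \<partial>P)"
        unfolding E_def by (simp add: W_D(1)[symmetric])
      then show ?thesis using False by (simp add: algebra_simps)
    qed
    also have "1 - (\<integral>z. W z powr (r / t) \<partial>P) = (\<integral>z. 1 - W z powr (r / t) \<partial>P)"
    proof -
      have "integrable P (\<lambda>z. e powr r * W z powr (r / t))"
        using D_int by (simp add: W_D)
      then have "integrable P (\<lambda>z. W z powr (r / t))" using e_pos by simp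
      then show ?thesis by (simp add: prob_space)
    qed
    also have "\<dots> \<le> L * K"
    proof -
      \<comment> \<open>As \<open>r <= t\<close>, the left integrand is at most
        \<open>max 0 (1 - W z)\<close>, the quantity controlled by the profile.\<close>
      have "(\<integral>z. 1 - W z powr (r / t) \<partial>P) \<le> (\<integral>z. L * (G (Y z) * W z powr (M + 1)) - c1 * (W z - 1) + c2 * (Y z - 1) \<partial>P)"
      proof (rule integral_mono_AE)
        show "integrable P (\<lambda>z. L * (G (Y z) * W z powr (M + 1)) - c1 * (W z - 1) + c2 * (Y z - 1))"
          using K_int W_int integrable_Y by simp
        have "integrable P (\<lambda>z. e powr r * W z powr (r / t))"
          using D_int by (simp add: W_D)
        then show "integrable P (\<lambda>z. 1 - W z powr (r / t))" using e_pos by simp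
        show "AE z in P. 1 - W z powr (r / t) \<le> L * (G (Y z) * W z powr (M + 1)) - c1 * (W z - 1) + c2 * (Y z - 1)"
          using Y_pos
        proof eventually_elim
          case (elim z)
          have "1 - W z powr (r / t) \<le> max 0 (1 - W z)"
          proof (cases "W z \<le> 1")
            case True
            then have "W z powr 1 \<le> W z powr (r / t)"
              using t t_pos W_nonneg[of z] by (intro powr_mono') auto
            then show ?thesis using W_nonneg[of z] by simp
          next
            case False
            then have "1 \<le> W z powr (r / t)" using r_pos t_pos by (intro ge_one_powr_ge_zero) auto
            then show ?thesis by simp
          qed
          then show ?case using c[OF elim W_nonneg[of z]] by (simp add: mult.assoc)
        qed
      qed
      also have "\<dots> = L * K"
        using K_int W_int integrable_Y integral_Y by (simp add: K_def prob_space)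
      finally show ?thesis .
    qed
    finally have "(real n - real m) * (A * (e powr (d + r) * K)) \<le> e powr r * (L * K)"
      using e_pos by (simp add: I_K mult_left_mono)
    then have "(e powr r * K) * ((real n - real m) * A * e powr d) \<le> (e powr r * K) * L"
      by (simp add: powr_add mult_ac)
    then have "(real n - real m) * A * e powr d \<le> L"
      using e_pos K_pos by (simp only: mult_le_cancel_left_pos mult_pos_pos powr_gt_zero)
    then have "e powr d \<le> L / (real n - real m) / A"
      using mn A by (simp add: field_simps)
    also have "\<dots> \<le> max (x / (real m - 1)) (L / (real n - real m)) / A"
      using A by (intro divide_right_mono) auto
    finally show ?thesis .
  qed
  also have "\<dots> = max (r / d / (real m - 1)) (L / (real n - real m)) * ((d + r) * (2 * \<sigma>) powr d * J / (V * r))"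
    by (simp add: A_def x_def field_simps)
  finally show ?thesis unfolding T_def[symmetric] e(3) .
qed

end

section \<open>Admissible profiles\<close>

lemma double_ln_le:
  fixes s :: real
  assumes "1 \<le> s"
  shows "2 * ln s \<le> s - 1 / s"
proof -
  have "(\<lambda>s. s - 1 / s - 2 * ln s) 1 \<le> (\<lambda>s. s - 1 / s - 2 * ln s) s"
  proof (rule DERIV_nonneg_imp_nondecreasing[OF assms])
    fix x :: real assume "1 \<le> x" "x \<le> s"
    then have "((\<lambda>s. s - 1 / s - 2 * ln s) has_real_derivative (1 - 1 / x) ^ 2) (at x)"
      by (auto intro!: derivative_eq_intros simp: power2_eq_square field_simps)
    then show "\<exists>y. ((\<lambda>s. s - 1 / s - 2 * ln s) has_real_derivative y) (at x) \<and> 0 \<le> y"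
      by (intro exI[of _ "(1 - 1 / x) ^ 2"]) auto
  qed
  then show ?thesis by simp
qed

text \<open>With \<open>s = sqrt (1 + h)\<close>, the bound \<open>2 * ln s <= s - 1 / s\<close>
  reduces the left side to \<open>(s ^ 2 + 1) / (2 * s)\<close>. The numbers \<open>55 / 100\<close>
  and \<open>183 / 100\<close> have sum \<open>238 / 100\<close> and product above 1, and
  \<open>s\<close> lies between them.\<close>

lemma ln_1_plus_ratio_le:
  fixes h :: real
  assumes "0 < h" "h \<le> 5 / 3"
  shows "(2 + h) / (2 * h) * ln (1 + h) \<le> 119 / 100"
proof -
  define s where "s = sqrt (1 + h)"
  have s: "1 < s" "s ^ 2 = 1 + h" using assms by (auto simp: s_def)
  have "s \<le> 164 / 100"
  proof (rule ccontr)
    assume "\<not> s \<le> 164 / 100"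
    then have "(164 / 100) ^ 2 < s ^ 2" by (intro power_strict_mono) auto
    then show False using s assms by (simp add: power2_eq_square)
  qed
  then have "0 \<le> (s - 55 / 100) * (183 / 100 - s)" using s by (intro mult_nonneg_nonneg) auto
  moreover have "(s - 55 / 100) * (183 / 100 - s) = 238 / 100 * s - s ^ 2 - 10065 / 10000"
    by (simp add: power2_eq_square field_simps)
  ultimately have q: "s ^ 2 + 1 \<le> 238 / 100 * s" by linarith
  have "ln (1 + h) = 2 * ln s" using s by (simp flip: s(2) add: ln_realpow)
  also have "\<dots> \<le> s - 1 / s" using s by (intro double_ln_le) auto
  finally have "(2 + h) / (2 * h) * ln (1 + h) \<le> (2 + h) / (2 * h) * (s - 1 / s)"
    using assms by (intro mult_left_mono) auto
  also have "\<dots> = (s ^ 2 + 1) / (2 * s)"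
  proof -
    have "s - 1 / s = (s ^ 2 - 1) / s"
      using s(1) by (simp add: power2_eq_square diff_divide_distrib)
    then have "s - 1 / s = h / s" using s(2) by simp
    then show ?thesis using s assms by (simp add: field_simps)
  qed
  also have "\<dots> \<le> 119 / 100" using q s by (simp add: field_simps)
  finally show ?thesis .
qed

text \<open>The right side is a factor of the lower bound for \<open>kappa powr d\<close>. After
  taking logarithms, \<open>ln x\<close> and \<open>ln (1 + x)\<close> are replaced by rational
  lower bounds, and a quadratic polynomial remains that is nonnegative on the unit interval.\<close>

lemma exp_le_powr_mix:
  fixes x :: real
  assumes x: "0 < x" "x \<le> 1"
  shows "exp (48 / 100) \<le> x powr (x / (1 + x)) * (1 + x) powr (1 / x)"
proof -
  \<comment> \<open>\<open>ln x >= ln c + 1 - c / x\<close> holds for every \<open>c > 0\<close>.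
    Here \<open>c = 2 / 5\<close>, and \<open>6 / 100\<close> is a rational lower bound for
    \<open>ln c + 1\<close>.\<close>
  have "1 + ln (2 / 5) \<ge> (6 / 100 :: real)"
  proof -
    have "exp (-(94 / 100)) \<le> (2 / 5 :: real)"
    proof -
      have "(5 / 2 :: real) \<le> (1 + 235 / 1000 + (235 / 1000) ^ 2 / 2) ^ 4"
        by (simp add: power4_eq_xxxx power2_eq_square)
      also have "\<dots> \<le> exp (235 / 1000) ^ 4"
        using exp_lower_Taylor_quadratic[of "235 / 1000 :: real"] by (intro power_mono) auto
      also have "\<dots> = exp (94 / 100)" by (simp flip: exp_of_nat_mult)
      finally show ?thesis by (simp add: exp_minus field_simps)
    qed
    then have "ln (exp (-(94 / 100))) \<le> ln (2 / 5 :: real)"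
      by (subst ln_le_cancel_iff) auto
    then show ?thesis by simp
  qed
  moreover have "ln (2 / 5) + 1 - (2 / 5) / x \<le> ln x"
    using ln_le_minus_one[of "2 / 5 / x"] ln_div[of "2 / 5" x] x by simp
  ultimately have "6 / 100 - (2 / 5) / x \<le> ln x" by linarith
  then have "x / (1 + x) * (6 / 100 - (2 / 5) / x) \<le> x / (1 + x) * ln x"
    using x by (intro mult_left_mono) auto
  moreover have "x / (1 + x) * (6 / 100 - (2 / 5) / x) = (6 / 100 * x - 2 / 5) / (1 + x)"
  proof -
    have "x * (6 / 100 - (2 / 5) / x) = 6 / 100 * x - 2 / 5"
      using x by (simp add: right_diff_distrib)
    then show ?thesis by (simp only: times_divide_eq_left)
  qed
  ultimately have 1: "(6 / 100 * x - 2 / 5) / (1 + x) \<le> x / (1 + x) * ln x"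
    by (simp only:)
  have "2 * x / (2 + x) \<le> ln (1 + x)"
  proof -
    have "(\<lambda>x. ln (1 + x) - 2 * x / (2 + x)) 0 \<le> (\<lambda>x. ln (1 + x) - 2 * x / (2 + x)) x"
    proof (rule DERIV_nonneg_imp_nondecreasing[OF less_imp_le[OF x(1)]])
      fix y :: real assume y: "0 \<le> y" "y \<le> x"
      then have nz: "1 + y \<noteq> 0" "2 + y \<noteq> 0" by auto
      have "((\<lambda>x. ln (1 + x) - 2 * x / (2 + x)) has_real_derivative 1 / (1 + y) - 4 / (2 + y) ^ 2) (at y)"
        using y nz by (auto intro!: derivative_eq_intros simp: power2_eq_square field_simps)
      moreover have "4 \<le> (2 + y) ^ 2 / (1 + y)"
        using y by (simp add: pos_le_divide_eq power2_eq_square algebra_simps)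
      then have "4 / (2 + y) ^ 2 \<le> 1 / (1 + y)"
        using y by (intro mult_imp_div_pos_le) auto
      ultimately show "\<exists>z. ((\<lambda>x. ln (1 + x) - 2 * x / (2 + x)) has_real_derivative z) (at y) \<and> 0 \<le> z"
        by (intro exI[of _ "1 / (1 + y) - 4 / (2 + y) ^ 2"]) auto
    qed
    then show ?thesis by simp
  qed
  then have 2: "2 / (2 + x) \<le> 1 / x * ln (1 + x)"
    using x by (simp add: field_simps)
  have "48 / 100 \<le> (6 / 100 * x - 2 / 5) / (1 + x) + 2 / (2 + x)"
  proof -
    have "x * x \<le> x * 1" using x by (intro mult_left_mono) auto
    moreover have "(6 / 100 * x - 2 / 5) * (2 + x) + 2 * (1 + x) - 48 / 100 * ((1 + x) * (2 + x))
        = 24 / 100 + 28 / 100 * x - 42 / 100 * (x * x)"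
      by (simp add: field_simps)
    ultimately have "48 / 100 * ((1 + x) * (2 + x)) \<le> (6 / 100 * x - 2 / 5) * (2 + x) + 2 * (1 + x)"
      using x by linarith
    moreover have "(6 / 100 * x - 2 / 5) / (1 + x) + 2 / (2 + x)
       = ((6 / 100 * x - 2 / 5) * (2 + x) + 2 * (1 + x)) / ((1 + x) * (2 + x))"
      using x by (simp add: add_frac_eq)
    moreover have "0 < (1 + x) * (2 + x)" using x by simp
    ultimately show ?thesis by (simp only: pos_le_divide_eq)
  qed
  with 1 2 have "48 / 100 \<le> x / (1 + x) * ln x + 1 / x * ln (1 + x)" by linarith
  then have "exp (48 / 100) \<le> exp (x / (1 + x) * ln x + 1 / x * ln (1 + x))" by simp
  also have "\<dots> = x powr (x / (1 + x)) * (1 + x) powr (1 / x)"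
    using x by (simp add: powr_def exp_add)
  finally show ?thesis .
qed

lemma powr_mix_ge_1:
  fixes x :: real
  assumes x: "0 < x"
  shows "1 \<le> x powr (x / (1 + x)) * (1 + x) powr (1 / x)"
proof (cases "x \<le> 1")
  case True
  have "1 \<le> exp (48 / 100 :: real)" by simp
  also have "\<dots> \<le> x powr (x / (1 + x)) * (1 + x) powr (1 / x)"
    using x True by (rule exp_le_powr_mix)
  finally show ?thesis .
next
  case False
  then have "1 * 1 \<le> x powr (x / (1 + x)) * (1 + x) powr (1 / x)"
    using x by (intro mult_mono ge_one_powr_ge_zero) auto
  then show ?thesis by simp
qed

text \<open>The exponent on the right is the symmetrised relative entropy of two Bernoulli laws.\<close>

lemma powr_le_exp_affine:
  fixes a b y :: real
  assumes a: "0 < a" "a < 1" and b: "0 < b" "b < 1" and y: "0 < y"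
  shows "y powr a \<le> exp ((a - b) * ln (a * (1 - b) / (b * (1 - a)))) * (1 + b * (y - 1))"
proof -
  \<comment> \<open>Relative entropy of the Bernoulli law with parameter \<open>a\<close> with
    respect to the one with parameter \<open>b\<close>. Young's inequality gives the claim with
    \<open>exp k\<close>.\<close>
  define k where "k = (1 - a) * ln ((1 - a) / (1 - b)) + a * ln (a / b)"
  have "((1 - b) / (1 - a)) powr (1 - a) * (b * y / a) powr a
      \<le> (1 - a) * ((1 - b) / (1 - a)) + a * (b * y / a)"
    using a b y by (intro Youngs_inequality_0) auto
  also have "(1 - a) * ((1 - b) / (1 - a)) = 1 - b" using a by simp
  also have "a * (b * y / a) = b * y" using a by simp
  also have "1 - b + b * y = 1 + b * (y - 1)" by (simp add: algebra_simps)
  finally have "exp k * (((1 - b) / (1 - a)) powr (1 - a) * (b * y / a) powr a) \<le> exp k * (1 + b * (y - 1))"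
    by (intro mult_left_mono) auto
  moreover have "exp k * (((1 - b) / (1 - a)) powr (1 - a) * (b * y / a) powr a) = y powr a"
    using a b y by (simp add: powr_def k_def ln_div ln_mult mult_exp_exp algebra_simps)
  \<comment> \<open>The difference of the two sides is the relative entropy with the laws exchanged,
    which is nonnegative.\<close>
  moreover have "k \<le> (a - b) * ln (a * (1 - b) / (b * (1 - a)))"
  proof -
    have "1 - (1 - a) / (1 - b) \<le> ln ((1 - b) / (1 - a))"
      using ln_le_minus_one[of "(1 - a) / (1 - b)"] a b by (simp add: ln_div)
    then have "(1 - b) * (1 - (1 - a) / (1 - b)) \<le> (1 - b) * ln ((1 - b) / (1 - a))"
      using b by (intro mult_left_mono) auto
    moreover have "(1 - b) * (1 - (1 - a) / (1 - b)) = a - b"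
      using b by (simp add: field_simps)
    moreover have "b * (1 - a / b) = b - a"
      using b by (simp add: field_simps)
    moreover have "1 - a / b \<le> ln (b / a)"
      using ln_le_minus_one[of "a / b"] a b by (simp add: ln_div)
    then have "b * (1 - a / b) \<le> b * ln (b / a)"
      using b by (intro mult_left_mono) auto
    ultimately have "0 \<le> (1 - b) * ln ((1 - b) / (1 - a)) + b * ln (b / a)"
      by linarith
    also have "\<dots> = (a - b) * ln (a * (1 - b) / (b * (1 - a))) - k"
    proof -
      have "ln (a * (1 - b) / (b * (1 - a))) = ln a + ln (1 - b) - ln b - ln (1 - a)"
        using a b by (simp add: ln_div ln_mult)
      then show ?thesis
        using a b by (simp add: k_def ln_div) (simp add: algebra_simps)
    qed
    finally show ?thesis by simp
  qed
  then have "exp k * (1 + b * (y - 1)) \<le> exp ((a - b) * ln (a * (1 - b) / (b * (1 - a)))) * (1 + b * (y - 1))"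
  proof -
    assume "k \<le> (a - b) * ln (a * (1 - b) / (b * (1 - a)))"
    moreover have "0 \<le> (1 - b) + b * y" using b y by (intro add_nonneg_nonneg) auto
    ultimately show ?thesis by (intro mult_right_mono) (auto simp: algebra_simps)
  qed
  ultimately show ?thesis by linarith
qed

section \<open>Profiles from affine bounds and pure powers\<close>

lemma affine_powr_neg_le:
  fixes a b y M :: real
  assumes a: "0 < a" "a < 1" and b: "0 < b" "b < 1" and y: "0 < y" and M: "0 < M"
  shows "(1 + b * (y - 1)) powr (- M) \<le> exp (M * (a - b) * ln (a * (1 - b) / (b * (1 - a)))) * y powr (- (M * a))"
proof -
  define e where "e = (a - b) * ln (a * (1 - b) / (b * (1 - a)))"
  have "y powr a \<le> exp e * (1 + b * (y - 1))"
    unfolding e_def using assms by (intro powr_le_exp_affine) auto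
  then have "exp (- e) * y powr a \<le> 1 + b * (y - 1)"
    by (simp add: exp_minus field_simps)
  then have "(1 + b * (y - 1)) powr (- M) \<le> (exp (- e) * y powr a) powr (- M)"
    using y M by (intro powr_mono2') auto
  also have "\<dots> = exp (M * e) * y powr (- (M * a))"
    using y by (simp add: powr_mult powr_powr exp_powr_real mult.commute)
  finally show ?thesis by (simp add: e_def mult.assoc)
qed

text \<open>The branches meet at 1 with value \<open>C\<close>. An exponent below the critical one
  near 0 and above it at infinity makes \<open>two_power C e1 e2 (N z powr p)\<close> integrable,
  which no single power achieves.\<close>

definition two_power :: "real \<Rightarrow> real \<Rightarrow> real \<Rightarrow> real \<Rightarrow> real" where
  "two_power C e1 e2 y = C * (if y \<le> 1 then y powr (- e1) else y powr (- e2))"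

text \<open>The tangent inequality with \<open>Z = 1 + b * (y - 1)\<close> is affine in
  \<open>w\<close> and \<open>y\<close>. Taking \<open>c1 = M + 1\<close> and
  \<open>c2 = M * b\<close> leaves a constant 1 to spare, which covers \<open>max 0 (1 - w)\<close>;
  hence \<open>L = 1\<close>.\<close>

lemma profile_of_affine_bound:
  assumes "0 < M" "G \<in> borel_measurable borel" "\<And>y. 0 \<le> G y"
    and "\<And>y z. 0 < y \<Longrightarrow> y \<le> z \<Longrightarrow> G z \<le> G y"
    and b: "0 \<le> b" "b < 1" "\<And>y. 0 < y \<Longrightarrow> (1 + b * (y - 1)) powr (- M) \<le> G y"
  shows "profile M 1 G"
proof -
  have "max 0 (1 - w) + (M + 1) * (w - 1) - (M * b) * (y - 1) \<le> 1 * G y * w powr (M + 1)"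
    if y: "0 < y" and w: "0 \<le> w" for y w
  proof -
    have "0 < (1 - b) + b * y" using b y by (intro add_pos_nonneg) auto
    then have Z: "0 < 1 + b * (y - 1)" by (simp add: algebra_simps)
    have "max 0 (1 - w) + (M + 1) * (w - 1) - (M * b) * (y - 1) \<le> (M + 1) * w - M * (1 + b * (y - 1))"
      using w by (simp add: algebra_simps)
    also have "\<dots> \<le> (1 + b * (y - 1)) powr (- M) * w powr (M + 1)"
      using assms(1) w Z by (intro perspective_tangent) auto
    also have "\<dots> \<le> G y * w powr (M + 1)"
      using b(3)[OF y] by (intro mult_right_mono) auto
    finally show ?thesis by simp
  qed
  moreover have "\<exists>b\<in>{0..1}. \<forall>y>0. (1 + b * (y - 1)) powr (- M) \<le> G y"
    using b by (intro bexI[of _ b]) auto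
  ultimately show ?thesis
    unfolding profile_def using assms(2-4) by blast
qed

text \<open>Two slopes make \<open>L\<close> proportional to \<open>peak M\<close>. Slope
  \<open>k\<close> serves \<open>w >= 1\<close> with weight \<open>u / (u - k)\<close>, slope
  \<open>u\<close> serves \<open>w < 1\<close> with weight \<open>k / (u - k)\<close>. The weights
  differ by 1, which accounts for \<open>max 0 (1 - w)\<close>, and weight times slope is the same,
  so one pair \<open>c1\<close>, \<open>c2\<close> fits both ranges.\<close>

lemma profile_of_two_affine_bounds:
  assumes M: "0 < M" and G: "G \<in> borel_measurable borel" "\<And>y. 0 \<le> G y"
    "\<And>y z. 0 < y \<Longrightarrow> y \<le> z \<Longrightarrow> G z \<le> G y"
    and k: "0 < k" "k < u" "u < 1"
    and le_k: "\<And>y. 0 < y \<Longrightarrow> (1 + k * (y - 1)) powr (- M) \<le> G y"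
    and le_u: "\<And>y. 0 < y \<Longrightarrow> (1 + u * (y - 1)) powr (- M) \<le> G y"
  shows "profile M (peak M * (u / (u - k))) G"
proof -
  have Z: "0 < 1 + b * (y - 1)" if "0 < y" "0 < b" "b < 1" for b y :: real
  proof -
    have "0 < (1 - b) + b * y" using that by (intro add_pos_nonneg) auto
    then show ?thesis by (simp add: algebra_simps)
  qed
  have tangent: "w - (1 + b * (y - 1)) \<le> peak M * (G y * w powr (M + 1))"
    if "0 < y" "0 \<le> w" "0 < b" "b < 1" "(1 + b * (y - 1)) powr (- M) \<le> G y" for b y w
  proof -
    have "w - (1 + b * (y - 1)) \<le> peak M * (1 + b * (y - 1)) powr (- M) * w powr (M + 1)"
      using M that Z by (intro peak_tangent) auto
    also have "\<dots> = peak M * ((1 + b * (y - 1)) powr (- M) * w powr (M + 1))"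
      by (simp add: mult.assoc)
    also have "\<dots> \<le> peak M * (G y * w powr (M + 1))"
      using that peak_pos[OF M] by (intro mult_left_mono mult_right_mono) auto
    finally show ?thesis .
  qed
  have factor: "c * (w - 1) - (c * b) * (y - 1) = c * (w - (1 + b * (y - 1)))" for b c w y :: real
    by (simp add: algebra_simps)
  have "max 0 (1 - w) + u / (u - k) * (w - 1) - (u / (u - k) * k) * (y - 1)
      \<le> peak M * (u / (u - k)) * G y * w powr (M + 1)"
    if y: "0 < y" and w: "0 \<le> w" for y w
  proof (cases "1 \<le> w")
    case True
    then have "max 0 (1 - w) + u / (u - k) * (w - 1) - (u / (u - k) * k) * (y - 1)
        = u / (u - k) * (w - (1 + k * (y - 1)))"
      by (simp flip: factor)
    also have "\<dots> \<le> u / (u - k) * (peak M * (G y * w powr (M + 1)))"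
      using k y w le_k by (intro mult_left_mono tangent) auto
    finally show ?thesis by (simp add: mult_ac)
  next
    case False
    have 1: "u / (u - k) - 1 = k / (u - k)" and 2: "u / (u - k) * k = k / (u - k) * u"
      using k by (simp_all add: divide_diff_eq_iff)
    have "max 0 (1 - w) + u / (u - k) * (w - 1) - (u / (u - k) * k) * (y - 1)
        = (u / (u - k) - 1) * (w - 1) - (u / (u - k) * k) * (y - 1)"
      using False by (simp add: algebra_simps)
    also have "\<dots> = k / (u - k) * (w - 1) - (k / (u - k) * u) * (y - 1)"
      by (simp only: 1 2)
    also have "\<dots> = k / (u - k) * (w - (1 + u * (y - 1)))"
      by (rule factor)
    also have "\<dots> \<le> k / (u - k) * (peak M * (G y * w powr (M + 1)))"
      using k y w le_u by (intro mult_left_mono tangent) auto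
    also have "\<dots> \<le> u / (u - k) * (peak M * (G y * w powr (M + 1)))"
      using k G peak_pos[OF M] by (intro mult_right_mono divide_right_mono) auto
    finally show ?thesis by (simp add: mult_ac)
  qed
  moreover have "\<exists>b\<in>{0..1}. \<forall>y>0. (1 + b * (y - 1)) powr (- M) \<le> G y"
    using k le_k by (intro bexI[of _ k]) auto
  ultimately show ?thesis
    unfolding profile_def using G by blast
qed

lemma two_power_measurable [measurable]: "two_power C e1 e2 \<in> borel_measurable borel"
  unfolding two_power_def[abs_def] by measurable

lemma two_power_nonneg: "0 \<le> C \<Longrightarrow> 0 \<le> two_power C e1 e2 y"
  by (simp add: two_power_def)

lemma two_power_antimono:
  assumes "0 \<le> C" "0 \<le> e1" "0 \<le> e2" "0 < y" "y \<le> z"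
  shows "two_power C e1 e2 z \<le> two_power C e1 e2 y"
proof -
  have "(if z \<le> 1 then z powr (- e1) else z powr (- e2)) \<le> (if y \<le> 1 then y powr (- e1) else y powr (- e2))"
  proof (cases "z \<le> 1")
    case True
    then show ?thesis using assms by (auto intro!: powr_mono2')
  next
    case z: False
    show ?thesis
    proof (cases "y \<le> 1")
      case True
      have "z powr (- e2) \<le> 1 powr (- e2)" using assms z by (intro powr_mono2') auto
      also have "\<dots> = 1 powr (- e1)" by simp
      also have "\<dots> \<le> y powr (- e1)" using assms True by (intro powr_mono2') auto
      finally show ?thesis using z True by simp
    next
      case False
      then show ?thesis using assms z by (auto intro!: powr_mono2')
    qed
  qed
  then show ?thesis unfolding two_power_def using assms by (intro mult_left_mono) auto
qed

text \<open>Each of the two powers, with prefactor \<open>C\<close>, dominates the affine bound for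
  all \<open>y > 0\<close>, so it does not matter where the branches are joined.\<close>

lemma affine_le_two_power:
  assumes M: "0 < M" and b: "0 < b" "b < 1" and k: "0 < k" "k < 1" and u: "0 < u" "u < 1"
    and C: "exp (M * (k - b) * ln (k * (1 - b) / (b * (1 - k)))) \<le> C"
      "exp (M * (u - b) * ln (u * (1 - b) / (b * (1 - u)))) \<le> C"
    and y: "0 < y"
  shows "(1 + b * (y - 1)) powr (- M) \<le> two_power C (M * k) (M * u) y"
proof -
  have "(1 + b * (y - 1)) powr (- M) \<le> C * y powr (- (M * k))"
    using affine_powr_neg_le[OF k b y M] C(1) by (meson mult_right_mono order_trans powr_ge_zero)
  moreover have "(1 + b * (y - 1)) powr (- M) \<le> C * y powr (- (M * u))"
    using affine_powr_neg_le[OF u b y M] C(2) by (meson mult_right_mono order_trans powr_ge_zero)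
  ultimately show ?thesis by (simp add: two_power_def)
qed

text \<open>
  The two exponents move the odds of \<open>\<alpha>\<close> down and up by the factor \<open>1 + h\<close>.
\<close>

definition lower_odds :: "real \<Rightarrow> real \<Rightarrow> real" where
  "lower_odds \<alpha> h = \<alpha> / (1 + (1 - \<alpha>) * h)"

definition upper_odds :: "real \<Rightarrow> real \<Rightarrow> real" where
  "upper_odds \<alpha> h = \<alpha> * (1 + h) / (1 + \<alpha> * h)"

context
  fixes \<alpha> h :: real
  assumes \<alpha>: "0 < \<alpha>" "\<alpha> < 1" and h: "0 < h"
begin

lemma odds_denominators: "0 < 1 + (1 - \<alpha>) * h" "0 < 1 + \<alpha> * h"
  using \<alpha> h by (auto intro: add_pos_pos)

lemma lower_odds_pos: "0 < lower_odds \<alpha> h" and lower_odds_less: "lower_odds \<alpha> h < \<alpha>"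
  and upper_odds_greater: "\<alpha> < upper_odds \<alpha> h"
  and one_minus_lower_odds: "1 - lower_odds \<alpha> h = (1 - \<alpha>) * (1 + h) / (1 + (1 - \<alpha>) * h)"
  and one_minus_upper_odds: "1 - upper_odds \<alpha> h = (1 - \<alpha>) / (1 + \<alpha> * h)"
  and minus_lower_odds: "\<alpha> - lower_odds \<alpha> h = \<alpha> * (1 - \<alpha>) * h / (1 + (1 - \<alpha>) * h)"
  and upper_odds_minus: "upper_odds \<alpha> h - \<alpha> = \<alpha> * (1 - \<alpha>) * h / (1 + \<alpha> * h)"
proof -
  show "0 < lower_odds \<alpha> h"
    using odds_denominators \<alpha> by (simp add: lower_odds_def)
  show "1 - lower_odds \<alpha> h = (1 - \<alpha>) * (1 + h) / (1 + (1 - \<alpha>) * h)"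
    using odds_denominators(1) by (simp add: lower_odds_def diff_divide_eq_iff algebra_simps)
  show "1 - upper_odds \<alpha> h = (1 - \<alpha>) / (1 + \<alpha> * h)"
    using odds_denominators(2) by (simp add: upper_odds_def diff_divide_eq_iff algebra_simps)
  show 1: "\<alpha> - lower_odds \<alpha> h = \<alpha> * (1 - \<alpha>) * h / (1 + (1 - \<alpha>) * h)"
    using odds_denominators(1) by (simp add: lower_odds_def diff_divide_eq_iff algebra_simps)
  show 2: "upper_odds \<alpha> h - \<alpha> = \<alpha> * (1 - \<alpha>) * h / (1 + \<alpha> * h)"
    using odds_denominators(2) by (simp add: upper_odds_def divide_diff_eq_iff algebra_simps)
  have "0 < \<alpha> - lower_odds \<alpha> h" "0 < upper_odds \<alpha> h - \<alpha>"
    unfolding 1 2 using odds_denominators \<alpha> h by auto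
  then show "lower_odds \<alpha> h < \<alpha>" "\<alpha> < upper_odds \<alpha> h" by auto
qed

lemma upper_odds_less_1: "upper_odds \<alpha> h < 1"
proof -
  have "0 < 1 - upper_odds \<alpha> h"
    unfolding one_minus_upper_odds using odds_denominators \<alpha> by auto
  then show ?thesis by simp
qed

text \<open>The logarithm in the Bernoulli exponent is a difference of log odds. On the odds scale
  the ratios that occur are powers of \<open>1 + h\<close>, whatever \<open>\<alpha>\<close>
  is.\<close>

lemma odds_ratios:
  "lower_odds \<alpha> h * (1 - \<alpha>) / (\<alpha> * (1 - lower_odds \<alpha> h)) = 1 / (1 + h)"
  "upper_odds \<alpha> h * (1 - \<alpha>) / (\<alpha> * (1 - upper_odds \<alpha> h)) = 1 + h"
  "upper_odds \<alpha> h * (1 - lower_odds \<alpha> h) / (lower_odds \<alpha> h * (1 - upper_odds \<alpha> h)) = (1 + h) ^ 2"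
  unfolding one_minus_lower_odds one_minus_upper_odds
  using odds_denominators \<alpha> h by (simp_all add: lower_odds_def upper_odds_def power2_eq_square)

lemma odds_difference:
  "upper_odds \<alpha> h - lower_odds \<alpha> h
    = \<alpha> * (1 - \<alpha>) * h * (2 + h) / ((1 + (1 - \<alpha>) * h) * (1 + \<alpha> * h))"
proof -
  have "upper_odds \<alpha> h - lower_odds \<alpha> h = (upper_odds \<alpha> h - \<alpha>) + (\<alpha> - lower_odds \<alpha> h)" by simp
  also have "\<dots> = \<alpha> * (1 - \<alpha>) * h / (1 + \<alpha> * h) + \<alpha> * (1 - \<alpha>) * h / (1 + (1 - \<alpha>) * h)"
    by (simp only: minus_lower_odds upper_odds_minus)
  also have "\<dots> = \<alpha> * (1 - \<alpha>) * h * (2 + h) / ((1 + (1 - \<alpha>) * h) * (1 + \<alpha> * h))"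
    using odds_denominators by (simp add: add_frac_eq algebra_simps)
  finally show ?thesis .
qed

end

text \<open>For this \<open>M\<close> the exponent \<open>M * \<alpha>\<close> is critical, and the
  two odds lie on either side of \<open>\<alpha>\<close>. Their form makes the numerators
  \<open>1 + (1 - \<alpha>) * h\<close> and \<open>1 + \<alpha> * h\<close> add up to
  \<open>2 + h\<close>; the factor \<open>V / (1 - \<alpha>)\<close> is the value of the integral in
  \<open>kappa\<close>.\<close>

lemma (in vec_norm) nn_integral_two_power_odds:
  assumes \<alpha>: "0 < \<alpha>" "\<alpha> < 1" and h: "0 < h" and p: "0 < p" and M: "M = d / (\<alpha> * p)" and C: "0 < C"
  shows "(\<integral>\<^sup>+ z. ennreal (two_power C (M * lower_odds \<alpha> h) (M * upper_odds \<alpha> h) (N z powr p)) \<partial>lborel)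
    = ennreal (C * (V / (1 - \<alpha>)) * ((2 + h) / h))"
proof -
  note den = odds_denominators[OF \<alpha> h]
  define e1 where "e1 = d * (1 / (1 + (1 - \<alpha>) * h))"
  define e2 where "e2 = d * ((1 + h) / (1 + \<alpha> * h))"
  have d_pos: "0 < d" using d_ge_1 by simp
  have e: "p * (M * lower_odds \<alpha> h) = e1" "p * (M * upper_odds \<alpha> h) = e2"
    using \<alpha> p by (simp_all add: M e1_def e2_def lower_odds_def upper_odds_def)
  have de1: "d - e1 = d * ((1 - \<alpha>) * h / (1 + (1 - \<alpha>) * h))"
  proof -
    have "1 - 1 / (1 + (1 - \<alpha>) * h) = (1 - \<alpha>) * h / (1 + (1 - \<alpha>) * h)"
      using den(1) by (simp add: diff_divide_eq_iff)
    then show ?thesis unfolding e1_def by (metis mult.right_neutral right_diff_distrib)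
  qed
  have de2: "e2 - d = d * ((1 - \<alpha>) * h / (1 + \<alpha> * h))"
  proof -
    have "(1 + h) / (1 + \<alpha> * h) - 1 = (1 - \<alpha>) * h / (1 + \<alpha> * h)"
      using den(2) by (simp add: divide_diff_eq_iff algebra_simps)
    then show ?thesis unfolding e2_def by (metis mult.right_neutral right_diff_distrib)
  qed
  have "0 < d - e1" "0 < e2 - d" unfolding de1 de2 using den d_pos \<alpha> h by auto
  then have lt: "e1 < d" "d < e2" by auto
  have "(\<integral>\<^sup>+ z. ennreal (two_power C (M * lower_odds \<alpha> h) (M * upper_odds \<alpha> h) (N z powr p)) \<partial>lborel)
    = (\<integral>\<^sup>+ z. ennreal C * ennreal (if N z \<le> 1 then N z powr (- e1) else N z powr (- e2)) \<partial>lborel)"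
  proof (rule nn_integral_cong)
    fix z
    have "N z powr p \<le> 1 \<longleftrightarrow> N z \<le> 1"
    proof (cases "N z \<le> 1")
      case True
      then show ?thesis using p powr_le1[of p "N z"] by simp
    next
      case False
      then have "1 powr p < N z powr p" using p by (intro powr_less_mono2) auto
      then show ?thesis using False by simp
    qed
    then show "ennreal (two_power C (M * lower_odds \<alpha> h) (M * upper_odds \<alpha> h) (N z powr p))
      = ennreal C * ennreal (if N z \<le> 1 then N z powr (- e1) else N z powr (- e2))"
      using C by (simp add: two_power_def powr_powr e ennreal_mult')
  qed
  also have "\<dots> = ennreal C * ennreal (V * d * (1 / (d - e1) + 1 / (e2 - d)))"
    using lt by (simp add: nn_integral_cmult nn_integral_two_powers)
  also have "V * d * (1 / (d - e1) + 1 / (e2 - d)) = V / (1 - \<alpha>) * ((2 + h) / h)"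
  proof -
    have "d * (1 / (d - e1) + 1 / (e2 - d))
        = (1 + (1 - \<alpha>) * h) / ((1 - \<alpha>) * h) + (1 + \<alpha> * h) / ((1 - \<alpha>) * h)"
    proof -
      have "d * (1 / (d * (n / m))) = m / n" for m n :: real using d_pos by simp
      then show ?thesis unfolding de1 de2 distrib_left by (simp only:)
    qed
    also have "\<dots> = (2 + h) / ((1 - \<alpha>) * h)"
      by (simp add: add_divide_distrib[symmetric] algebra_simps)
    finally show ?thesis by (simp add: mult.assoc)
  qed
  finally show ?thesis using C by (simp add: ennreal_mult'[symmetric] mult.assoc)
qed

text \<open>\<open>h\<close> is the positive root of the quadratic equation. For
  \<open>Q >= 1 / 4\<close> it satisfies \<open>h * h <= 1 + h\<close>, so it is at most the golden
  ratio, which is below \<open>5 / 3\<close>.\<close>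

lemma obtain_odds_step:
  fixes Q :: real
  assumes "1 / 4 \<le> Q"
  obtains h where "0 < h" "h \<le> 5 / 3" "4 * Q * h ^ 2 = 1 + h"
proof
  define h where "h = (1 + sqrt (1 + 16 * Q)) / (8 * Q)"
  have s: "0 < sqrt (1 + 16 * Q)" "sqrt (1 + 16 * Q) ^ 2 = 1 + 16 * Q" using assms by auto
  then show "0 < h" using assms unfolding h_def by (intro divide_pos_pos add_pos_pos) auto
  have "8 * Q * h - 1 = sqrt (1 + 16 * Q)" using assms by (simp add: h_def)
  then have "(8 * Q * h - 1) ^ 2 = 1 + 16 * Q" using s by simp
  then have "16 * Q * (4 * Q * h ^ 2) = 16 * Q * (1 + h)" by (simp add: power2_eq_square algebra_simps)
  then show eq: "4 * Q * h ^ 2 = 1 + h" using assms by simp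
  show "h \<le> 5 / 3"
  proof (rule ccontr)
    assume h: "\<not> h \<le> 5 / 3"
    have "1 * h ^ 2 \<le> 4 * Q * h ^ 2" using assms by (intro mult_right_mono) auto
    then have "h * h \<le> 1 + h" using eq by (simp add: power2_eq_square)
    moreover have "5 / 3 * h \<le> h * h" using h by (intro mult_right_mono) auto
    ultimately show False using h by linarith
  qed
qed

text \<open>
  What is left of the comparison with the constant of the theorem after the powers of 2 have been
  cancelled against \<open>2 powr (d / \<alpha>) \<ge> 2 powr d * (1 + 2 / 3 * (1 - \<alpha>))\<close>.
\<close>

lemma exists_exponents:
  fixes \<alpha> x M :: real
  assumes \<alpha>: "0 < \<alpha>" "\<alpha> < 1" and x: "0 < x" "x \<le> 1" and M: "0 < M" "M * x < 1"
  obtains C h L where "0 < C" "0 < h" "0 < L"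
    "profile M L (two_power C (M * lower_odds \<alpha> h) (M * upper_odds \<alpha> h))"
    "max x L * (C * ((2 + h) / h)) \<le> 3 * (1 + x) * exp (48 / 100) * (1 + 2 / 3 * (1 - \<alpha>))"
proof -
  \<comment> \<open>\<open>Q\<close> measures the cost of moving away from \<open>\<alpha>\<close>:
    for an odds step \<open>h\<close>, \<open>M\<close> times the distance of either exponent
    parameter from \<open>\<alpha>\<close> is \<open>Q * h\<close> divided by a number at least
    1.\<close>
  define Q where "Q = M * \<alpha> * (1 - \<alpha>)"
  have Q: "0 < Q" using M \<alpha> by (simp add: Q_def)
  have exp48: "148 / 100 \<le> exp (48 / 100 :: real)"
    using exp_ge_add_one_self[of "48 / 100 :: real"] by simp
  show thesis
  proof (cases "Q \<le> 1 / 4")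
    \<comment> \<open>Small \<open>Q\<close>: a single affine bound of slope \<open>\<alpha>\<close>
      and \<open>h = 2\<close>. Then \<open>C <= sqrt 3 <= 2\<close>, so the left side is at most 4,
      below \<open>3 * (148 / 100)\<close>.\<close>
    case True
    define C where "C = exp (Q * 2 * ln (3 :: real))"
    let ?k = "lower_odds \<alpha> 2" and ?u = "upper_odds \<alpha> 2"
    note den = odds_denominators[OF \<alpha>, of 2, simplified]
    note k = lower_odds_pos[OF \<alpha>, of 2] lower_odds_less[OF \<alpha>, of 2]
      upper_odds_greater[OF \<alpha>, of 2] upper_odds_less_1[OF \<alpha>, of 2]
    have frac: "Q * 2 / c \<le> Q * 2" if "1 \<le> c" for c :: real
      using that Q by (simp add: divide_le_eq)
    have "ln (?k * (1 - \<alpha>) / (\<alpha> * (1 - ?k))) = - ln 3"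
      by (subst odds_ratios(1)[OF \<alpha>]) (simp_all add: ln_div)
    then have "M * (?k - \<alpha>) * ln (?k * (1 - \<alpha>) / (\<alpha> * (1 - ?k))) = M * (\<alpha> - ?k) * ln 3"
      by (simp add: algebra_simps)
    also have "\<dots> = Q * 2 / (1 + (1 - \<alpha>) * 2) * ln 3"
      using minus_lower_odds[OF \<alpha>, of 2] by (simp add: Q_def)
    also have "\<dots> \<le> Q * 2 * ln 3"
      using \<alpha> by (intro mult_right_mono frac) auto
    finally have C1: "exp (M * (?k - \<alpha>) * ln (?k * (1 - \<alpha>) / (\<alpha> * (1 - ?k)))) \<le> C"
      by (simp add: C_def)
    have "M * (?u - \<alpha>) * ln (?u * (1 - \<alpha>) / (\<alpha> * (1 - ?u))) = M * (?u - \<alpha>) * ln 3"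
      using odds_ratios(2)[OF \<alpha>, of 2] by simp
    also have "\<dots> = Q * 2 / (1 + \<alpha> * 2) * ln 3"
      using upper_odds_minus[OF \<alpha>, of 2] by (simp add: Q_def)
    also have "\<dots> \<le> Q * 2 * ln 3"
      using \<alpha> by (intro mult_right_mono frac) auto
    finally have C2: "exp (M * (?u - \<alpha>) * ln (?u * (1 - \<alpha>) / (\<alpha> * (1 - ?u)))) \<le> C"
      by (simp add: C_def)
    have C: "0 < C" by (simp add: C_def)
    have "profile M 1 (two_power C (M * ?k) (M * ?u))"
    proof (rule profile_of_affine_bound[OF M(1)])
      show "two_power C (M * ?k) (M * ?u) z \<le> two_power C (M * ?k) (M * ?u) y" if "0 < y" "y \<le> z" for y z
        using that C M k \<alpha> by (intro two_power_antimono) auto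
      show "(1 + \<alpha> * (y - 1)) powr (- M) \<le> two_power C (M * ?k) (M * ?u) y" if "0 < y" for y
        using that k \<alpha> M C1 C2 by (intro affine_le_two_power) auto
    qed (use C \<alpha> in \<open>auto intro: two_power_nonneg\<close>)
    moreover have "max x 1 * (C * ((2 + 2) / 2)) \<le> 3 * (1 + x) * exp (48 / 100) * (1 + 2 / 3 * (1 - \<alpha>))"
    proof -
      have "C \<le> exp (1 / 2 * ln 3)" unfolding C_def using True by simp
      also have "\<dots> = sqrt 3" by (simp add: powr_def flip: powr_half_sqrt)
      also have "\<dots> \<le> 2" by (rule real_le_lsqrt) auto
      finally have "max x 1 * (C * ((2 + 2) / 2)) \<le> 3 * 1 * (148 / 100) * 1" using x by simp
      also have "\<dots> \<le> 3 * (1 + x) * exp (48 / 100) * (1 + 2 / 3 * (1 - \<alpha>))"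
        using x \<alpha> exp48 by (intro mult_mono) auto
      finally show ?thesis .
    qed
    ultimately show thesis using C by (intro that[of C 2 1]) auto
  next
    \<comment> \<open>Large \<open>Q\<close>: two affine bounds whose slopes are the exponent
      parameters \<open>?k\<close> and \<open>?u\<close> themselves. A slope has divergence 0 from
      its own parameter, which asks for \<open>C >= 1\<close>, and exponent \<open>e\<close> towards
      the other one. The equation for \<open>h\<close> keeps \<open>e\<close> bounded.\<close>
    case False
    then obtain h where h: "0 < h" "h \<le> 5 / 3" "4 * Q * h ^ 2 = 1 + h"
      using obtain_odds_step[of Q] by auto
    let ?k = "lower_odds \<alpha> h" and ?u = "upper_odds \<alpha> h"
    note den = odds_denominators[OF \<alpha> h(1)]
    note k = lower_odds_pos[OF \<alpha> h(1)] lower_odds_less[OF \<alpha> h(1)]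
      upper_odds_greater[OF \<alpha> h(1)] upper_odds_less_1[OF \<alpha> h(1)]
    define e where "e = M * (?u - ?k) * ln ((1 + h) ^ 2)"
    define C where "C = exp e"
    have C: "0 < C" by (simp add: C_def)
    have e_nonneg: "0 \<le> e" unfolding e_def using M k h by (intro mult_nonneg_nonneg) auto
    have Qh: "Q * h = (1 + h) / (4 * h)" using h by (simp add: power2_eq_square field_simps)
    have e_le: "e \<le> 119 / 100"
    proof -
      have "1 + h \<le> (1 + (1 - \<alpha>) * h) * (1 + \<alpha> * h)"
        using \<alpha> h by (simp add: algebra_simps)
      then have "Q * h * (2 + h) / ((1 + (1 - \<alpha>) * h) * (1 + \<alpha> * h)) \<le> Q * h * (2 + h) / (1 + h)"
        using Q h den by (intro divide_left_mono) auto
      moreover have "Q * h * (2 + h) / (1 + h) = (2 + h) / (4 * h)"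
        unfolding Qh using h by simp
      moreover have "M * (?u - ?k) = Q * h * (2 + h) / ((1 + (1 - \<alpha>) * h) * (1 + \<alpha> * h))"
        unfolding odds_difference[OF \<alpha> h(1)] by (simp add: Q_def)
      ultimately have "e \<le> (2 + h) / (4 * h) * ln ((1 + h) ^ 2)"
        unfolding e_def using h by (intro mult_right_mono) auto
      also have "\<dots> = (2 + h) / (2 * h) * ln (1 + h)"
        using h by (simp add: ln_realpow)
      also have "\<dots> \<le> 119 / 100" by (rule ln_1_plus_ratio_le[OF h(1,2)])
      finally show ?thesis .
    qed
    have Cu: "exp (M * (?u - ?k) * ln (?u * (1 - ?k) / (?k * (1 - ?u)))) \<le> C"
      using odds_ratios(3)[OF \<alpha> h(1)] by (simp add: C_def e_def)
    have Ck: "exp (M * (?k - ?u) * ln (?k * (1 - ?u) / (?u * (1 - ?k)))) \<le> C"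
    proof -
      have "?k * (1 - ?u) / (?u * (1 - ?k)) = 1 / (1 + h) ^ 2"
        using odds_ratios(3)[OF \<alpha> h(1)] by (metis inverse_divide inverse_eq_divide)
      then have "M * (?k - ?u) * ln (?k * (1 - ?u) / (?u * (1 - ?k))) = e"
        using h by (simp add: e_def ln_div algebra_simps)
      then show ?thesis by (simp add: C_def)
    qed
    have C_ge_1: "1 \<le> C" using e_nonneg by (simp add: C_def)
    define L where "L = peak M * (?u / (?u - ?k))"
    have L: "0 < L" using peak_pos[OF M(1)] k \<alpha> by (simp add: L_def)
    have "profile M L (two_power C (M * ?k) (M * ?u))"
      unfolding L_def
    proof (rule profile_of_two_affine_bounds[OF M(1)])
      show "two_power C (M * ?k) (M * ?u) z \<le> two_power C (M * ?k) (M * ?u) y" if "0 < y" "y \<le> z" for y z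
        using that C M k \<alpha> by (intro two_power_antimono) auto
      show "(1 + ?k * (y - 1)) powr (- M) \<le> two_power C (M * ?k) (M * ?u) y" if "0 < y" for y
        using that k \<alpha> M Cu C_ge_1 by (intro affine_le_two_power) auto
      show "(1 + ?u * (y - 1)) powr (- M) \<le> two_power C (M * ?k) (M * ?u) y" if "0 < y" for y
        using that k \<alpha> M Ck C_ge_1 by (intro affine_le_two_power) auto
    qed (use C k in \<open>auto intro: two_power_nonneg\<close>)
    moreover have "max x L * (C * ((2 + h) / h)) \<le> 3 * (1 + x) * exp (48 / 100) * (1 + 2 / 3 * (1 - \<alpha>))"
    proof -
      have C_le: "C \<le> exp (119 / 100)" using e_le by (simp add: C_def)
      have "x * (C * ((2 + h) / h)) \<le> 3 * (1 + x) * exp (48 / 100) * (1 + 2 / 3 * (1 - \<alpha>))"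
      proof -
        \<comment> \<open>\<open>M * x < 1\<close> and
          \<open>4 * (\<alpha> * (1 - \<alpha>)) <= 1\<close> turn the equation for \<open>h\<close>
          into a bound on \<open>x\<close>.\<close>
        have Mx: "x * (1 + h) \<le> h ^ 2"
        proof -
          have "x * (1 + h) = (M * x) * (4 * (\<alpha> * (1 - \<alpha>)) * h ^ 2)"
            using h(3)[symmetric] by (simp add: Q_def mult_ac)
          also have "\<dots> \<le> 1 * (1 * h ^ 2)"
          proof (intro mult_mono)
            have "0 \<le> (1 - 2 * \<alpha>) ^ 2" by simp
            then show "4 * (\<alpha> * (1 - \<alpha>)) \<le> 1" by (simp add: power2_eq_square algebra_simps)
          qed (use M x \<alpha> in auto)
          finally show ?thesis by simp
        qed
        have "x * ((2 + h) / h) \<le> 130 / 100 * (1 + x)"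
        proof -
          have "x * (1 + h) * (2 - 30 / 100 * h) \<le> h ^ 2 * (2 - 30 / 100 * h)"
            using Mx h by (intro mult_right_mono) auto
          also have "\<dots> \<le> 130 / 100 * h * (1 + h)"
          proof -
            have "h * (2 - 30 / 100 * h) \<le> 130 / 100 * (1 + h)"
              using h zero_le_power2[of "h - 1"] by (simp add: power2_eq_square algebra_simps)
            then have "h * (h * (2 - 30 / 100 * h)) \<le> h * (130 / 100 * (1 + h))"
              using h by (intro mult_left_mono) auto
            then show ?thesis by (simp add: power2_eq_square mult_ac)
          qed
          finally have "(1 + h) * (x * (2 - 30 / 100 * h)) \<le> (1 + h) * (130 / 100 * h)"
            by (simp add: mult_ac)
          then have "x * (2 - 30 / 100 * h) \<le> 130 / 100 * h"
            by (rule mult_left_le_imp_le) (use h in simp)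
          then have "x * (2 + h) \<le> 130 / 100 * (1 + x) * h" by (simp add: algebra_simps)
          then show ?thesis using h by (simp add: pos_divide_le_eq)
        qed
        then have "C * (x * ((2 + h) / h)) \<le> C * (130 / 100 * (1 + x))"
          using C by (intro mult_left_mono) auto
        then have "x * (C * ((2 + h) / h)) \<le> C * (130 / 100 * (1 + x))"
          by (simp only: mult.left_commute)
        also have "\<dots> \<le> exp (119 / 100) * (130 / 100 * (1 + x))"
          using C_le x by (intro mult_right_mono) auto
        \<comment> \<open>Splitting 119 as 71 + 48 isolates the factor \<open>exp (48 / 100)\<close>
          of the target; the rest is at most \<open>130 / 100 * (22 / 10)\<close>, which is below
          3.\<close>
        also have "\<dots> = 130 / 100 * exp (71 / 100) * exp (48 / 100) * (1 + x)"
        proof -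
          have "exp (119 / 100) = exp (71 / 100) * exp (48 / 100 :: real)" by (simp flip: exp_add)
          then show ?thesis by (simp only: mult_ac)
        qed
        also have "\<dots> \<le> 3 * exp (48 / 100) * (1 + x)"
        proof -
          have "exp (71 / 100) \<le> (22 / 10 :: real)"
          proof -
            have "exp (71 / 100 :: real) = exp (71 / 200) ^ 2" by (simp flip: exp_of_nat_mult)
            also have "\<dots> \<le> (1 + 71 / 200 + (71 / 200) ^ 2) ^ 2"
              by (intro power_mono exp_bound) auto
            also have "\<dots> \<le> 22 / 10" by (simp add: power2_eq_square)
            finally show ?thesis .
          qed
          then show ?thesis using x by (intro mult_right_mono) auto
        qed
        also have "\<dots> \<le> 3 * (1 + x) * exp (48 / 100) * (1 + 2 / 3 * (1 - \<alpha>))"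
          using x \<alpha> by (simp add: mult_ac)
        finally show ?thesis .
      qed
      moreover have "L * (C * ((2 + h) / h)) \<le> 3 * (1 + x) * exp (48 / 100) * (1 + 2 / 3 * (1 - \<alpha>))"
      proof -
        have ratio: "?u / (?u - ?k) = (1 + h) * (1 + (1 - \<alpha>) * h) / ((1 - \<alpha>) * h * (2 + h))"
          unfolding odds_difference[OF \<alpha> h(1)] using \<alpha> h den by (simp add: upper_odds_def)
        have "L \<le> 1 / (exp 1 * M) * (?u / (?u - ?k))"
          unfolding L_def using peak_le[OF M(1)] k \<alpha> by (intro mult_right_mono) auto
        then have "L * (C * ((2 + h) / h)) \<le> 1 / (exp 1 * M) * (?u / (?u - ?k)) * (exp (119 / 100) * ((2 + h) / h))"
          using C_le C L h by (intro mult_mono) auto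
        also have "\<dots> = exp (119 / 100) / exp 1 * ((?u / (?u - ?k)) * ((2 + h) / h) / M)"
          by (simp add: mult_ac)
        \<comment> \<open>\<open>M\<close> occurs only in \<open>Q * h ^ 2\<close>, which equals
          \<open>(1 + h) / 4\<close>, so it disappears.\<close>
        also have "(?u / (?u - ?k)) * ((2 + h) / h) / M = 4 * \<alpha> * (1 + (1 - \<alpha>) * h)"
        proof -
          have "(?u / (?u - ?k)) * ((2 + h) / h) / M = \<alpha> * (1 + h) * (1 + (1 - \<alpha>) * h) / (Q * h ^ 2)"
            unfolding ratio Q_def using \<alpha> h M by (simp add: power2_eq_square)
          also have "Q * h ^ 2 = (1 + h) / 4" using h by simp
          finally show ?thesis using h by simp
        qed
        also have "exp (119 / 100) / exp 1 = exp (19 / 100 :: real)"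
          by (simp flip: exp_diff)
        also have "\<dots> * (4 * \<alpha> * (1 + (1 - \<alpha>) * h)) \<le> 3 * exp (48 / 100) * (1 + 2 / 3 * (1 - \<alpha>))"
        proof -
          have "exp (19 / 100) * 4 \<le> (3 * exp (48 / 100) :: real)"
          proof -
            have "4 / 3 \<le> exp (29 / 100 :: real)"
            proof -
              have "(4 / 3 :: real) \<le> (1 + 145 / 1000 + (145 / 1000) ^ 2 / 2) ^ 2"
                by (simp add: power2_eq_square)
              also have "\<dots> \<le> exp (145 / 1000) ^ 2"
                using exp_lower_Taylor_quadratic[of "145 / 1000 :: real"] by (intro power_mono) auto
              also have "\<dots> = exp (29 / 100)" by (simp flip: exp_of_nat_mult)
              finally show ?thesis .
            qed
            then have "exp (19 / 100) * (4 / 3) \<le> exp (19 / 100) * exp (29 / 100 :: real)"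
              by (intro mult_left_mono) auto
            then show ?thesis by (simp add: mult_exp_exp)
          qed
          \<comment> \<open>At the largest possible step \<open>h = 5 / 3\<close> the difference of
            the sides is \<open>5 / 3 * (1 - \<alpha>) ^ 2\<close>.\<close>
          moreover have "\<alpha> * (1 + (1 - \<alpha>) * h) \<le> 1 + 2 / 3 * (1 - \<alpha>)"
          proof -
            have "\<alpha> * (1 - \<alpha>) * h \<le> \<alpha> * (1 - \<alpha>) * (5 / 3)"
              using \<alpha> h by (intro mult_left_mono) auto
            moreover have "\<alpha> * (1 + (1 - \<alpha>) * h) = \<alpha> + \<alpha> * (1 - \<alpha>) * h"
              by (simp add: algebra_simps)
            moreover have "0 \<le> (1 - \<alpha>) ^ 2" by simp
            moreover have "1 + 2 / 3 * (1 - \<alpha>) - (\<alpha> + \<alpha> * (1 - \<alpha>) * (5 / 3)) = 5 / 3 * (1 - \<alpha>) ^ 2"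
              by (simp add: power2_eq_square field_simps)
            ultimately show ?thesis by linarith
          qed
          ultimately have "exp (19 / 100) * 4 * (\<alpha> * (1 + (1 - \<alpha>) * h)) \<le> 3 * exp (48 / 100) * (1 + 2 / 3 * (1 - \<alpha>))"
            by (rule mult_mono) (use \<alpha> h den in auto)
          then show ?thesis by (simp only: mult_ac)
        qed
        also have "\<dots> \<le> (1 + x) * (3 * exp (48 / 100) * (1 + 2 / 3 * (1 - \<alpha>)))"
          using x \<alpha> by (simp add: distrib_right)
        finally show ?thesis by (simp only: mult_ac)
      qed
      ultimately show ?thesis using C h by (simp add: max_def)
    qed
    ultimately show thesis using C h L by (intro that[of C h L]) auto
  qed
qed

text \<open>It follows from \<open>1 / \<alpha> - 1 >= 1 - \<alpha>\<close> and
  \<open>ln 2 >= 2 / 3\<close>. Raised to the power \<open>d\<close>, it lets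
  \<open>2 powr (d / \<alpha>)\<close> pay for \<open>2 powr d\<close> and for the last factor in
  \<open>exists_exponents\<close>.\<close>

lemma two_powr_inverse_ge:
  fixes \<alpha> :: real
  assumes "0 < \<alpha>" "\<alpha> < 1"
  shows "2 * (1 + 2 / 3 * (1 - \<alpha>)) \<le> 2 powr (1 / \<alpha>)"
proof -
  have "(1 - \<alpha>) * 1 \<le> (1 - \<alpha>) * (1 / \<alpha>)"
    using assms by (intro mult_left_mono) auto
  then have B: "1 - \<alpha> \<le> 1 / \<alpha> - 1" using assms by (simp add: field_simps)
  have "2 / 3 * (1 - \<alpha>) \<le> ln 2 * (1 - \<alpha>)"
    using ln2_ge_two_thirds assms by (intro mult_right_mono) auto
  then have "1 + 2 / 3 * (1 - \<alpha>) \<le> exp (ln 2 * (1 - \<alpha>))"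
    using exp_ge_add_one_self[of "ln 2 * (1 - \<alpha>)"] by linarith
  also have "\<dots> = 2 powr (1 - \<alpha>)" by (simp add: powr_def mult.commute)
  also have "\<dots> \<le> 2 powr (1 / \<alpha> - 1)" using B by (intro powr_mono) auto
  finally have "2 * (1 + 2 / 3 * (1 - \<alpha>)) \<le> 2 * 2 powr (1 / \<alpha> - 1)"
    by (intro mult_left_mono) auto
  also have "\<dots> = 2 powr (1 / \<alpha>)" by (simp add: powr_diff)
  finally show ?thesis .
qed

lemma one_plus_le_3_powr: "0 \<le> x \<Longrightarrow> x \<le> y \<Longrightarrow> 1 + x \<le> 3 powr (y :: real)"
proof -
  assume x: "0 \<le> x" "x \<le> y"
  have "1 \<le> ln (3 :: real)"
    using exp_le by (simp add: ln_ge_iff)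
  then have "y * 1 \<le> y * ln 3" using x by (intro mult_left_mono) auto
  then have "1 + x \<le> exp (y * ln 3)"
    using exp_ge_add_one_self[of "y * ln 3"] x by linarith
  then show ?thesis by (simp add: powr_def)
qed

text \<open>Up to the factor \<open>2 * ((1 + x) / x) / V\<close>, the right side is the lower bound
  for \<open>kappa powr d\<close> in \<open>kappa_powr_ge\<close>. If \<open>p >= 1\<close>, the
  mass \<open>2 powr M\<close> of a cut-off power is absorbed by \<open>2 powr (p * M)\<close>. If
  \<open>p < 1\<close> that comparison fails, and the two-power profile takes over.\<close>

lemma (in vec_norm) exists_profile:
  assumes r: "0 < r" and \<alpha>: "0 < \<alpha>" "\<alpha> < 1" and p: "0 < p" "r < \<alpha> * p" and M: "M = d / (\<alpha> * p)"
    and x: "x = r / d"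
  obtains G L J where "0 < L" "profile M L G" "0 < J"
    "(\<integral>\<^sup>+ z. ennreal (G (N z powr p)) \<partial>lborel) = ennreal J"
    "max x L * 2 powr d * J
      \<le> 2 powr (p * (1 + M) / (1 + x)) * (x powr (x / (1 + x)) * (1 + x) powr (1 / x)) * 3 powr (d + r) * (V / (1 - \<alpha>))"
proof -
  define T where "T = x powr (x / (1 + x)) * (1 + x) powr (1 / x)"
  have d_pos: "0 < d" using d_ge_1 by simp
  have x_pos: "0 < x" using x r d_pos by simp
  have M_pos: "0 < M" using M d_pos p \<alpha> by simp
  have "M * x = r / (\<alpha> * p)" using M x d_pos by simp
  then have Mx: "M * x < 1" using p \<alpha> by simp
  have pM: "p * M = d / \<alpha>" using M p \<alpha> by simp
  have x_le: "x \<le> r" using x r d_ge_1 divide_left_mono[of 1 d r] by simp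
  \<comment> \<open>The profiles are compared with \<open>2 powr (p * M)\<close>;
    \<open>M * x < 1\<close> shows that the exponent coming from \<open>kappa\<close> is at least as
    large.\<close>
  have exponent: "p * M \<le> p * (1 + M) / (1 + x)"
  proof -
    have "M * (1 + x) \<le> 1 + M" using Mx by (simp add: distrib_left)
    then have "p * (M * (1 + x)) \<le> p * (1 + M)" using p by (intro mult_left_mono) auto
    then show ?thesis using x_pos by (simp add: pos_le_divide_eq mult.assoc)
  qed
  then have two: "2 powr (p * M) \<le> 2 powr (p * (1 + M) / (1 + x))" by (intro powr_mono) auto
  have I_pos: "0 < V / (1 - \<alpha>)" using V_pos \<alpha> by simp
  have three_r: "1 + x \<le> 3 powr r" using x_pos x_le by (intro one_plus_le_3_powr) auto
  show thesis
  proof (cases "1 \<le> p")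
    case True
    \<comment> \<open>The affine bound holds with \<open>b = 1 / 2\<close>, since
      \<open>max 1 y <= 1 + y\<close>.\<close>
    define G where "G y = (max 1 y / 2) powr (- M)" for y :: real
    define J where "J = 2 powr M * (V / (1 - \<alpha>))"
    have J: "0 < J" unfolding J_def using I_pos by (intro mult_pos_pos) auto
    have "profile M 1 G"
    proof (rule profile_of_affine_bound[OF M_pos])
      show "G \<in> borel_measurable borel" unfolding G_def by measurable
      show "G z \<le> G y" if "0 < y" "y \<le> z" for y z
        unfolding G_def using that M_pos by (intro powr_mono2') auto
      show "(1 + 1 / 2 * (y - 1)) powr (- M) \<le> G y" if "0 < y" for y
        unfolding G_def using that M_pos by (intro powr_mono2') (auto simp: field_simps)
    qed (auto simp: G_def)
    moreover have "(\<integral>\<^sup>+ z. ennreal (G (N z powr p)) \<partial>lborel) = ennreal J"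
    proof -
      have "(\<integral>\<^sup>+ z. ennreal (G (N z powr p)) \<partial>lborel)
          = (\<integral>\<^sup>+ z. ennreal (2 powr M) * ennreal (max 1 (N z) powr (- (d / \<alpha>))) \<partial>lborel)"
      proof (rule nn_integral_cong)
        fix z
        have "max 1 (N z powr p) = max 1 (N z) powr p"
        proof (cases "N z \<le> 1")
          case True
          then show ?thesis using p powr_le1[of p "N z"] by (simp add: max_def)
        next
          case False
          then have "1 powr p < N z powr p" using p by (intro powr_less_mono2) auto
          then show ?thesis using False by (simp add: max_def)
        qed
        then have "G (N z powr p) = 2 powr M * max 1 (N z) powr (- (d / \<alpha>))"
          unfolding G_def pM[symmetric] by (simp add: powr_divide powr_powr powr_minus_divide)
        then show "ennreal (G (N z powr p)) = ennreal (2 powr M) * ennreal (max 1 (N z) powr (- (d / \<alpha>)))"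
          by (simp add: ennreal_mult')
      qed
      also have "\<dots> = ennreal (2 powr M) * (\<integral>\<^sup>+ z. ennreal (max 1 (N z) powr (- (d / \<alpha>))) \<partial>lborel)"
        by (intro nn_integral_cmult) measurable
      also have "(\<integral>\<^sup>+ z. ennreal (max 1 (N z) powr (- (d / \<alpha>))) \<partial>lborel) = ennreal (V * (d / \<alpha>) / (d / \<alpha> - d))"
        using \<alpha> d_pos by (intro nn_integral_max_1_powr) (simp add: field_simps)
      also have "V * (d / \<alpha>) / (d / \<alpha> - d) = V / (1 - \<alpha>)"
      proof -
        have "d / \<alpha> - d = (d / \<alpha>) * (1 - \<alpha>)" using \<alpha> by (simp add: right_diff_distrib)
        then show ?thesis using d_pos \<alpha> by simp
      qed
      also have "ennreal (2 powr M) * ennreal (V / (1 - \<alpha>)) = ennreal J"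
        by (simp only: J_def ennreal_mult' powr_ge_zero)
      finally show ?thesis .
    qed
    moreover have "max x 1 * 2 powr d * J
      \<le> 2 powr (p * (1 + M) / (1 + x)) * (x powr (x / (1 + x)) * (1 + x) powr (1 / x)) * 3 powr (d + r) * (V / (1 - \<alpha>))"
    proof -
      have "2 powr M \<le> 2 powr (p * M)" using True M_pos by (intro powr_mono) auto
      with two have 1: "2 powr M \<le> 2 powr (p * (1 + M) / (1 + x))" by linarith
      have 2: "1 \<le> T" unfolding T_def by (rule powr_mix_ge_1[OF x_pos])
      have "max x 1 * 2 powr d \<le> (1 + x) * 3 powr d"
        using x_pos d_pos by (intro mult_mono powr_mono2) auto
      also have "\<dots> \<le> 3 powr r * 3 powr d"
        using three_r by (intro mult_right_mono) auto
      finally have 3: "max x 1 * 2 powr d \<le> 3 powr (d + r)" by (simp add: powr_add mult.commute)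
      have "max x 1 * 2 powr d * J = (2 powr M * 1 * (max x 1 * 2 powr d)) * (V / (1 - \<alpha>))"
        by (simp add: J_def)
      also have "\<dots> \<le> (2 powr (p * (1 + M) / (1 + x)) * T * 3 powr (d + r)) * (V / (1 - \<alpha>))"
        using 1 2 3 I_pos x_pos by (intro mult_right_mono mult_mono) auto
      finally show ?thesis by (simp add: T_def)
    qed
    ultimately show thesis using J by (intro that[of 1 G J]) auto
  next
    case False
    have "r < 1" using p \<alpha> False by (smt (verit) mult_less_cancel_right2)
    then have x_le_1: "x \<le> 1" using x_le by simp
    obtain C h L where C: "0 < C" and h: "0 < h" and L: "0 < L"
      and prof: "profile M L (two_power C (M * lower_odds \<alpha> h) (M * upper_odds \<alpha> h))"
      and le: "max x L * (C * ((2 + h) / h)) \<le> 3 * (1 + x) * exp (48 / 100) * (1 + 2 / 3 * (1 - \<alpha>))"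
      by (rule exists_exponents[OF \<alpha> x_pos x_le_1 M_pos Mx])
    define J where "J = C * (V / (1 - \<alpha>)) * ((2 + h) / h)"
    have J: "0 < J" unfolding J_def using I_pos C h by (intro mult_pos_pos) auto
    note J_int = nn_integral_two_power_odds[OF \<alpha> h p(1) M C, folded J_def]
    have T: "exp (48 / 100) \<le> T" unfolding T_def by (rule exp_le_powr_mix[OF x_pos x_le_1])
    have T_nonneg: "0 \<le> T" by (simp add: T_def)
    \<comment> \<open>As \<open>d >= 1\<close>, raising a number at least 1 to the power
      \<open>d\<close> does not decrease it, so an estimate without \<open>d\<close> serves every
      dimension.\<close>
    have "2 powr d * (1 + 2 / 3 * (1 - \<alpha>)) \<le> 2 powr d * (1 + 2 / 3 * (1 - \<alpha>)) powr d"
      using \<alpha> d_ge_1 by (intro mult_left_mono) (auto intro: order_trans[OF _ powr_mono[of 1 d]])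
    also have "\<dots> = (2 * (1 + 2 / 3 * (1 - \<alpha>))) powr d"
    proof -
      have "0 \<le> 1 + 2 / 3 * (1 - \<alpha>)" using \<alpha> by simp
      then show ?thesis by (simp only: powr_mult zero_le_numeral)
    qed
    also have "\<dots> \<le> (2 powr (1 / \<alpha>)) powr d"
      using two_powr_inverse_ge[OF \<alpha>] \<alpha> d_pos by (intro powr_mono2) auto
    also have "\<dots> = 2 powr (p * M)" by (simp add: powr_powr pM)
    also note two
    finally have 2: "2 powr d * (1 + 2 / 3 * (1 - \<alpha>)) \<le> 2 powr (p * (1 + M) / (1 + x))" .
    have "(3 :: real) powr 1 \<le> 3 powr d" using d_ge_1 by (intro powr_mono) auto
    then have 3: "3 * (1 + x) \<le> 3 powr (d + r)"
      using three_r x_pos unfolding powr_add by (intro mult_mono) auto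
    have "max x L * 2 powr d * J = 2 powr d * (max x L * (C * ((2 + h) / h))) * (V / (1 - \<alpha>))"
      by (simp only: J_def mult_ac)
    also have "\<dots> \<le> 2 powr d * (3 * (1 + x) * exp (48 / 100) * (1 + 2 / 3 * (1 - \<alpha>))) * (V / (1 - \<alpha>))"
      using le I_pos by (intro mult_right_mono mult_left_mono) auto
    also have "\<dots> = (2 powr d * (1 + 2 / 3 * (1 - \<alpha>))) * exp (48 / 100) * (3 * (1 + x)) * (V / (1 - \<alpha>))"
      by (simp only: mult_ac)
    also have "\<dots> \<le> 2 powr (p * (1 + M) / (1 + x)) * T * 3 powr (d + r) * (V / (1 - \<alpha>))"
      using 2 3 T T_nonneg I_pos x_pos \<alpha> by (intro mult_right_mono mult_mono) auto
    finally show thesis unfolding T_def using that[OF L prof J J_int] by blast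
  qed
qed

section \<open>The constant and the dilation\<close>

text \<open>The left side is a nonnegative integral, so integrability of the product is not
  presupposed. Young's inequality is applied to the normalised functions; a vanishing norm, which
  forbids the normalisation, is treated first.\<close>

lemma Holder_nn_integral_le:
  fixes u v :: "'a \<Rightarrow> real" and w w' :: real
  assumes w: "1 < w" "1 < w'" "1 / w + 1 / w' = 1"
    and nonneg: "\<And>x. 0 \<le> u x" "\<And>x. 0 \<le> v x"
    and u: "u \<in> borel_measurable M" "integrable M (\<lambda>x. u x powr w)"
    and v: "v \<in> borel_measurable M" "integrable M (\<lambda>x. v x powr w')"
  shows "(\<integral>\<^sup>+ x. ennreal (u x * v x) \<partial>M)
    \<le> ennreal ((\<integral>x. u x powr w \<partial>M) powr (1 / w) * (\<integral>x. v x powr w' \<partial>M) powr (1 / w'))"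
proof -
  note [measurable] = u(1) v(1)
  define A where "A = (\<integral>x. u x powr w \<partial>M)"
  define B where "B = (\<integral>x. v x powr w' \<partial>M)"
  have zero: "(\<integral>\<^sup>+ x. ennreal (u x * v x) \<partial>M) = 0" if "AE x in M. u x = 0 \<or> v x = 0"
    using that by (subst nn_integral_0_iff_AE) auto
  show ?thesis
  proof (cases "A = 0 \<or> B = 0")
    case True
    have "AE x in M. u x powr w = 0" if "A = 0"
      using that u unfolding A_def by (subst (asm) integral_nonneg_eq_0_iff_AE) auto
    moreover have "AE x in M. v x powr w' = 0" if "B = 0"
      using that v unfolding B_def by (subst (asm) integral_nonneg_eq_0_iff_AE) auto
    ultimately have "(AE x in M. u x = 0) \<or> (AE x in M. v x = 0)" using True by auto
    then have "AE x in M. u x = 0 \<or> v x = 0" by auto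
    from zero[OF this] show ?thesis by simp
  next
    case False
    moreover have "0 \<le> A" "0 \<le> B"
      unfolding A_def B_def by (auto intro!: Bochner_Integration.integral_nonneg)
    ultimately have A: "0 < A" and B: "0 < B" by auto
    define a where "a = A powr (1 / w)"
    define b where "b = B powr (1 / w')"
    have a: "0 < a" "a powr w = A" and b: "0 < b" "b powr w' = B"
      using A B w by (auto simp: a_def b_def powr_powr)
    have int: "integrable M (\<lambda>x. a * b * (u x powr w / A / w + v x powr w' / B / w'))"
      using u v by simp
    have "(\<integral>\<^sup>+ x. ennreal (u x * v x) \<partial>M) \<le> (\<integral>\<^sup>+ x. ennreal (a * b * (u x powr w / A / w + v x powr w' / B / w')) \<partial>M)"
    proof (intro nn_integral_mono ennreal_leI)
      fix x
      have "(u x / a) * (v x / b) \<le> (u x / a) powr w / w + (v x / b) powr w' / w'"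
        using w nonneg a b by (intro Youngs_inequality) auto
      also have "\<dots> = u x powr w / A / w + v x powr w' / B / w'"
        using nonneg a b by (simp add: powr_divide)
      finally have "a * b * ((u x / a) * (v x / b)) \<le> a * b * (u x powr w / A / w + v x powr w' / B / w')"
        using a b by (intro mult_left_mono) auto
      then show "u x * v x \<le> a * b * (u x powr w / A / w + v x powr w' / B / w')"
        using a b by simp
    qed
    also have "\<dots> = ennreal (\<integral>x. a * b * (u x powr w / A / w + v x powr w' / B / w') \<partial>M)"
      using int a b A B w by (intro nn_integral_eq_integral) auto
    also have "(\<integral>x. a * b * (u x powr w / A / w + v x powr w' / B / w') \<partial>M) = a * b * (A / A / w + B / B / w')"
      using u v by (simp add: A_def B_def)
    also have "\<dots> = a * b" using A B w by simp
    finally show ?thesis by (simp add: a_def b_def A_def B_def)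
  qed
qed

text \<open>With \<open>y = (3 * u) powr r\<close> one has
  \<open>phi d r u = (1 - y) * y powr (1 / x) / 3 powr (d + r)\<close>, and the maximum of the
  numerator is \<open>peak (1 / x)\<close>.\<close>

lemma phi_le:
  assumes d: "0 < d" and r: "0 < r" and u: "0 < u" and x: "x = r / d"
  shows "phi d r u \<le> x / (3 powr (d + r) * (1 + x) powr (1 / x + 1))"
proof -
  have x_pos: "0 < x" using x d r by simp
  define y where "y = (3 * u) powr r"
  have y: "0 < y" using u by (simp add: y_def)
  have y_powr: "y powr (1 / x) = 3 powr d * u powr d"
    using u r x by (simp add: y_def powr_powr powr_mult)
  have "1 - y \<le> peak (1 / x) * y powr (- (1 / x)) * 1 powr (1 / x + 1)"
    using x_pos y by (intro peak_tangent) auto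
  then have "(1 - y) * y powr (1 / x) \<le> peak (1 / x) * y powr (- (1 / x)) * y powr (1 / x)"
    by (intro mult_right_mono) auto
  also have "\<dots> = peak (1 / x)" using y by (simp add: powr_minus)
  also have "\<dots> = x / (1 + x) powr (1 / x + 1)"
  proof -
    have "1 / x / (1 / x + 1) = 1 / (1 + x)" "1 / x + 1 = (1 + x) / x"
      using x_pos by (simp_all add: field_simps)
    then have "peak (1 / x) = (1 / (1 + x)) powr (1 / x) / ((1 + x) / x)"
      by (simp only: peak_def)
    then show ?thesis
      using x_pos by (simp add: powr_divide powr_add)
  qed
  finally have "(1 - y) * y powr (1 / x) / 3 powr (d + r) \<le> x / (1 + x) powr (1 / x + 1) / 3 powr (d + r)"
    by (intro divide_right_mono) auto
  moreover have "phi d r u = (1 - y) * y powr (1 / x) / 3 powr (d + r)"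
  proof -
    have "(1 / 3 powr r - u powr r) = (1 - y) / 3 powr r"
      using u by (simp add: y_def powr_mult diff_divide_distrib)
    then show ?thesis unfolding phi_def y_powr by (simp add: powr_add)
  qed
  ultimately show ?thesis by (simp add: mult.commute)
qed

text \<open>The factor \<open>1 + \<epsilon>\<close> is bounded below by 1 and \<open>phi\<close>
  above by its maximum; the result bounds \<open>kappa\<close> from below, the direction in which it
  is used.\<close>

lemma INF_phi_ge:
  assumes d: "0 < d" and r: "0 < r" and x: "x = r / d"
  shows "(3 powr (d + r) * (1 + x) powr (1 / x + 1) / x) powr (1 / d)
    \<le> (INF \<epsilon>\<in>{0<..<1/3}. (1 + \<epsilon>) * phi d r \<epsilon> powr (- 1 / d))"
proof (rule cINF_greatest)
  show "{0<..<1/3 :: real} \<noteq> {}" by simp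
  fix e :: real assume e: "e \<in> {0<..<1/3}"
  have x_pos: "0 < x" using x d r by simp
  define K where "K = 3 powr (d + r) * (1 + x) powr (1 / x + 1) / x"
  have K: "0 < K" using x_pos by (simp add: K_def)
  have "e powr r < (1 / 3) powr r" using e r by (intro powr_less_mono2) auto
  then have phi_pos: "0 < phi d r e" using e by (simp add: phi_def powr_divide)
  have "phi d r e \<le> 1 / K"
    using phi_le[OF d r _ x, of e] e by (simp add: K_def)
  then have "(1 / K) powr (- 1 / d) \<le> phi d r e powr (- 1 / d)"
    using phi_pos d by (intro powr_mono2') auto
  moreover have "(1 / K) powr (- 1 / d) = K powr (1 / d)"
    using K by (simp add: powr_divide powr_minus_divide)
  ultimately have "K powr (1 / d) \<le> phi d r e powr (- 1 / d)" by simp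
  also have "\<dots> \<le> (1 + e) * phi d r e powr (- 1 / d)"
    using e by (simp add: distrib_right)
  finally show "K powr (1 / d) \<le> (1 + e) * phi d r e powr (- 1 / d)" .
qed

context vec_norm
begin

lemma integral_max_1_powr:
  assumes "d < k"
  shows "(\<integral>z. max 1 (N z) powr (- k) \<partial>lborel) = V * k / (k - d)"
proof -
  have "0 \<le> V * k / (k - d)" using assms V_pos d_ge_1 by simp
  then show ?thesis
    using nn_integral_max_1_powr[OF assms] by (subst integral_eq_nn_integral) auto
qed

text \<open>All factors of \<open>kappa\<close> are evaluated exactly except the infimum, which is
  replaced by its lower bound. The leading 2 is the \<open>d\<close>-th power of
  \<open>2 powr (1 / d)\<close> and pays for splitting the steps into two halves.\<close>

lemma kappa_powr_ge:
  fixes r \<delta> \<eta> q p' p \<alpha> M x :: real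
  assumes r: "0 < r" and p: "p = r + \<delta>" and \<alpha>: "\<alpha> = (r + \<delta> - \<eta>) / p" "0 < \<alpha>" "\<alpha> < 1" "0 < p"
    and M: "M = d / (\<alpha> * p)" and qp: "\<bar>q\<bar> * p' = 1 / M" and x: "x = r / d"
  shows "2 * 2 powr (p * (1 + M) / (1 + x)) * (x powr (x / (1 + x)) * (1 + x) powr (1 / x)) * 3 powr (d + r)
      * ((1 + x) / x) / V * (V / (1 - \<alpha>)) \<le> kappa N r \<delta> \<eta> q p' powr d"
    and "0 \<le> kappa N r \<delta> \<eta> q p'"
proof -
  have d_pos: "0 < d" using d_ge_1 by simp
  have x_pos: "0 < x" using x r d_pos by simp
  define K where "K = 3 powr (d + r) * (1 + x) powr (1 / x + 1) / x"
  have K: "0 < K" using x_pos by (simp add: K_def)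
  define F where "F = (INF \<epsilon>\<in>{0<..<1/3}. (1 + \<epsilon>) * phi d r \<epsilon> powr (- 1 / d))"
  have F: "K powr (1 / d) \<le> F"
    unfolding K_def F_def by (rule INF_phi_ge[OF d_pos r x])
  then have F_nonneg: "0 \<le> F" by (rule order_trans[rotated]) simp
  have "(K powr (1 / d)) powr d \<le> F powr d" using F d_pos by (intro powr_mono2) auto
  then have KF: "K \<le> F powr d" using K d_pos by (simp add: powr_powr)
  have "(r + \<delta>) / (r + \<delta> - \<eta>) = 1 / \<alpha>" unfolding \<alpha>(1) p by simp
  then have "- d * ((r + \<delta>) / (r + \<delta> - \<eta>)) = - (d / \<alpha>)" by (simp only:) simp
  moreover have "(\<integral>z. max 1 (N z) powr (- (d / \<alpha>)) \<partial>lborel) = V / (1 - \<alpha>)"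
  proof -
    have "d / \<alpha> - d = (d / \<alpha>) * (1 - \<alpha>)" using \<alpha>(2) by (simp add: right_diff_distrib)
    moreover have "d < d / \<alpha>" using \<alpha>(2,3) d_pos by (simp add: field_simps)
    ultimately show ?thesis
      using integral_max_1_powr[of "d / \<alpha>"] d_pos \<alpha>(2,3) by simp
  qed
  ultimately have I: "(\<integral>z. max 1 (N z) powr (- d * ((r + \<delta>) / (r + \<delta> - \<eta>))) \<partial>lborel) = V / (1 - \<alpha>)"
    by simp
  have I_pos: "0 < V / (1 - \<alpha>)" using V_pos \<alpha> by simp
  have kappa: "kappa N r \<delta> \<eta> q p' = 2 powr (1 / d + p / (r + d) * (1 + M)) * V powr (- 1 / d)
      * x powr (r / (d * (d + r))) * F * (V / (1 - \<alpha>)) powr (1 / d)"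
    unfolding kappa_def Let_def d_eq[symmetric] I qp F_def x p by simp
  show "0 \<le> kappa N r \<delta> \<eta> q p'"
    unfolding kappa using F_nonneg by simp
  have e1: "(1 / d + p / (r + d) * (1 + M)) * d = 1 + p * (1 + M) / (1 + x)"
  proof -
    have c: "d / (r + d) = 1 / (1 + x)" using d_pos r by (simp add: x field_simps)
    have "(1 / d + p / (r + d) * (1 + M)) * d = 1 + p * (1 + M) * (d / (r + d))"
      using d_pos by (simp add: distrib_right)
    then show ?thesis unfolding c by simp
  qed
  have "1 + x = (d + r) / d" using d_pos by (simp add: x add_divide_distrib)
  then have e2: "r / (d * (d + r)) * d = x / (1 + x)"
    using d_pos x by (simp only:) simp
  have "kappa N r \<delta> \<eta> q p' powr d = 2 powr (1 + p * (1 + M) / (1 + x)) * V powr (- 1)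
      * x powr (x / (1 + x)) * F powr d * (V / (1 - \<alpha>))"
  proof -
    have prod: "(a * b * c * f * g) powr d = a powr d * b powr d * c powr d * f powr d * g powr d"
      if "0 \<le> a" "0 \<le> b" "0 \<le> c" "0 \<le> f" "0 \<le> g" for a b c f g :: real
      using that by (simp add: powr_mult)
    have "kappa N r \<delta> \<eta> q p' powr d = (2 powr (1 / d + p / (r + d) * (1 + M))) powr d * (V powr (- 1 / d)) powr d
      * (x powr (r / (d * (d + r)))) powr d * F powr d * ((V / (1 - \<alpha>)) powr (1 / d)) powr d"
      unfolding kappa using F_nonneg by (intro prod) auto
    moreover have "(V powr (- 1 / d)) powr d = V powr (- 1)" "((V / (1 - \<alpha>)) powr (1 / d)) powr d = V / (1 - \<alpha>)"
      using d_pos V_pos \<alpha>(3) by (simp_all only: powr_powr) auto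
    ultimately show ?thesis by (simp only: powr_powr e1 e2)
  qed
  also have "\<dots> \<ge> 2 powr (1 + p * (1 + M) / (1 + x)) * V powr (- 1) * x powr (x / (1 + x)) * K * (V / (1 - \<alpha>))"
    using KF I_pos by (intro mult_right_mono mult_left_mono) auto
  also have "2 powr (1 + p * (1 + M) / (1 + x)) * V powr (- 1) * x powr (x / (1 + x)) * K * (V / (1 - \<alpha>))
    = 2 * 2 powr (p * (1 + M) / (1 + x)) * (x powr (x / (1 + x)) * (1 + x) powr (1 / x)) * 3 powr (d + r)
      * ((1 + x) / x) / V * (V / (1 - \<alpha>))"
    using V_pos x_pos by (simp add: K_def powr_add powr_minus_divide)
  finally show "2 * 2 powr (p * (1 + M) / (1 + x)) * (x powr (x / (1 + x)) * (1 + x) powr (1 / x)) * 3 powr (d + r)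
      * ((1 + x) / x) / V * (V / (1 - \<alpha>)) \<le> kappa N r \<delta> \<eta> q p' powr d" .
qed

end

lemma (in greedy_quantization) greedy_error_bound:
  fixes \<delta> \<eta> q p' \<alpha> t :: real
  assumes p: "p = r + \<delta>" and \<alpha>: "\<alpha> = (r + \<delta> - \<eta>) / p" "\<alpha> < 1" "r < \<alpha> * p"
    and qp: "\<bar>q\<bar> * p' = \<alpha> * p / d" and t: "t = \<alpha> * p * (d + r) / (d + \<alpha> * p)" and n: "3 \<le> n"
  shows "(\<integral>x. D n x powr t \<partial>P) powr (1 / t) \<le> kappa N r \<delta> \<eta> q p' * \<sigma> * (real n - 2) powr (- 1 / d)"
proof -
  have d_pos: "0 < d" using d_ge_1 by simp
  have ap: "0 < \<alpha> * p" using \<alpha>(3) r_pos by simp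
  then have \<alpha>_pos: "0 < \<alpha>" using p_pos by (simp add: zero_less_mult_iff)
  define M where "M = d / (\<alpha> * p)"
  define x where "x = r / d"
  have M: "0 < M" "M * r < d"
    using d_pos ap \<alpha>(3) by (simp_all add: M_def pos_divide_less_eq)
  \<comment> \<open>This relation explains the choice of \<open>t\<close>: the power
    \<open>M + 1\<close> of \<open>D n powr t\<close> is the power \<open>d + r\<close> that occurs
    in the gain.\<close>
  have tM: "t * (M + 1) = d + r"
  proof -
    have "M + 1 = (d + \<alpha> * p) / (\<alpha> * p)" using \<alpha>_pos p_pos by (simp add: M_def add_divide_distrib)
    moreover have "0 < d + \<alpha> * p" using ap d_pos by simp
    ultimately show ?thesis using \<alpha>_pos p_pos by (simp add: t)
  qed
  have rt: "r \<le> t"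
  proof -
    have "r * (d + \<alpha> * p) \<le> \<alpha> * p * (d + r)"
      using \<alpha>(3) d_pos by (simp add: algebra_simps)
    then show ?thesis using ap d_pos unfolding t by (simp add: pos_le_divide_eq)
  qed
  have tp: "t \<le> p"
  proof -
    have "\<alpha> * p * (d + r) \<le> \<alpha> * p * (d + \<alpha> * p)" using \<alpha>(3) ap by (intro mult_left_mono) auto
    then have "t \<le> \<alpha> * p" using ap d_pos unfolding t by (simp add: pos_divide_le_eq)
    also have "\<dots> \<le> 1 * p" using \<alpha>(2) p_pos by (intro mult_right_mono) auto
    finally show ?thesis by simp
  qed
  obtain G L J where L: "0 < L" and G: "profile M L G" and J: "0 < J"
    and J_int: "(\<integral>\<^sup>+ z. ennreal (G (N z powr p)) \<partial>lborel) = ennreal J"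
    and le: "max x L * 2 powr d * J \<le> 2 powr (p * (1 + M) / (1 + x)) * (x powr (x / (1 + x)) * (1 + x) powr (1 / x))
        * 3 powr (d + r) * (V / (1 - \<alpha>))"
    by (rule exists_profile[OF r_pos \<alpha>_pos \<alpha>(2) p_pos \<alpha>(3) M_def x_def])
  have x_pos: "0 < x" using r_pos d_pos by (simp add: x_def)
  \<comment> \<open>The steps are split in the middle: \<open>m - 1\<close> and \<open>n - m\<close>
    are both at least \<open>(n - 2) / 2\<close>, which is the origin of \<open>n - 2\<close> in the
    theorem. For \<open>n >= 3\<close> this gives \<open>2 <= m < n\<close>.\<close>
  define m where "m = (n + 1) div 2"
  have m: "2 \<le> m" "m < n" "n \<le> 2 * m" "2 * m \<le> n + 1" using n by (auto simp: m_def)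
  have "(real n - 2) / 2 \<le> real m - 1" using of_nat_mono[OF m(3), where 'a=real] by simp
  moreover have "(real n - 2) / 2 \<le> real n - real m" using of_nat_mono[OF m(4), where 'a=real] by simp
  ultimately have m': "(real n - 2) / 2 \<le> real m - 1" "(real n - 2) / 2 \<le> real n - real m" .
  have n2: "0 < real n - 2" using n by linarith
  let ?T = "\<integral>x. D n x powr t \<partial>P"
  have "?T powr (d / t) \<le> max (r / d / (real m - 1)) (L / (real n - real m)) * ((d + r) * (2 * \<sigma>) powr d * J / (V * r))"
    by (rule mismatch_error_bound[OF M rt tp tM L G J_int J m(1,2)])
  also have "\<dots> \<le> (max x L / ((real n - 2) / 2)) * ((d + r) * (2 * \<sigma>) powr d * J / (V * r))"
  proof (rule mult_right_mono)
    have "x / (real m - 1) \<le> x / ((real n - 2) / 2)" "L / (real n - real m) \<le> L / ((real n - 2) / 2)"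
      using m' n2 x_pos L m by (intro divide_left_mono mult_pos_pos; simp)+
    moreover have "x / ((real n - 2) / 2) \<le> max x L / ((real n - 2) / 2)" "L / ((real n - 2) / 2) \<le> max x L / ((real n - 2) / 2)"
      using n2 by (intro divide_right_mono; simp)+
    ultimately show "max (r / d / (real m - 1)) (L / (real n - real m)) \<le> max x L / ((real n - 2) / 2)"
      unfolding x_def by linarith
    show "0 \<le> (d + r) * (2 * \<sigma>) powr d * J / (V * r)" using d_pos r_pos J V_pos by simp
  qed
  also have "\<dots> = (max x L * 2 powr d * J) * (2 * ((1 + x) / x) / V * \<sigma> powr d / (real n - 2))"
    using d_pos r_pos \<sigma>_pos V_pos n2 by (simp add: x_def powr_mult field_simps)
  also have "\<dots> \<le> (2 powr (p * (1 + M) / (1 + x)) * (x powr (x / (1 + x)) * (1 + x) powr (1 / x))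
        * 3 powr (d + r) * (V / (1 - \<alpha>))) * (2 * ((1 + x) / x) / V * \<sigma> powr d / (real n - 2))"
    using le n2 x_pos V_pos by (intro mult_right_mono) auto
  also have "\<dots> = (2 * 2 powr (p * (1 + M) / (1 + x)) * (x powr (x / (1 + x)) * (1 + x) powr (1 / x)) * 3 powr (d + r)
      * ((1 + x) / x) / V * (V / (1 - \<alpha>))) * (\<sigma> powr d / (real n - 2))"
    by (simp only: mult_ac divide_inverse)
  also have "\<dots> \<le> kappa N r \<delta> \<eta> q p' powr d * (\<sigma> powr d / (real n - 2))"
    using n2 qp by (intro mult_right_mono kappa_powr_ge(1)[OF r_pos p \<alpha>(1) \<alpha>_pos \<alpha>(2) p_pos M_def _ x_def]) (auto simp: M_def)
  finally have "(?T powr (d / t)) powr (1 / d) \<le> (kappa N r \<delta> \<eta> q p' powr d * (\<sigma> powr d / (real n - 2))) powr (1 / d)"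
    using d_pos by (intro powr_mono2) auto
  moreover have "0 \<le> kappa N r \<delta> \<eta> q p'"
    using qp by (intro kappa_powr_ge(2)[OF r_pos p \<alpha>(1) \<alpha>_pos \<alpha>(2) p_pos M_def _ x_def]) (auto simp: M_def)
  ultimately show ?thesis
    using d_pos \<sigma>_pos n2 by (simp add: powr_mult powr_divide powr_powr powr_minus_divide)
qed

section \<open>Change of variables under the dilation\<close>

context vec_norm
begin

lemma dilate_set_finite: "finite \<Gamma> \<Longrightarrow> finite (dilate_set \<theta> \<mu> \<Gamma>)"
  and dilate_set_nonempty: "\<Gamma> \<noteq> {} \<Longrightarrow> dilate_set \<theta> \<mu> \<Gamma> \<noteq> {}"
  by (simp_all add: dilate_set_def)

lemma ndist_dilate_set:
  assumes "finite \<Gamma>" "\<Gamma> \<noteq> {}" "0 < \<theta>"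
  shows "ndist (dilate_set \<theta> \<mu> \<Gamma>) (\<mu> + \<theta> *\<^sub>R (x - \<mu>)) = \<theta> * ndist \<Gamma> x"
proof -
  have "N ((\<mu> + \<theta> *\<^sub>R (x - \<mu>)) - (\<mu> + \<theta> *\<^sub>R (y - \<mu>))) = \<theta> * N (x - y)" for y
  proof -
    have "(\<mu> + \<theta> *\<^sub>R (x - \<mu>)) - (\<mu> + \<theta> *\<^sub>R (y - \<mu>)) = \<theta> *\<^sub>R (x - y)"
      by (simp add: algebra_simps)
    then show ?thesis using assms(3) by (simp only: N_scaleR abs_of_pos)
  qed
  then have "ndist (dilate_set \<theta> \<mu> \<Gamma>) (\<mu> + \<theta> *\<^sub>R (x - \<mu>)) = Min ((\<lambda>t. \<theta> * t) ` ((\<lambda>y. N (x - y)) ` \<Gamma>))"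
    unfolding ndist_def dilate_set_def image_image by simp
  also have "\<dots> = \<theta> * ndist \<Gamma> x"
    unfolding ndist_def using assms
    by (intro mono_Min_commute[symmetric] monoI mult_left_mono) auto
  finally show ?thesis .
qed

text \<open>The substitution multiplies distances by \<open>\<theta>\<close> and volume by
  \<open>\<theta> powr d\<close>, and turns the density into \<open>f x * g x\<close>, with
  \<open>g\<close> the density ratio. Hoelder's inequality under \<open>P\<close> then separates
  \<open>g\<close> from the distance to the original points.\<close>

lemma dilated_error_le:
  fixes f :: "real ^ 'd \<Rightarrow> real" and P :: "(real ^ 'd) measure"
  assumes f [measurable]: "f \<in> borel_measurable borel" and f_nonneg: "\<And>x. 0 \<le> f x"
    and P: "P = density lborel (\<lambda>x. ennreal (f x))"
    and \<theta>: "0 < \<theta>" and s: "0 < s" and w: "1 < w" "1 < w'" "1 / w + 1 / w' = 1"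
    and \<Gamma>: "finite \<Gamma>" "\<Gamma> \<noteq> {}"
    and abs_cont: "AE x in lborel. f x = 0 \<longrightarrow> dilate_fun \<theta> \<mu> f x = 0"
    and H: "set_integrable lborel {x. f x > 0} (\<lambda>x. (dilate_fun \<theta> \<mu> f x / f x) powr w * f x)"
    and int: "integrable P (\<lambda>x. ndist \<Gamma> x powr (s * w'))"
  shows "quant_error N s (dilate_set \<theta> \<mu> \<Gamma>) P
    \<le> ennreal (\<theta> powr (1 + d / s)
        * (LINT x:{x. f x > 0}|lborel. (dilate_fun \<theta> \<mu> f x / f x) powr w * f x) powr (1 / (w * s))
        * (\<integral>x. ndist \<Gamma> x powr (s * w') \<partial>P) powr (1 / (s * w')))"
proof -
  let ?\<Gamma>' = "dilate_set \<theta> \<mu> \<Gamma>"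
  note \<Gamma>' = dilate_set_finite[OF \<Gamma>(1)] dilate_set_nonempty[OF \<Gamma>(2)]
  have [measurable]: "ndist \<Gamma> \<in> borel_measurable borel" "ndist ?\<Gamma>' \<in> borel_measurable borel"
    using \<Gamma> \<Gamma>' by (auto intro: ndist_measurable)
  have [measurable]: "dilate_fun \<theta> \<mu> f \<in> borel_measurable borel"
    unfolding dilate_fun_def[abs_def] by measurable
  define g where "g x = dilate_fun \<theta> \<mu> f x / f x" for x
  have g_meas [measurable]: "g \<in> borel_measurable borel" unfolding g_def by measurable
  have g_nonneg: "0 \<le> g x" for x using f_nonneg by (simp add: g_def dilate_fun_def)
  have fg: "f x * (g x powr w) = indicator {x. f x > 0} x *\<^sub>R (g x powr w * f x)" for x
    using f_nonneg[of x] by (auto simp: indicator_def)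
  define A where "A = (LINT x:{x. f x > 0}|lborel. g x powr w * f x)"
  have g_int: "integrable P (\<lambda>x. g x powr w)"
  proof -
    have "integrable lborel (\<lambda>x. indicator {x. f x > 0} x *\<^sub>R (g x powr w * f x))"
      using H by (simp add: set_integrable_def g_def)
    then have "integrable lborel (\<lambda>x. f x * (g x powr w))" by (simp only: fg)
    then show ?thesis unfolding P using f_nonneg by (subst integrable_density) auto
  qed
  have g_val: "(\<integral>x. g x powr w \<partial>P) = A"
    unfolding P A_def set_lebesgue_integral_def using f_nonneg
    by (subst integral_density) (auto simp: fg)
  define B where "B = (\<integral>x. ndist \<Gamma> x powr (s * w') \<partial>P)"
  have "(\<integral>\<^sup>+ x. ennreal (ndist ?\<Gamma>' x powr s) \<partial>P) = (\<integral>\<^sup>+ x. ennreal (f x) * ennreal (ndist ?\<Gamma>' x powr s) \<partial>lborel)"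
    unfolding P by (subst nn_integral_density) auto
  also have "\<dots> = ennreal (\<theta> powr d) * (\<integral>\<^sup>+ x. ennreal (f ((\<mu> - \<theta> *\<^sub>R \<mu>) + \<theta> *\<^sub>R x))
      * ennreal (ndist ?\<Gamma>' ((\<mu> - \<theta> *\<^sub>R \<mu>) + \<theta> *\<^sub>R x) powr s) \<partial>lborel)"
    using \<theta> by (intro nn_integral_affine) auto
  also have "(\<integral>\<^sup>+ x. ennreal (f ((\<mu> - \<theta> *\<^sub>R \<mu>) + \<theta> *\<^sub>R x))
      * ennreal (ndist ?\<Gamma>' ((\<mu> - \<theta> *\<^sub>R \<mu>) + \<theta> *\<^sub>R x) powr s) \<partial>lborel)
      = (\<integral>\<^sup>+ x. ennreal (\<theta> powr s) * (ennreal (f x) * ennreal (g x * ndist \<Gamma> x powr s)) \<partial>lborel)"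
  proof (rule nn_integral_cong_AE)
    show "AE x in lborel. ennreal (f ((\<mu> - \<theta> *\<^sub>R \<mu>) + \<theta> *\<^sub>R x))
        * ennreal (ndist ?\<Gamma>' ((\<mu> - \<theta> *\<^sub>R \<mu>) + \<theta> *\<^sub>R x) powr s)
        = ennreal (\<theta> powr s) * (ennreal (f x) * ennreal (g x * ndist \<Gamma> x powr s))"
      using abs_cont
    proof eventually_elim
      case (elim x)
      have pt: "(\<mu> - \<theta> *\<^sub>R \<mu>) + \<theta> *\<^sub>R x = \<mu> + \<theta> *\<^sub>R (x - \<mu>)" by (simp add: algebra_simps)
      \<comment> \<open>Where \<open>f x = 0\<close>, division by 0 makes \<open>g x = 0\<close>,
        and \<open>abs_cont\<close> makes the left side 0 as well.\<close>
      have "f (\<mu> + \<theta> *\<^sub>R (x - \<mu>)) = f x * g x"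
        using elim by (auto simp: g_def dilate_fun_def)
      moreover have "ndist ?\<Gamma>' (\<mu> + \<theta> *\<^sub>R (x - \<mu>)) powr s = \<theta> powr s * ndist \<Gamma> x powr s"
        using \<theta> \<Gamma> ndist_nonneg[OF \<Gamma>, of x] by (simp add: ndist_dilate_set powr_mult)
      ultimately show ?case
        unfolding pt using f_nonneg[of x] g_nonneg[of x] by (simp add: ennreal_mult'[symmetric] mult_ac)
    qed
  qed
  also have "\<dots> = ennreal (\<theta> powr s) * (\<integral>\<^sup>+ x. ennreal (f x) * ennreal (g x * ndist \<Gamma> x powr s) \<partial>lborel)"
    by (intro nn_integral_cmult) measurable
  also have "(\<integral>\<^sup>+ x. ennreal (f x) * ennreal (g x * ndist \<Gamma> x powr s) \<partial>lborel) = (\<integral>\<^sup>+ x. ennreal (g x * ndist \<Gamma> x powr s) \<partial>P)"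
    unfolding P by (subst nn_integral_density) auto
  finally have eq: "(\<integral>\<^sup>+ x. ennreal (ndist ?\<Gamma>' x powr s) \<partial>P)
      = ennreal (\<theta> powr d) * (ennreal (\<theta> powr s) * (\<integral>\<^sup>+ x. ennreal (g x * ndist \<Gamma> x powr s) \<partial>P))" .
  have P_borel: "sets P = sets borel" by (simp add: P)
  have "(\<integral>\<^sup>+ x. ennreal (g x * ndist \<Gamma> x powr s) \<partial>P)
    \<le> ennreal ((\<integral>x. g x powr w \<partial>P) powr (1 / w) * (\<integral>x. (ndist \<Gamma> x powr s) powr w' \<partial>P) powr (1 / w'))"
    using g_int int P_borel g_nonneg
    by (intro Holder_nn_integral_le[OF w]) (auto simp: powr_powr measurable_cong_sets[OF P_borel refl])
  also have "\<dots> = ennreal (A powr (1 / w) * B powr (1 / w'))"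
    by (simp add: g_val B_def powr_powr)
  finally have "(\<integral>\<^sup>+ x. ennreal (ndist ?\<Gamma>' x powr s) \<partial>P)
      \<le> ennreal (\<theta> powr d) * (ennreal (\<theta> powr s) * ennreal (A powr (1 / w) * B powr (1 / w')))"
    unfolding eq by (intro mult_left_mono) auto
  also have "\<dots> = ennreal (\<theta> powr (d + s) * (A powr (1 / w) * B powr (1 / w')))"
    by (simp add: ennreal_mult'[symmetric] powr_add mult.assoc)
  finally have "epowr (\<integral>\<^sup>+ x. ennreal (ndist ?\<Gamma>' x powr s) \<partial>P) (1 / s)
      \<le> epowr (ennreal (\<theta> powr (d + s) * (A powr (1 / w) * B powr (1 / w')))) (1 / s)"
    using s by (simp add: epowr_le_iff)
  also have "\<dots> = ennreal ((\<theta> powr (d + s) * (A powr (1 / w) * B powr (1 / w'))) powr (1 / s))"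
    by (simp add: epowr_def)
  also have "(\<theta> powr (d + s) * (A powr (1 / w) * B powr (1 / w'))) powr (1 / s)
      = \<theta> powr (1 + d / s) * A powr (1 / (w * s)) * B powr (1 / (s * w'))"
  proof -
    have "(d + s) * (1 / s) = 1 + d / s" using s by (simp add: field_simps)
    then show ?thesis by (simp add: powr_mult powr_powr mult.commute)
  qed
  finally show ?thesis
    using \<Gamma>' s by (simp add: quant_error_eq A_def B_def g_def)
qed

end

theorem theorem3p1:
  fixes N :: "real ^ 'd \<Rightarrow> real"
    and M :: "'w measure" and X :: "'w \<Rightarrow> real ^ 'd" and P :: "(real ^ 'd) measure"
    and f :: "real ^ 'd \<Rightarrow> real" and a :: "nat \<Rightarrow> real ^ 'd" and \<mu> :: "real ^ 'd"
    and d r \<theta> s q \<delta> \<eta> p' q' :: real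
  assumes norm: "is_norm N"
    and d: "d = real CARD('d)"
    and r: "0 < r" and \<theta>: "0 < \<theta>"
    and s: "r \<le> s" "s < d + r"
    and q: "1 - q = (d + r) / (d + r - s)"
    and prob: "prob_space M"
    and f_nonneg: "\<And>x. 0 \<le> f x"
    and X: "distributed M lborel X (\<lambda>x. ennreal (f x))"
    and P: "P = distr M lborel X"
    and \<delta>: "0 < \<delta>" "r + \<delta> > s * d / (d + r - s)"
    and moment: "integrable M (\<lambda>\<omega>. N (X \<omega>) powr (r + \<delta>))"
    and greedy: "greedy_sequence N r P a"
    and \<eta>: "\<eta> \<in> {0<..<r + \<delta> - s * d / (d + r - s)}"
    and p': "p' = (r + \<delta> - \<eta>) / (d * \<bar>q\<bar>)"
    and q': "q' = (r + \<delta> - \<eta>) / (r + \<delta> - \<eta> - d * \<bar>q\<bar>)"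
    (* implicit in the source: the density ratio below only sees the set where f > 0 *)
    and abs_cont: "AE x in lborel. f x = 0 \<longrightarrow> dilate_fun \<theta> \<mu> f x = 0"
    and finite_integral:
      "set_integrable lborel {x. f x > 0}
         (\<lambda>x. (dilate_fun \<theta> \<mu> f x / f x) powr ((1 - q) * q') * f x)"
  shows "q = - s / (d + r - s) \<and> q < 0 \<and> p' > 1 \<and> q' > 1 \<and> 1 / p' + 1 / q' = 1 \<and>
    quant_error N (r + \<delta>) (first_points a 1) P =
      epowr (\<integral>\<^sup>+ \<omega>. ennreal (N (X \<omega> - a 1) powr (r + \<delta>)) \<partial>M) (1 / (r + \<delta>)) \<and>
    quant_error N (r + \<delta>) (first_points a 1) P < \<infinity> \<and>
    (\<forall>n\<ge>3.
      quant_error N s (dilate_set \<theta> \<mu> (first_points a n)) P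
      \<le> ennreal (\<theta> powr (1 + d / s) * kappa N r \<delta> \<eta> q p'
            * (LINT x:{x. f x > 0}|lborel.
                 (dilate_fun \<theta> \<mu> f x / f x) powr ((1 - q) * q') * f x)
              powr (1 / (q' * \<bar>q\<bar> * (d + r))))
        * quant_error N (r + \<delta>) (first_points a 1) P
        * ennreal ((real n - 2) powr (- 1 / d)))"
proof -
  interpret vec_norm N d
    using norm d by unfold_locales auto
  interpret M: prob_space M by (rule prob)
  define p where "p = r + \<delta>"
  define \<rho> where "\<rho> = r + \<delta> - \<eta>"
  define e where "e = d + r - s"
  have d_pos: "0 < d" using d_ge_1 by simp
  have e: "0 < e" using s by (simp add: e_def)
  have s_pos: "0 < s" using s r by simp
  have q_eq: "q = - s / e"
  proof -
    have "q = 1 - (d + r) / e" using q by (simp add: e_def)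
    also have "\<dots> = - s / e" using e by (simp add: diff_divide_eq_iff) (simp add: e_def)
    finally show ?thesis .
  qed
  have q_abs: "\<bar>q\<bar> = s / e" using q_eq e s_pos by simp
  have \<rho>: "s * d / e < \<rho>" "\<rho> < p" using \<eta> by (auto simp: \<rho>_def p_def e_def)
  \<comment> \<open>Since \<open>s >= r\<close>, the threshold in the moment condition is at least
    \<open>r\<close>, so the reduced order \<open>\<rho>\<close> still exceeds
    \<open>r\<close>.\<close>
  have r_le: "r \<le> s * d / e"
  proof -
    have "r * (d + r) \<le> s * (d + r)" using s d_pos r by (intro mult_right_mono) auto
    then have "r * e \<le> s * d" by (simp add: e_def algebra_simps)
    then show ?thesis using e by (simp add: pos_le_divide_eq)
  qed
  have r\<rho>: "r < \<rho>" using \<rho> r_le by simp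
  have \<rho>_pos: "0 < \<rho>" and p_pos: "0 < p" using r\<rho> r \<rho> by auto
  \<comment> \<open>The denominator of \<open>q'\<close> cleared of fractions. Its positivity is the
    upper limit on \<open>\<eta>\<close>, and it makes \<open>p'\<close>, \<open>q'\<close> and the
    later exponent \<open>w\<close> explicit quotients.\<close>
  define b where "b = \<rho> * e - s * d"
  have b: "0 < b" using \<rho>(1) e by (simp add: b_def pos_divide_less_eq)
  have b_eq: "b = \<rho> * (d + r) - s * (d + \<rho>)" by (simp add: b_def e_def algebra_simps)
  have p'_eq: "p' = \<rho> * e / (s * d)" using p' q_abs by (simp add: \<rho>_def mult.commute)
  have q'_eq: "q' = \<rho> * e / b"
  proof -
    have "\<rho> - d * (s / e) = b / e" using e by (simp add: b_def diff_divide_distrib mult.commute)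
    then show ?thesis using q' q_abs by (simp add: \<rho>_def)
  qed
  have p'_gt: "1 < p'" unfolding p'_eq using b s_pos d_pos by (simp add: b_def)
  have q'_gt: "1 < q'" unfolding q'_eq using b s_pos d_pos by (simp add: b_def)
  have conj: "1 / p' + 1 / q' = 1"
    unfolding p'_eq q'_eq using \<rho>_pos e by (simp add: add_divide_distrib[symmetric] b_def)

  have f_meas: "f \<in> borel_measurable borel"
  proof -
    \<comment> \<open>\<open>X\<close> provides measurability of \<open>ennreal (f x)\<close> only;
      \<open>f\<close> is recovered from it because it is nonnegative.\<close>
    have "(\<lambda>x. enn2real (ennreal (f x))) \<in> borel_measurable lborel"
      using distributed_borel_measurable[OF X] by measurable
    then show ?thesis using f_nonneg by simp
  qed
  have X_meas [measurable]: "X \<in> M \<rightarrow>\<^sub>M borel"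
    using distributed_measurable[OF X] by simp
  have P_density: "P = density lborel (\<lambda>x. ennreal (f x))"
    unfolding P by (rule distributed_distr_eq_density[OF X])
  have P_borel: "sets P = sets borel" by (simp add: P)
  note [measurable_cong] = P_borel
  interpret P: prob_space P
  proof -
    have "X \<in> M \<rightarrow>\<^sub>M lborel" by simp
    then show "prob_space P" unfolding P by (rule M.prob_space_distr)
  qed
  have no_atom: "AE x in P. x \<noteq> a 1"
  proof -
    have "AE x in lborel. x \<noteq> a 1" by (rule AE_lborel_singleton)
    then show ?thesis unfolding P_density using f_meas by (subst AE_density) auto
  qed
  have moment_a: "integrable P (\<lambda>x. N (x - a 1) powr p)"
  proof (rule Bochner_Integration.integrable_bound)
    have "integrable P (\<lambda>x. N x powr p)"
      unfolding P p_def using moment by (subst integrable_distr_eq) auto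
    then show "integrable P (\<lambda>x. 2 powr p * (N x powr p + N (a 1) powr p))" by simp
    show "AE x in P. norm (N (x - a 1) powr p) \<le> norm (2 powr p * (N x powr p + N (a 1) powr p))"
    proof (rule AE_I2)
      \<comment> \<open>Passing through the maximum also covers \<open>p < 1\<close>, where
        convexity of the power fails.\<close>
      fix x
      have "N (x - a 1) \<le> N x + N (a 1)" using N_triangle[of x "- a 1"] by simp
      also have "\<dots> \<le> 2 * max (N x) (N (a 1))" by simp
      finally have "N (x - a 1) powr p \<le> (2 * max (N x) (N (a 1))) powr p"
        using p_pos by (intro powr_mono2) auto
      also have "\<dots> = 2 powr p * max (N x) (N (a 1)) powr p"
        by (rule powr_mult)
      also have "\<dots> \<le> 2 powr p * (N x powr p + N (a 1) powr p)"
        by (intro mult_left_mono) (auto simp: max_def)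
      finally show "norm (N (x - a 1) powr p) \<le> norm (2 powr p * (N x powr p + N (a 1) powr p))"
        by simp
    qed
  qed measurable
  define S where "S = (\<integral>x. N (x - a 1) powr p \<partial>P)"
  have S: "0 < S"
  proof -
    have "S \<noteq> 0"
    proof
      assume "S = 0"
      then have "AE x in P. N (x - a 1) powr p = 0"
        using moment_a unfolding S_def by (subst (asm) integral_nonneg_eq_0_iff_AE) auto
      with no_atom have "AE x in P. False" by eventually_elim simp
      then show False by simp
    qed
    moreover have "0 \<le> S" unfolding S_def by (intro Bochner_Integration.integral_nonneg) auto
    ultimately show ?thesis by simp
  qed
  define \<sigma> where "\<sigma> = S powr (1 / p)"
  have \<sigma>: "0 < \<sigma>" "\<sigma> powr p = S" using S p_pos by (auto simp: \<sigma>_def powr_powr)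
  interpret greedy_quantization N d P a r p \<sigma>
    using r r\<rho> \<rho> \<sigma> moment_a no_atom greedy P_borel by unfold_locales (auto simp: S_def)

  have first: "first_points a 1 = {a 1}" by (simp add: first_points_def)
  have quant_1: "quant_error N p (first_points a 1) P = epowr (\<integral>\<^sup>+ x. ennreal (N (x - a 1) powr p) \<partial>P) (1 / p)"
    unfolding first by (simp add: quant_error_def)
  have part1: "quant_error N (r + \<delta>) (first_points a 1) P =
      epowr (\<integral>\<^sup>+ \<omega>. ennreal (N (X \<omega> - a 1) powr (r + \<delta>)) \<partial>M) (1 / (r + \<delta>))"
    unfolding p_def[symmetric] quant_1 unfolding P by (subst nn_integral_distr) auto
  have quant_\<sigma>: "quant_error N (r + \<delta>) (first_points a 1) P = ennreal \<sigma>"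
  proof -
    have "(\<integral>\<^sup>+ x. ennreal (N (x - a 1) powr p) \<partial>P) = ennreal S"
      unfolding S_def using moment_a by (intro nn_integral_eq_integral) auto
    then show ?thesis unfolding p_def[symmetric] quant_1 using S by (simp add: epowr_def \<sigma>_def)
  qed

  define \<alpha> where "\<alpha> = \<rho> / p"
  have \<alpha>p: "\<alpha> * p = \<rho>" using p_pos by (simp add: \<alpha>_def)
  have \<alpha>: "\<alpha> = (r + \<delta> - \<eta>) / p" "\<alpha> < 1" "r < \<alpha> * p"
    using \<rho> p_pos r\<rho> by (simp_all add: \<alpha>p) (simp_all add: \<alpha>_def \<rho>_def)
  define t where "t = \<alpha> * p * (d + r) / (d + \<alpha> * p)"
  have t_eq: "t = \<rho> * (d + r) / (d + \<rho>)" by (simp add: t_def \<alpha>p)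
  \<comment> \<open>\<open>w\<close> is the Hoelder exponent of the density ratio. Its conjugate is
    \<open>t / s\<close>, so the distance enters with order \<open>s * w' = t\<close>, the order
    treated by \<open>greedy_error_bound\<close>.\<close>
  define w where "w = (1 - q) * q'"
  define w' where "w' = t / s"
  have w_eq: "w = \<rho> * (d + r) / b"
    unfolding w_def q q'_eq e_def[symmetric] using e by simp
  have inv: "1 / w + 1 / w' = 1"
  proof -
    have "1 / w + 1 / w' = b / (\<rho> * (d + r)) + s * (d + \<rho>) / (\<rho> * (d + r))"
      by (simp add: w_eq w'_def t_eq)
    also have "\<dots> = 1" using \<rho>_pos d_pos r by (simp add: add_divide_distrib[symmetric] b_eq)
    finally show ?thesis .
  qed
  have w_gt: "1 < w"
    unfolding w_eq using b s_pos d_pos \<rho>_pos by (simp add: b_eq)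
  have w'_gt: "1 < w'"
  proof -
    have "s * (d + \<rho>) < \<rho> * (d + r)" using b by (simp add: b_eq)
    then show ?thesis
      unfolding w'_def t_eq using s_pos d_pos \<rho>_pos by (simp add: pos_less_divide_eq mult.commute)
  qed
  have sw': "s * w' = t" using s_pos by (simp add: w'_def)
  have t: "0 < t" "t \<le> p"
  proof -
    show "0 < t" using \<rho>_pos d_pos r by (simp add: t_eq)
    have "\<rho> * (d + r) \<le> \<rho> * (d + \<rho>)" using r\<rho> \<rho>_pos by (intro mult_left_mono) auto
    then have "t \<le> \<rho>" using \<rho>_pos d_pos by (simp add: t_eq pos_divide_le_eq)
    then show "t \<le> p" using \<rho> by simp
  qed
  have exponent: "q' * \<bar>q\<bar> * (d + r) = w * s"
  proof -
    have "\<bar>q\<bar> * (d + r) = (1 - q) * s" unfolding q_abs q e_def[symmetric] by simp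
    then show ?thesis by (simp add: w_def mult_ac)
  qed
  have qp: "\<bar>q\<bar> * p' = \<alpha> * p / d"
    unfolding q_abs p'_eq \<alpha>p using e s_pos by simp
  define H where "H = (LINT x:{x. f x > 0}|lborel. (dilate_fun \<theta> \<mu> f x / f x) powr w * f x)"
  have bound: "quant_error N s (dilate_set \<theta> \<mu> (first_points a n)) P
      \<le> ennreal (\<theta> powr (1 + d / s) * kappa N r \<delta> \<eta> q p' * H powr (1 / (q' * \<bar>q\<bar> * (d + r))))
        * quant_error N (r + \<delta>) (first_points a 1) P
        * ennreal ((real n - 2) powr (- 1 / d))" if n: "3 \<le> n" for n
  proof -
    have n1: "1 \<le> n" using n by simp
    let ?T = "\<integral>x. D n x powr t \<partial>P"
    have "quant_error N s (dilate_set \<theta> \<mu> (first_points a n)) P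
        \<le> ennreal (\<theta> powr (1 + d / s) * H powr (1 / (w * s)) * ?T powr (1 / t))"
      unfolding H_def sw'[symmetric]
    proof (rule dilated_error_le[OF f_meas f_nonneg P_density \<theta> s_pos w_gt w'_gt inv _ _ abs_cont])
      show "set_integrable lborel {x. f x > 0} (\<lambda>x. (dilate_fun \<theta> \<mu> f x / f x) powr w * f x)"
        unfolding w_def by (rule finite_integral)
      show "integrable P (\<lambda>x. D n x powr (s * w'))"
        unfolding sw' using n1 t by (rule integrable_powr_D)
    qed (use n1 in auto)
    also have "\<dots> \<le> ennreal (\<theta> powr (1 + d / s) * H powr (1 / (w * s))
        * (kappa N r \<delta> \<eta> q p' * \<sigma> * (real n - 2) powr (- 1 / d)))"
      by (intro ennreal_leI mult_left_mono greedy_error_bound[OF p_def \<alpha> qp t_def n]) auto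
    also have "\<dots> = ennreal ((\<theta> powr (1 + d / s) * kappa N r \<delta> \<eta> q p' * H powr (1 / (w * s))) * (\<sigma> * (real n - 2) powr (- 1 / d)))"
      by (simp only: mult_ac)
    also have "\<dots> = ennreal (\<theta> powr (1 + d / s) * kappa N r \<delta> \<eta> q p' * H powr (1 / (w * s))) * (ennreal \<sigma> * ennreal ((real n - 2) powr (- 1 / d)))"
      using \<sigma> by (simp add: ennreal_mult''[symmetric])
    finally show ?thesis unfolding quant_\<sigma> exponent by (simp only: mult.assoc)
  qed
  have q_neg: "q < 0" using q_eq e s_pos by simp
  have finite_\<sigma>: "quant_error N (r + \<delta>) (first_points a 1) P < \<infinity>"
    unfolding quant_\<sigma> by simp
  show ?thesis
    using q_eq[unfolded e_def] q_neg p'_gt q'_gt conj part1 finite_\<sigma> bound[unfolded H_def w_def]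
    by (intro conjI allI impI) assumption+
qed

end
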